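(* Let $A$ be a bialgebra over a field $k$ and let $M,N$ be Hopf bimodules over $A$. For $n,p\ge 0$ let $T^{n,p}(M,N)\subseteq C^{n,p}(M,N)=\mathrm{Hom}_k(A^{\otimes n}\otimes M,N\otimes A^{\otimes p})$ be the subspace of maps that are both right $A$-linear and left $A$-colinear for the right $A$-module and left $A$-comodule structures on $A^{\otimes n}\otimes M$ and $N\otimes A^{\otimes p}$ given in the context. Let $d_m^{n,p}:C^{n,p}(M,N)\to C^{n+1,p}(M,N)$ and $d_c^{n,p}:C^{n,p}(M,N)\to C^{n,p+1}(M,N)$ be the differentials defined in the context. Then for all $n,p\ge0$ $$d_m^{n,p}(T^{n,p}(M,N))\subseteq T^{n+1,p}(M,N),\qquad d_c^{n,p}(T^{n,p}(M,N))\subseteq T^{n,p+1}(M,N),$$ hence $(T^{n,p}(M,N),d_m^{n,p},d_c^{n,p})$ is a double complex.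
   Context: $k$ is a field, all linear spaces, tensor products and Homs are over $k$; $A^n$ denotes $A^{\otimes n}$ with $A^0=k$. Sweedler notation: $\Delta(a)=\sum a_1\otimes a_2$, iterated $\sum a_1\otimes\cdots\otimes a_{r}$. A Hopf bimodule (two-sided two-cosided Hopf module) over $A$ is a $k$-space $M$ that is an $A$-bimodule and an $A$-bicomodule, with right coaction $m\mapsto\sum m_0\otimes m_1\in M\otimes A$ and left coaction $m\mapsto \sum m_{(-1)}\otimes m_{(0)}\in A\otimes M$, such that each of the two coactions is compatible with each of the two actions in the Hopf-module sense: $\sum(a\cdot m)_0\otimes(a\cdot m)_1=\sum a_1\cdot m_0\otimes a_2m_1$, $\sum(m\cdot a)_0\otimes(m\cdot a)_1=\sum m_0\cdot a_1\otimes m_1a_2$, $\sum(a\cdot m)_{(-1)}\otimes(a\cdot m)_{(0)}=\sum a_1m_{(-1)}\otimes a_2\cdot m_{(0)}$, $\sum(m\cdot a)_{(-1)}\otimes(m\cdot a)_{(0)}=\sum m_{(-1)}a_1\otimes m_{(0)}\cdot a_2$. Right $A$-module structures: on $A^n\otimes M$, $(a^1\otimes\cdots\otimes a^n\otimes m)\cdot b=a^1\otimes\cdots\otimes a^n\otimes m\cdot b$; on $N\otimes A^p$, $(x\otimes a^1\otimes\cdots\otimes a^p)\cdot b=\sum x\cdot b_1\otimes a^1b_2\otimes\cdots\otimes a^pb_{p+1}$. Left $A$-comodule structures: on $A^n\otimes M$, $a^1\otimes\cdots\otimes a^n\otimes m\mapsto\sum (a^1)_1\cdots(a^n)_1m_{(-1)}\otimes(a^1)_2\otimes\cdots\otimes(a^n)_2\otimes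 m_{(0)}$; on $N\otimes A^p$, $x\otimes a^1\otimes\cdots\otimes a^p\mapsto\sum x_{(-1)}\otimes x_{(0)}\otimes a^1\otimes\cdots\otimes a^p$. Differentials on $C^{n,p}(M,N)$ (using only the left action and right coaction of $M,N$): for $f\in C^{n,p}(M,N)$ write $f(x)=\sum f(x)^0\otimes f(x)^1\otimes\cdots\otimes f(x)^p$ with $f(x)^0\in N$, $f(x)^j\in A$ for $j\ge1$. Superscripts on $a^1,\dots,a^n\in A$ are indices. Maps $b_i^{n,p}:C^{n,p}\to C^{n+1,p}$, $0\le i\le n+1$: - $b_0^{n,p}(f)(a^1\otimes\cdots\otimes a^{n+1}\otimes m)=\sum (a^1)_1\cdot f(x)^0\otimes (a^1)_2f(x)^1\otimes\cdots\otimes(a^1)_{p+1}f(x)^p$, with $x=a^2\otimes\cdots\otimes a^{n+1}\otimes m$; - $b_i^{n,p}(f)(a^1\otimes\cdots\otimes a^{n+1}\otimes m)=f(a^1\otimes\cdots\otimes a^ia^{i+1}\otimes\cdots\otimes a^{n+1}\otimes m)$ for $1\le i\le n$; - $b_{n+1}^{n,p}(f)(a^1\otimes\cdots\otimes a^{n+1}\otimes m)=f(a^1\otimes\cdots\otimes a^n\otimes a^{n+1}\cdot m)$. Maps $c_i^{n,p}:C^{n,p}\to C^{n,p+1}$, $0\le i\le p+1$: - $c_0^{n,p}(f)(x)=\sum (f(x)^0)_0\otimes (f(x)^0)_1\otimes f(x)^1\otimes\cdots\otimes f(x)^p$; - for $1\le i\le p$, $c_i^{n,p}(f)(x)=\sum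 f(x)^0\otimes\cdots\otimes (f(x)^i)_1\otimes(f(x)^i)_2\otimes\cdots\otimes f(x)^p$ ($\Delta$ applied to the $i$-th $A$-factor); - $c_{p+1}^{n,p}(f)(a^1\otimes\cdots\otimes a^n\otimes m)=\sum f((a^1)_1\otimes\cdots\otimes(a^n)_1\otimes m_0)\otimes (a^1)_2\cdots(a^n)_2m_1$. (Empty products, when $n=0$, equal $1$.) $d_m^{n,p}=\sum_{i=0}^{n+1}(-1)^ib_i^{n,p}$ and $d_c^{n,p}=\sum_{i=0}^{p+1}(-1)^ic_i^{n,p}$. A double complex here means $d_md_m=0$, $d_cd_c=0$ and $d_cd_m=d_md_c$. *)

theory Defs
  imports Complex_Main "HOL-Library.FuncSet" "HOL-Library.Poly_Mapping"
begin

section \<open>Free vector spaces and their quotients\<close>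

text \<open>
  The free \<open>'k\<close>-vector space on \<open>'x\<close> is \<open>'x \<Rightarrow>\<^sub>0 'k\<close>, with basis vectors \<open>bas x\<close>.
  A quotient of (a coordinate subspace of) it by a subspace \<open>R\<close> is rendered as a set of
  cosets \<open>p + R\<close>.  The operations on cosets go through the representative chosen by \<open>rep\<close>;
  they do not depend on this choice.
\<close>

definition fscale :: "'k::field \<Rightarrow> ('x \<Rightarrow>\<^sub>0 'k) \<Rightarrow> ('x \<Rightarrow>\<^sub>0 'k)"
  where "fscale c p = Poly_Mapping.map ((*) c) p"

lemma lookup_fscale [simp]: "Poly_Mapping.lookup (fscale c p) x = c * Poly_Mapping.lookup p x"
  by (simp add: fscale_def Poly_Mapping.map.rep_eq when_def)

global_interpretation free: vector_space "fscale :: 'k::field \<Rightarrow> ('x \<Rightarrow>\<^sub>0 'k) \<Rightarrow> _"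
  by unfold_locales (auto intro!: poly_mapping_eqI simp: lookup_add algebra_simps)

abbreviation bas :: "'x \<Rightarrow> ('x \<Rightarrow>\<^sub>0 'k::field)"
  where "bas x \<equiv> Poly_Mapping.single x 1"

definition linext :: "('k::field \<Rightarrow> 'v \<Rightarrow> 'v::ab_group_add) \<Rightarrow> ('x \<Rightarrow>\<^sub>0 'k) \<Rightarrow> ('x \<Rightarrow> 'v) \<Rightarrow> 'v"
  where "linext s p g = (\<Sum>x\<in>Poly_Mapping.keys p. s (Poly_Mapping.lookup p x) (g x))"

text \<open>
  \<open>bind p g\<close> is the linear extension of \<open>g\<close>, evaluated at \<open>p\<close>.  A Sweedler sum
  ``\<open>\<Sum> g(t\<^sub>1, t\<^sub>2, \<dots>)\<close> for a tensor \<open>t = \<Sum> t\<^sub>1 \<otimes> t\<^sub>2 \<otimes> \<dots>\<close>'' is the class of \<open>bind (rep t) g\<close>.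
\<close>

definition bind :: "('x \<Rightarrow>\<^sub>0 'k::field) \<Rightarrow> ('x \<Rightarrow> ('y \<Rightarrow>\<^sub>0 'k)) \<Rightarrow> ('y \<Rightarrow>\<^sub>0 'k)"
  where "bind p g = linext fscale p g"

definition cls :: "('x \<Rightarrow>\<^sub>0 'k::field) set \<Rightarrow> ('x \<Rightarrow>\<^sub>0 'k) \<Rightarrow> ('x \<Rightarrow>\<^sub>0 'k) set"
  where "cls R p = {q. q - p \<in> R}"

definition rep :: "('x \<Rightarrow>\<^sub>0 'k::field) set \<Rightarrow> ('x \<Rightarrow>\<^sub>0 'k)"
  where "rep X = (SOME p. p \<in> X)"

definition qspace :: "('x \<Rightarrow>\<^sub>0 'k::field) set \<Rightarrow> 'x set \<Rightarrow> ('x \<Rightarrow>\<^sub>0 'k) set set"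
  where "qspace R D = cls R ` {p. Poly_Mapping.keys p \<subseteq> D}"

definition qadd :: "('x \<Rightarrow>\<^sub>0 'k::field) set \<Rightarrow> ('x \<Rightarrow>\<^sub>0 'k) set \<Rightarrow> ('x \<Rightarrow>\<^sub>0 'k) set \<Rightarrow> ('x \<Rightarrow>\<^sub>0 'k) set"
  where "qadd R X Y = cls R (rep X + rep Y)"

definition qscale :: "('x \<Rightarrow>\<^sub>0 'k::field) set \<Rightarrow> 'k \<Rightarrow> ('x \<Rightarrow>\<^sub>0 'k) set \<Rightarrow> ('x \<Rightarrow>\<^sub>0 'k) set"
  where "qscale R c X = cls R (fscale c (rep X))"

definition qaltsum :: "('x \<Rightarrow>\<^sub>0 'k::field) set \<Rightarrow> nat \<Rightarrow> (nat \<Rightarrow> ('x \<Rightarrow>\<^sub>0 'k) set) \<Rightarrow> ('x \<Rightarrow>\<^sub>0 'k) set"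
  where "qaltsum R r X = cls R (\<Sum>i\<le>r. fscale ((- 1) ^ i) (rep (X i)))"

definition linear_to_quotient ::
    "('k::field \<Rightarrow> 'v \<Rightarrow> 'v::ab_group_add) \<Rightarrow> ('x \<Rightarrow>\<^sub>0 'k) set \<Rightarrow> ('v \<Rightarrow> ('x \<Rightarrow>\<^sub>0 'k) set) \<Rightarrow> bool"
  where "linear_to_quotient s R f \<longleftrightarrow>
    (\<forall>u v. f (u + v) = qadd R (f u) (f v)) \<and> (\<forall>c u. f (s c u) = qscale R c (f u))"

text \<open>Linear maps between quotients; they are \<open>undefined\<close> outside their domain, so that
  equality of functions is equality of linear maps.\<close>

definition qhom ::
    "('x \<Rightarrow>\<^sub>0 'k::field) set \<Rightarrow> 'x set \<Rightarrow> ('y \<Rightarrow>\<^sub>0 'k) set \<Rightarrow> 'y set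
      \<Rightarrow> (('x \<Rightarrow>\<^sub>0 'k) set \<Rightarrow> ('y \<Rightarrow>\<^sub>0 'k) set) set"
  where "qhom R D R' D' =
    {f \<in> qspace R D \<rightarrow>\<^sub>E qspace R' D'.
      (\<forall>X\<in>qspace R D. \<forall>Y\<in>qspace R D. f (qadd R X Y) = qadd R' (f X) (f Y)) \<and>
      (\<forall>c. \<forall>X\<in>qspace R D. f (qscale R c X) = qscale R' c (f X))}"


section \<open>Tensor products\<close>

text \<open>Relations making the basis vector \<open>bas (\<sigma> v)\<close> linear in the slot \<open>v\<close>.\<close>

definition slot_relations ::
    "('k::field \<Rightarrow> 'v \<Rightarrow> 'v::ab_group_add) \<Rightarrow> ('v \<Rightarrow> 'x) \<Rightarrow> ('x \<Rightarrow>\<^sub>0 'k) set"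
  where "slot_relations s \<sigma> =
    {bas (\<sigma> (u + v)) - bas (\<sigma> u) - bas (\<sigma> v) | u v. True} \<union>
    {bas (\<sigma> (s c u)) - fscale c (bas (\<sigma> u)) | c u. True}"

text \<open>\<open>V\<^sup>r\<close>: the simple tensor \<open>v\<^sub>1 \<otimes> \<dots> \<otimes> v\<^sub>r\<close> is the class of the list \<open>[v\<^sub>1, \<dots>, v\<^sub>r]\<close>.\<close>

definition pow_rel :: "('k::field \<Rightarrow> 'a \<Rightarrow> 'a::ab_group_add) \<Rightarrow> nat \<Rightarrow> ('a list \<Rightarrow>\<^sub>0 'k) set"
  where "pow_rel s r = free.span
    (\<Union>{slot_relations s (\<lambda>a. as @ a # as') | as as'. Suc (length as + length as') = r})"

definition pow_dom :: "nat \<Rightarrow> 'a list set"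
  where "pow_dom r = {as. length as = r}"

text \<open>\<open>V\<^sup>i \<otimes> W \<otimes> V\<^sup>j\<close>: the simple tensor \<open>v\<^sub>1 \<otimes> \<dots> \<otimes> v\<^sub>i \<otimes> w \<otimes> v'\<^sub>1 \<otimes> \<dots> \<otimes> v'\<^sub>j\<close> is the class of
  \<open>([v\<^sub>1, \<dots>, v\<^sub>i], w, [v'\<^sub>1, \<dots>, v'\<^sub>j])\<close>.  All tensor products having one factor in a
  bimodule are of this kind, e.g. \<open>A\<^sup>n \<otimes> M\<close> for \<open>j = 0\<close> and \<open>N \<otimes> A\<^sup>p\<close> for \<open>i = 0\<close>.\<close>

definition mid_rel ::
    "('k::field \<Rightarrow> 'a \<Rightarrow> 'a::ab_group_add) \<Rightarrow> ('k \<Rightarrow> 'm \<Rightarrow> 'm::ab_group_add) \<Rightarrow> nat \<Rightarrow> nat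
      \<Rightarrow> ('a list \<times> 'm \<times> 'a list \<Rightarrow>\<^sub>0 'k) set"
  where "mid_rel s t i j = free.span
    (\<Union>{slot_relations s (\<lambda>a. (as @ a # as', m, bs)) | as as' m bs.
         Suc (length as + length as') = i \<and> length bs = j} \<union>
     \<Union>{slot_relations t (\<lambda>m. (as, m, bs)) | as bs. length as = i \<and> length bs = j} \<union>
     \<Union>{slot_relations s (\<lambda>b. (as, m, bs @ b # bs')) | as m bs bs'.
         length as = i \<and> Suc (length bs + length bs') = j})"

definition mid_dom :: "nat \<Rightarrow> nat \<Rightarrow> ('a list \<times> 'm \<times> 'a list) set"
  where "mid_dom i j = {(as, m, bs). length as = i \<and> length bs = j}"


section \<open>Bialgebras\<close>

text \<open>The underlying ring of the bialgebra is the type \<open>'a::ring_1\<close>.  The axiom \<open>0 \<noteq> 1\<close> of that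
  class is no restriction: it follows from \<open>counit 1 = 1\<close>.\<close>

record (overloaded) ('k::zero, 'a) bialg =
  ascale :: "'k \<Rightarrow> 'a \<Rightarrow> 'a"
  comult :: "'a \<Rightarrow> ('a list \<Rightarrow>\<^sub>0 'k) set"
  counit :: "'a \<Rightarrow> 'k"

abbreviation "arel A r \<equiv> pow_rel (ascale A) r"

locale bialgebra = vector_space "ascale A"
  for A :: "('k::field, 'a::ring_1) bialg" +
  assumes mult_linear_left: "Vector_Spaces.linear (ascale A) (ascale A) (\<lambda>a. a * b)"
    and mult_linear_right: "Vector_Spaces.linear (ascale A) (ascale A) (\<lambda>b. a * b)"
    and comult_closed: "comult A a \<in> qspace (arel A 2) (pow_dom 2)"
    and comult_linear: "linear_to_quotient (ascale A) (arel A 2) (comult A)"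
    and counit_linear: "Vector_Spaces.linear (ascale A) (*) (counit A)"
    and coassoc:
      "cls (arel A 3) (bind (rep (comult A a)) (\<lambda>w. bind (rep (comult A (w ! 0))) (\<lambda>v.
          bas [v ! 0, v ! 1, w ! 1]))) =
       cls (arel A 3) (bind (rep (comult A a)) (\<lambda>w. bind (rep (comult A (w ! 1))) (\<lambda>v.
          bas [w ! 0, v ! 0, v ! 1])))"
    and counit_left:
      "linext (ascale A) (rep (comult A a)) (\<lambda>w. ascale A (counit A (w ! 0)) (w ! 1)) = a"
    and counit_right:
      "linext (ascale A) (rep (comult A a)) (\<lambda>w. ascale A (counit A (w ! 1)) (w ! 0)) = a"
    and comult_mult:
      "comult A (a * b) = cls (arel A 2) (bind (rep (comult A a)) (\<lambda>v. bind (rep (comult A b)) (\<lambda>w.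
          bas [v ! 0 * w ! 0, v ! 1 * w ! 1])))"
    and comult_one: "comult A 1 = cls (arel A 2) (bas [1, 1])"
    and counit_mult: "counit A (a * b) = counit A a * counit A b"
    and counit_one: "counit A 1 = 1"

text \<open>\<open>comult_iter A r a\<close> represents \<open>\<Sum> a\<^sub>1 \<otimes> \<dots> \<otimes> a\<^sub>r\<^sub>+\<^sub>1\<close>.\<close>

fun comult_iter :: "('k::field, 'a) bialg \<Rightarrow> nat \<Rightarrow> 'a \<Rightarrow> ('a list \<Rightarrow>\<^sub>0 'k)" where
  "comult_iter A 0 a = bas [a]"
| "comult_iter A (Suc r) a =
    bind (rep (comult A a)) (\<lambda>w. bind (comult_iter A r (w ! 1)) (\<lambda>v. bas (w ! 0 # v)))"

text \<open>\<open>comult_each A [a\<^sup>1, \<dots>, a\<^sup>n]\<close> represents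
  \<open>\<Sum> ((a\<^sup>1)\<^sub>1 \<otimes> \<dots> \<otimes> (a\<^sup>n)\<^sub>1) \<otimes> ((a\<^sup>1)\<^sub>2 \<otimes> \<dots> \<otimes> (a\<^sup>n)\<^sub>2)\<close>.\<close>

fun comult_each :: "('k::field, 'a) bialg \<Rightarrow> 'a list \<Rightarrow> ('a list \<times> 'a list \<Rightarrow>\<^sub>0 'k)" where
  "comult_each A [] = bas ([], [])"
| "comult_each A (a # as) =
    bind (rep (comult A a)) (\<lambda>w. bind (comult_each A as) (\<lambda>(us, vs).
      bas (w ! 0 # us, w ! 1 # vs)))"


section \<open>Hopf bimodules\<close>

text \<open>\<open>lact M a m\<close> is \<open>a \<cdot> m\<close> and \<open>ract M m a\<close> is \<open>m \<cdot> a\<close>.  In \<open>lcoact M m\<close>, an element of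
  \<open>A \<otimes> M\<close>, the basis vectors are \<open>([m\<^sub>-\<^sub>1], m\<^sub>0, [])\<close>; in \<open>rcoact M m\<close>, an element of \<open>M \<otimes> A\<close>,
  they are \<open>([], m\<^sub>0, [m\<^sub>1])\<close>.\<close>

record (overloaded) ('k::zero, 'a, 'm) hbim =
  mscale :: "'k \<Rightarrow> 'm \<Rightarrow> 'm"
  lact :: "'a \<Rightarrow> 'm \<Rightarrow> 'm"
  ract :: "'m \<Rightarrow> 'a \<Rightarrow> 'm"
  lcoact :: "'m \<Rightarrow> ('a list \<times> 'm \<times> 'a list \<Rightarrow>\<^sub>0 'k) set"
  rcoact :: "'m \<Rightarrow> ('a list \<times> 'm \<times> 'a list \<Rightarrow>\<^sub>0 'k) set"

abbreviation "mrel A M i j \<equiv> mid_rel (ascale A) (mscale M) i j"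

locale hopf_bimodule = bialgebra A + M: vector_space "mscale M"
  for A :: "('k::field, 'a::ring_1) bialg"
    and M :: "('k, 'a, 'm::ab_group_add) hbim" +
  assumes lact_linear: "Vector_Spaces.linear (mscale M) (mscale M) (\<lambda>m. lact M a m)"
    and lact_linear': "Vector_Spaces.linear (ascale A) (mscale M) (\<lambda>a. lact M a m)"
    and lact_mult: "lact M (a * b) m = lact M a (lact M b m)"
    and lact_one: "lact M 1 m = m"
    and ract_linear: "Vector_Spaces.linear (mscale M) (mscale M) (\<lambda>m. ract M m a)"
    and ract_linear': "Vector_Spaces.linear (ascale A) (mscale M) (\<lambda>a. ract M m a)"
    and ract_mult: "ract M m (a * b) = ract M (ract M m a) b"
    and ract_one: "ract M m 1 = m"
    and lact_ract: "ract M (lact M a m) b = lact M a (ract M m b)"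
    and lcoact_closed: "lcoact M m \<in> qspace (mrel A M 1 0) (mid_dom 1 0)"
    and lcoact_linear: "linear_to_quotient (mscale M) (mrel A M 1 0) (lcoact M)"
    and lcoact_coassoc:
      "cls (mrel A M 2 0) (bind (rep (lcoact M m)) (\<lambda>(c, m0, _).
          bind (rep (comult A (hd c))) (\<lambda>w. bas (w, m0, [])))) =
       cls (mrel A M 2 0) (bind (rep (lcoact M m)) (\<lambda>(c, m0, _).
          bind (rep (lcoact M m0)) (\<lambda>(c', m0', _). bas ([hd c, hd c'], m0', []))))"
    and lcoact_counit:
      "linext (mscale M) (rep (lcoact M m)) (\<lambda>(c, m0, _). mscale M (counit A (hd c)) m0) = m"
    and rcoact_closed: "rcoact M m \<in> qspace (mrel A M 0 1) (mid_dom 0 1)"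
    and rcoact_linear: "linear_to_quotient (mscale M) (mrel A M 0 1) (rcoact M)"
    and rcoact_coassoc:
      "cls (mrel A M 0 2) (bind (rep (rcoact M m)) (\<lambda>(_, m0, d).
          bind (rep (comult A (hd d))) (\<lambda>w. bas ([], m0, w)))) =
       cls (mrel A M 0 2) (bind (rep (rcoact M m)) (\<lambda>(_, m0, d).
          bind (rep (rcoact M m0)) (\<lambda>(_, m0', d'). bas ([], m0', [hd d', hd d]))))"
    and rcoact_counit:
      "linext (mscale M) (rep (rcoact M m)) (\<lambda>(_, m0, d). mscale M (counit A (hd d)) m0) = m"
    and lcoact_rcoact:
      "cls (mrel A M 1 1) (bind (rep (rcoact M m)) (\<lambda>(_, m0, d).
          bind (rep (lcoact M m0)) (\<lambda>(c, m0', _). bas (c, m0', d)))) =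
       cls (mrel A M 1 1) (bind (rep (lcoact M m)) (\<lambda>(c, m0, _).
          bind (rep (rcoact M m0)) (\<lambda>(_, m0', d). bas (c, m0', d))))"
    and rcoact_lact:
      "rcoact M (lact M a m) = cls (mrel A M 0 1)
        (bind (rep (comult A a)) (\<lambda>w. bind (rep (rcoact M m)) (\<lambda>(_, m0, d).
          bas ([], lact M (w ! 0) m0, [w ! 1 * hd d]))))"
    and rcoact_ract:
      "rcoact M (ract M m a) = cls (mrel A M 0 1)
        (bind (rep (rcoact M m)) (\<lambda>(_, m0, d). bind (rep (comult A a)) (\<lambda>w.
          bas ([], ract M m0 (w ! 0), [hd d * w ! 1]))))"
    and lcoact_lact:
      "lcoact M (lact M a m) = cls (mrel A M 1 0)
        (bind (rep (comult A a)) (\<lambda>w. bind (rep (lcoact M m)) (\<lambda>(c, m0, _).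
          bas ([w ! 0 * hd c], lact M (w ! 1) m0, []))))"
    and lcoact_ract:
      "lcoact M (ract M m a) = cls (mrel A M 1 0)
        (bind (rep (lcoact M m)) (\<lambda>(c, m0, _). bind (rep (comult A a)) (\<lambda>w.
          bas ([hd c * w ! 0], ract M m0 (w ! 1), []))))"


section \<open>The spaces \<open>C\<close> and \<open>T\<close>\<close>

abbreviation AnM :: "('k::field, 'a::ring_1) bialg \<Rightarrow> ('k, 'a, 'm::ab_group_add) hbim \<Rightarrow> nat
    \<Rightarrow> ('a list \<times> 'm \<times> 'a list \<Rightarrow>\<^sub>0 'k) set set"
  where "AnM A M n \<equiv> qspace (mrel A M n 0) (mid_dom n 0)"

abbreviation NAp :: "('k::field, 'a::ring_1) bialg \<Rightarrow> ('k, 'a, 'n::ab_group_add) hbim \<Rightarrow> nat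
    \<Rightarrow> ('a list \<times> 'n \<times> 'a list \<Rightarrow>\<^sub>0 'k) set set"
  where "NAp A N p \<equiv> qspace (mrel A N 0 p) (mid_dom 0 p)"

type_synonym ('k, 'a, 'm, 'n) cochain =
  "('a list \<times> 'm \<times> 'a list \<Rightarrow>\<^sub>0 'k) set \<Rightarrow> ('a list \<times> 'n \<times> 'a list \<Rightarrow>\<^sub>0 'k) set"

definition Csp :: "('k::field, 'a::ring_1) bialg \<Rightarrow> ('k, 'a, 'm::ab_group_add) hbim
    \<Rightarrow> ('k, 'a, 'n::ab_group_add) hbim \<Rightarrow> nat \<Rightarrow> nat \<Rightarrow> ('k, 'a, 'm, 'n) cochain set"
  where "Csp A M N n p = qhom (mrel A M n 0) (mid_dom n 0) (mrel A N 0 p) (mid_dom 0 p)"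

text \<open>Module and comodule structures on \<open>A\<^sup>n \<otimes> M\<close> and on \<open>N \<otimes> A\<^sup>p\<close>.\<close>

definition ract_AnM ::
    "('k::field, 'a::ring_1) bialg \<Rightarrow> ('k, 'a, 'm::ab_group_add) hbim \<Rightarrow> nat
      \<Rightarrow> ('a list \<times> 'm \<times> 'a list \<Rightarrow>\<^sub>0 'k) set \<Rightarrow> 'a \<Rightarrow> ('a list \<times> 'm \<times> 'a list \<Rightarrow>\<^sub>0 'k) set"
  where "ract_AnM A M n X b =
    cls (mrel A M n 0) (bind (rep X) (\<lambda>(as, m, _). bas (as, ract M m b, [])))"

definition ract_NAp ::
    "('k::field, 'a::ring_1) bialg \<Rightarrow> ('k, 'a, 'n::ab_group_add) hbim \<Rightarrow> nat
      \<Rightarrow> ('a list \<times> 'n \<times> 'a list \<Rightarrow>\<^sub>0 'k) set \<Rightarrow> 'a \<Rightarrow> ('a list \<times> 'n \<times> 'a list \<Rightarrow>\<^sub>0 'k) set"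
  where "ract_NAp A N p Y b =
    cls (mrel A N 0 p) (bind (rep Y) (\<lambda>(_, x, as). bind (comult_iter A p b) (\<lambda>w.
      bas ([], ract N x (hd w), map2 (*) as (tl w)))))"

definition lcoact_AnM ::
    "('k::field, 'a::ring_1) bialg \<Rightarrow> ('k, 'a, 'm::ab_group_add) hbim \<Rightarrow> nat
      \<Rightarrow> ('a list \<times> 'm \<times> 'a list \<Rightarrow>\<^sub>0 'k) set \<Rightarrow> ('a list \<times> 'm \<times> 'a list \<Rightarrow>\<^sub>0 'k) set"
  where "lcoact_AnM A M n X =
    cls (mrel A M (Suc n) 0) (bind (rep X) (\<lambda>(as, m, _).
      bind (comult_each A as) (\<lambda>(us, vs). bind (rep (lcoact M m)) (\<lambda>(c, m0, _).
        bas ((prod_list us * hd c) # vs, m0, [])))))"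

definition lcoact_NAp ::
    "('k::field, 'a::ring_1) bialg \<Rightarrow> ('k, 'a, 'n::ab_group_add) hbim \<Rightarrow> nat
      \<Rightarrow> ('a list \<times> 'n \<times> 'a list \<Rightarrow>\<^sub>0 'k) set \<Rightarrow> ('a list \<times> 'n \<times> 'a list \<Rightarrow>\<^sub>0 'k) set"
  where "lcoact_NAp A N p Y =
    cls (mrel A N 1 p) (bind (rep Y) (\<lambda>(_, x, as).
      bind (rep (lcoact N x)) (\<lambda>(c, x0, _). bas (c, x0, as))))"

text \<open>The map \<open>id\<^sub>A \<otimes> f\<close> from \<open>A \<otimes> (A\<^sup>n \<otimes> M)\<close> to \<open>A \<otimes> (N \<otimes> A\<^sup>p)\<close>.\<close>

definition id_tensor ::
    "('k::field, 'a::ring_1) bialg \<Rightarrow> ('k, 'a, 'm::ab_group_add) hbim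
      \<Rightarrow> ('k, 'a, 'n::ab_group_add) hbim \<Rightarrow> nat \<Rightarrow> nat
      \<Rightarrow> ('k, 'a, 'm, 'n) cochain \<Rightarrow> ('k, 'a, 'm, 'n) cochain"
  where "id_tensor A M N n p f Z =
    cls (mrel A N 1 p) (bind (rep Z) (\<lambda>(as, m, _).
      bind (rep (f (cls (mrel A M n 0) (bas (tl as, m, []))))) (\<lambda>(_, x, bs).
        bas ([hd as], x, bs))))"

definition Tsp :: "('k::field, 'a::ring_1) bialg \<Rightarrow> ('k, 'a, 'm::ab_group_add) hbim
    \<Rightarrow> ('k, 'a, 'n::ab_group_add) hbim \<Rightarrow> nat \<Rightarrow> nat \<Rightarrow> ('k, 'a, 'm, 'n) cochain set"
  where "Tsp A M N n p = {f \<in> Csp A M N n p.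
    (\<forall>X\<in>AnM A M n. \<forall>b. f (ract_AnM A M n X b) = ract_NAp A N p (f X) b) \<and>
    (\<forall>X\<in>AnM A M n. id_tensor A M N n p f (lcoact_AnM A M n X) = lcoact_NAp A N p (f X))}"


section \<open>The differentials\<close>

definition face_b ::
    "('k::field, 'a::ring_1) bialg \<Rightarrow> ('k, 'a, 'm::ab_group_add) hbim
      \<Rightarrow> ('k, 'a, 'n::ab_group_add) hbim \<Rightarrow> nat \<Rightarrow> nat \<Rightarrow> nat
      \<Rightarrow> ('k, 'a, 'm, 'n) cochain \<Rightarrow> ('k, 'a, 'm, 'n) cochain"
  where "face_b A M N n p i f X =
    cls (mrel A N 0 p) (bind (rep X) (\<lambda>(as, m, _).
      if i = 0 then
        bind (comult_iter A p (hd as)) (\<lambda>w.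
          bind (rep (f (cls (mrel A M n 0) (bas (tl as, m, []))))) (\<lambda>(_, x, bs).
            bas ([], lact N (hd w) x, map2 (*) (tl w) bs)))
      else if i \<le> n then
        rep (f (cls (mrel A M n 0)
          (bas (take (i - 1) as @ (as ! (i - 1) * as ! i) # drop (i + 1) as, m, []))))
      else
        rep (f (cls (mrel A M n 0) (bas (butlast as, lact M (last as) m, []))))))"

definition face_c ::
    "('k::field, 'a::ring_1) bialg \<Rightarrow> ('k, 'a, 'm::ab_group_add) hbim
      \<Rightarrow> ('k, 'a, 'n::ab_group_add) hbim \<Rightarrow> nat \<Rightarrow> nat \<Rightarrow> nat
      \<Rightarrow> ('k, 'a, 'm, 'n) cochain \<Rightarrow> ('k, 'a, 'm, 'n) cochain"
  where "face_c A M N n p i f X =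
    cls (mrel A N 0 (Suc p)) (
      if i = 0 then
        bind (rep (f X)) (\<lambda>(_, x, bs). bind (rep (rcoact N x)) (\<lambda>(_, x0, d).
          bas ([], x0, hd d # bs)))
      else if i \<le> p then
        bind (rep (f X)) (\<lambda>(_, x, bs). bind (rep (comult A (bs ! (i - 1)))) (\<lambda>w.
          bas ([], x, take (i - 1) bs @ w ! 0 # w ! 1 # drop i bs)))
      else
        bind (rep X) (\<lambda>(as, m, _). bind (comult_each A as) (\<lambda>(us, vs).
          bind (rep (rcoact M m)) (\<lambda>(_, m0, d).
            bind (rep (f (cls (mrel A M n 0) (bas (us, m0, []))))) (\<lambda>(_, x, bs).
              bas ([], x, bs @ [prod_list vs * hd d]))))))"

definition d_m ::
    "('k::field, 'a::ring_1) bialg \<Rightarrow> ('k, 'a, 'm::ab_group_add) hbim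
      \<Rightarrow> ('k, 'a, 'n::ab_group_add) hbim \<Rightarrow> nat \<Rightarrow> nat
      \<Rightarrow> ('k, 'a, 'm, 'n) cochain \<Rightarrow> ('k, 'a, 'm, 'n) cochain"
  where "d_m A M N n p f = restrict
    (\<lambda>X. qaltsum (mrel A N 0 p) (n + 1) (\<lambda>i. face_b A M N n p i f X)) (AnM A M (Suc n))"

definition d_c ::
    "('k::field, 'a::ring_1) bialg \<Rightarrow> ('k, 'a, 'm::ab_group_add) hbim
      \<Rightarrow> ('k, 'a, 'n::ab_group_add) hbim \<Rightarrow> nat \<Rightarrow> nat
      \<Rightarrow> ('k, 'a, 'm, 'n) cochain \<Rightarrow> ('k, 'a, 'm, 'n) cochain"
  where "d_c A M N n p f = restrict
    (\<lambda>X. qaltsum (mrel A N 0 (Suc p)) (p + 1) (\<lambda>i. face_c A M N n p i f X)) (AnM A M n)"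

definition zero_cochain ::
    "('k::field, 'a::ring_1) bialg \<Rightarrow> ('k, 'a, 'm::ab_group_add) hbim
      \<Rightarrow> ('k, 'a, 'n::ab_group_add) hbim \<Rightarrow> nat \<Rightarrow> nat \<Rightarrow> ('k, 'a, 'm, 'n) cochain"
  where "zero_cochain A M N n p = restrict (\<lambda>X. cls (mrel A N 0 p) 0) (AnM A M n)"

definition double_complex ::
    "(nat \<Rightarrow> nat \<Rightarrow> 'c set) \<Rightarrow> (nat \<Rightarrow> nat \<Rightarrow> 'c \<Rightarrow> 'c) \<Rightarrow> (nat \<Rightarrow> nat \<Rightarrow> 'c \<Rightarrow> 'c)
      \<Rightarrow> (nat \<Rightarrow> nat \<Rightarrow> 'c) \<Rightarrow> bool"
  where "double_complex T dm dc zero \<longleftrightarrow> (\<forall>n p.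
    dm n p ` T n p \<subseteq> T (Suc n) p \<and> dc n p ` T n p \<subseteq> T n (Suc p) \<and>
    (\<forall>f\<in>T n p. dm (Suc n) p (dm n p f) = zero (Suc (Suc n)) p \<and>
       dc n (Suc p) (dc n p f) = zero n (Suc (Suc p)) \<and>
       dc (Suc n) p (dm n p f) = dm n (Suc p) (dc n p f)))"

end

(* Over a field, an element of a tensor product is determined by its values under all multilinear
   forms.  Pairing with forms turns a Sweedler sum into a scalar-valued functional, linear in its
   continuation: sums over different coproducts commute for free, coassociativity and the Hopf module
   axioms become identities between iterated functionals, and a cochain f becomes a map F from forms
   on N (x) A^p to forms on A^n (x) M.  On this level b_0 and c_0, ..., c_p act on the argument of F,
   b_1, ..., b_(n+1) act on its result, and only c_(p+1) mixes the two sides, which makes the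
   cosimplicial identities short.  Every single face map preserves right linearity and left
   colinearity, so the alternating sums do. *)

theory Submission
  imports Defs
begin

section \<open>Pairing formal sums with functions\<close>

text \<open>Operations on tensors are defined through an arbitrary representative
  \<open>rep\<close>, so the obstacle is well-definedness: a formula at \<open>rep X\<close> is
  independent of the choice only after pairing with a multilinear form. Hence the
  \<open>linform\<close>, \<open>lmulti\<close> and \<open>multi\<close> conditions in most
  identities, and the proof for each operator that it keeps forms multilinear. The separating form
  comes from extending a basis of the relations by one vector.

  The Hopf axioms enter only at the end faces. \<open>rho_lact\<close> on N lets b_0 commute with
  c_0, on M it lets b_(n+1) commute with c_(p+1). Right linearity of c_0 and c_(p+1) is
  \<open>rho_ract\<close> on N and on M; that of b_0 and b_(n+1) is \<open>lact_ract\<close>. Left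
  colinearity of b_0 and b_(n+1) is \<open>lam_lact\<close> on N and on M; that of c_0 and c_(p+1)
  is \<open>lam_rho\<close>. For the inner faces the product and coproduct of A suffice.\<close>

abbreviation ev :: "('x \<Rightarrow>\<^sub>0 'k::field) \<Rightarrow> ('x \<Rightarrow> 'k) \<Rightarrow> 'k"
  where "ev \<equiv> linext (*)"

lemma ev_superset:
  assumes "finite S" "Poly_Mapping.keys p \<subseteq> S"
  shows "ev p g = (\<Sum>x\<in>S. Poly_Mapping.lookup p x * g x)"
  unfolding linext_def using assms by (intro sum.mono_neutral_left) (auto simp: in_keys_iff)

lemma ev_add [simp]: "ev (p + q) g = ev p g + ev q g"
proof -
  let ?S = "Poly_Mapping.keys p \<union> Poly_Mapping.keys q"
  have "ev (p + q) g = (\<Sum>x\<in>?S. Poly_Mapping.lookup (p + q) x * g x)"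
    by (intro ev_superset) (auto simp: Poly_Mapping.keys_add)
  moreover have "ev p g = (\<Sum>x\<in>?S. Poly_Mapping.lookup p x * g x)"
    "ev q g = (\<Sum>x\<in>?S. Poly_Mapping.lookup q x * g x)"
    by (intro ev_superset; auto)+
  ultimately show ?thesis by (simp add: lookup_add algebra_simps sum.distrib)
qed

lemma ev_fscale [simp]: "ev (fscale c p) g = c * ev p g"
proof -
  have "ev (fscale c p) g = (\<Sum>x\<in>Poly_Mapping.keys p. Poly_Mapping.lookup (fscale c p) x * g x)"
    by (intro ev_superset) (auto simp: in_keys_iff)
  then show ?thesis by (simp add: linext_def sum_distrib_left mult.assoc)
qed

lemma ev_zero [simp]: "ev 0 g = 0"
  by (simp add: linext_def)

lemma ev_diff [simp]: "ev (p - q) g = ev p g - ev q g"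
  using ev_add[of "p - q" q g] by simp

lemma ev_sum [simp]: "ev (\<Sum>i\<in>I. p i) g = (\<Sum>i\<in>I. ev (p i) g)"
  by (induction I rule: infinite_finite_induct) auto

lemma ev_bas [simp]: "ev (bas x) g = g x"
  by (simp add: linext_def)

lemma ev_bind [simp]: "ev (bind p h) g = ev p (\<lambda>x. ev (h x) g)"
proof -
  have "ev (bind p h) g = (\<Sum>x\<in>Poly_Mapping.keys p. Poly_Mapping.lookup p x * ev (h x) g)"
    unfolding bind_def linext_def[of fscale p h] ev_sum by simp
  then show ?thesis by (simp only: linext_def)
qed

lemma ev_cong:
  assumes "\<And>x. x \<in> Poly_Mapping.keys p \<Longrightarrow> g x = h x"
  shows "ev p g = ev p h"
  unfolding linext_def using assms by (intro sum.cong) auto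

lemma ev_plus: "ev p (\<lambda>x. g x + h x) = ev p g + ev p h"
  by (simp add: linext_def algebra_simps sum.distrib)

lemma ev_times: "ev p (\<lambda>x. c * g x) = c * ev p g"
  by (simp add: linext_def sum_distrib_left algebra_simps)

lemma ev_null [simp]: "ev p (\<lambda>x. 0) = 0"
  by (simp add: linext_def)

lemma ev_sum_right: "ev p (\<lambda>x. \<Sum>i\<in>I. g i x) = (\<Sum>i\<in>I. ev p (g i))"
  by (induction I rule: infinite_finite_induct) (auto simp: ev_plus)

text \<open>Finite double sums may be exchanged; no linearity of \<open>g\<close> enters, so no side
  condition arises.\<close>

lemma ev_swap: "ev p (\<lambda>x. ev q (\<lambda>y. g x y)) = ev q (\<lambda>y. ev p (\<lambda>x. g x y))"
proof -
  have "ev p (\<lambda>x. ev q (\<lambda>y. g x y)) = ev p (\<lambda>x. \<Sum>y\<in>Poly_Mapping.keys q. Poly_Mapping.lookup q y * g x y)"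
    by (simp add: linext_def)
  also have "\<dots> = (\<Sum>y\<in>Poly_Mapping.keys q. Poly_Mapping.lookup q y * ev p (\<lambda>x. g x y))"
    by (simp add: ev_sum_right ev_times)
  finally show ?thesis by (simp add: linext_def)
qed

lemma expand_bas: "p = (\<Sum>x\<in>Poly_Mapping.keys p. fscale (Poly_Mapping.lookup p x) (bas x))"
proof (rule poly_mapping_eqI)
  fix y
  have "Poly_Mapping.lookup (\<Sum>x\<in>Poly_Mapping.keys p. fscale (Poly_Mapping.lookup p x) (bas x)) y =
      (\<Sum>x\<in>Poly_Mapping.keys p. if x = y then Poly_Mapping.lookup p x else 0)"
    unfolding lookup_sum by (intro sum.cong) (auto simp: lookup_single)
  also have "\<dots> = Poly_Mapping.lookup p y"
    by (auto simp: sum.delta in_keys_iff)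
  finally show "Poly_Mapping.lookup p y =
    Poly_Mapping.lookup (\<Sum>x\<in>Poly_Mapping.keys p. fscale (Poly_Mapping.lookup p x) (bas x)) y" by simp
qed

lemma keys_fscale: "Poly_Mapping.keys (fscale c p) \<subseteq> Poly_Mapping.keys p"
  by (auto simp: in_keys_iff)

lemma keys_add_subset:
  "Poly_Mapping.keys p \<subseteq> D \<Longrightarrow> Poly_Mapping.keys q \<subseteq> D \<Longrightarrow> Poly_Mapping.keys (p + q) \<subseteq> D"
  by (rule order.trans[OF Poly_Mapping.keys_add]) simp

lemma keys_diff_subset:
  "Poly_Mapping.keys p \<subseteq> D \<Longrightarrow> Poly_Mapping.keys q \<subseteq> D \<Longrightarrow> Poly_Mapping.keys (p - q) \<subseteq> D"
  by (rule order.trans[OF keys_diff]) simp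

lemma keys_sum_subset:
  assumes "\<And>i. i \<in> I \<Longrightarrow> Poly_Mapping.keys (p i) \<subseteq> D"
  shows "Poly_Mapping.keys (\<Sum>i\<in>I. p i) \<subseteq> D"
  using assms
proof (induction I rule: infinite_finite_induct)
  case (insert i I)
  then show ?case by (simp add: keys_add_subset)
qed auto

lemma keys_bind:
  assumes "\<And>x. x \<in> Poly_Mapping.keys p \<Longrightarrow> Poly_Mapping.keys (h x) \<subseteq> D"
  shows "Poly_Mapping.keys (bind p h) \<subseteq> D"
  unfolding bind_def linext_def
  by (intro keys_sum_subset order.trans[OF keys_fscale] assms)

section \<open>Linear forms and separation from a span\<close>

definition linform :: "('k::field \<Rightarrow> 'v \<Rightarrow> 'v::ab_group_add) \<Rightarrow> ('v \<Rightarrow> 'k) \<Rightarrow> bool"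
  where "linform s h \<longleftrightarrow> (\<forall>u v. h (u + v) = h u + h v) \<and> (\<forall>c u. h (s c u) = c * h u)"

lemma linform_zero [simp]: "linform s (\<lambda>_. 0)"
  by (simp add: linform_def)

lemma linform_times:
  "linform s h \<Longrightarrow> linform s (\<lambda>a. c * h a)"
  by (auto simp: linform_def algebra_simps)

lemma linform_ev:
  assumes "\<And>z. z \<in> Poly_Mapping.keys p \<Longrightarrow> linform s (\<lambda>a. H a z)"
  shows "linform s (\<lambda>a. ev p (\<lambda>z. H a z))"
proof -
  have "ev p (H (u + v)) = ev p (\<lambda>z. H u z + H v z)" for u v
    using assms by (intro ev_cong) (auto simp: linform_def)
  moreover have "ev p (H (s c u)) = ev p (\<lambda>z. c * H u z)" for c u
    using assms by (intro ev_cong) (auto simp: linform_def)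
  ultimately show ?thesis by (simp add: linform_def ev_plus ev_times)
qed

text \<open>Choose a basis \<open>B\<close> of the span. A vector \<open>p\<close> outside it
  enlarges \<open>B\<close> to an independent set, so some linear functional is 1 at
  \<open>p\<close> and 0 on \<open>B\<close>; its values on the basis vectors \<open>bas x\<close>
  are \<open>h\<close>.\<close>

lemma separating_form:
  fixes p :: "'x \<Rightarrow>\<^sub>0 'k::field"
  assumes "p \<notin> free.span S"
  obtains h where "\<And>q. q \<in> free.span S \<Longrightarrow> ev q h = 0" and "ev p h \<noteq> 0"
proof -
  interpret vector_space_pair "fscale :: 'k \<Rightarrow> ('x \<Rightarrow>\<^sub>0 'k) \<Rightarrow> _" "(*) :: 'k \<Rightarrow> 'k \<Rightarrow> 'k"
    by unfold_locales (auto simp: algebra_simps)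
  obtain B where B: "B \<subseteq> free.span S" "free.independent B" "free.span S \<subseteq> free.span B"
    using free.maximal_independent_subset by metis
  have pB: "p \<notin> free.span B"
    using B(1) assms free.span_minimal[OF _ free.subspace_span] by blast
  then have "free.independent (insert p B)"
    using B(2) by (simp add: free.independent_insert)
  then obtain L where L: "Vector_Spaces.linear fscale (*) L"
    and Lv: "\<forall>x\<in>insert p B. L x = (if x = p then 1 else 0)"
    using linear_independent_extend[of "insert p B" "\<lambda>x. if x = p then 1 else 0"] by metis
  interpret L: Vector_Spaces.linear fscale "(*)" L by fact
  have L_ev: "L q = ev q (\<lambda>x. L (bas x))" for q
    using arg_cong[OF expand_bas[of q], of L] by (simp only: L.sum L.scale linext_def)
  have "p \<notin> B" using pB free.span_base[of p B] by iprover
  then have "L x = 0" if "x \<in> B" for x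
    using Lv that by (cases "x = p") auto
  then have "L q = 0" if "q \<in> free.span B" for q
    using L.eq_0_on_span[OF _ that] by blast
  then have "L q = 0" if "q \<in> free.span S" for q
    using that B(3) by auto
  moreover have "L p \<noteq> 0" using Lv by simp
  ultimately show ?thesis by (intro that[of "\<lambda>x. L (bas x)"]) (auto simp flip: L_ev)
qed

lemma ev_span_zero:
  assumes "p \<in> free.span S" "\<And>q. q \<in> S \<Longrightarrow> ev q h = 0"
  shows "ev p h = 0"
  using assms by (induction rule: free.span_induct_alt) auto

lemma keys_span:
  assumes "p \<in> free.span S" "\<And>q. q \<in> S \<Longrightarrow> Poly_Mapping.keys q \<subseteq> D"
  shows "Poly_Mapping.keys p \<subseteq> D"
  using assms
proof (induction rule: free.span_induct_alt)
  case (step c x y)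
  then show ?case by (simp only: keys_add_subset order.trans[OF keys_fscale])
qed auto


section \<open>Multilinear forms\<close>

text \<open>No length is prescribed for the lists: a form on one tensor power is extended by \<open>0\<close> to lists
  of the other lengths, which spares all the length bookkeeping.\<close>

definition lmulti :: "('k::field \<Rightarrow> 'a \<Rightarrow> 'a::ab_group_add) \<Rightarrow> ('a list \<Rightarrow> 'k) \<Rightarrow> bool"
  where "lmulti s h \<longleftrightarrow> (\<forall>as as'. linform s (\<lambda>a. h (as @ a # as')))"

definition multi :: "('k::field \<Rightarrow> 'a \<Rightarrow> 'a::ab_group_add) \<Rightarrow> ('k \<Rightarrow> 'm \<Rightarrow> 'm::ab_group_add)
    \<Rightarrow> ('a list \<Rightarrow> 'm \<Rightarrow> 'k) \<Rightarrow> bool"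
  where "multi s t g \<longleftrightarrow> (\<forall>as. linform t (g as)) \<and> (\<forall>m. lmulti s (\<lambda>as. g as m))"

lemma lmultiD: "lmulti s h \<Longrightarrow> linform s (\<lambda>a. h (as @ a # as'))"
  by (auto simp: lmulti_def)

lemma lmulti_head: "lmulti s h \<Longrightarrow> linform s (\<lambda>a. h (a # as))"
  using lmultiD[of s h "[]"] by simp

lemma lmulti_last: "lmulti s h \<Longrightarrow> linform s (\<lambda>a. h (as @ [a]))"
  by (rule lmultiD)

lemma lmulti_Cons: "lmulti s h \<Longrightarrow> lmulti s (\<lambda>as. h (a # as))"
  using lmultiD[of s h "a # _"] by (simp add: lmulti_def)

lemma lmulti_append: "lmulti s h \<Longrightarrow> lmulti s (\<lambda>as. h (as @ bs))"
  by (auto simp: lmulti_def)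

text \<open>The varying slot is the head or lies in the tail, which fits operators defined by
  recursion on the list.\<close>

lemma lmulti_split:
  assumes "\<And>as. linform s (\<lambda>a. h (a # as))" "\<And>a. lmulti s (\<lambda>as. h (a # as))"
  shows "lmulti s h"
  unfolding lmulti_def
proof (intro allI)
  fix as as'
  show "linform s (\<lambda>a. h (as @ a # as'))"
    using assms(1) lmultiD[OF assms(2)] by (cases as) auto
qed

lemma multi_linform: "multi s t g \<Longrightarrow> linform t (g as)"
  by (simp add: multi_def)

lemma multi_lmulti: "multi s t g \<Longrightarrow> lmulti s (\<lambda>as. g as m)"
  by (simp add: multi_def)

lemma multiI: "(\<And>as. linform t (g as)) \<Longrightarrow> (\<And>m. lmulti s (\<lambda>as. g as m)) \<Longrightarrow> multi s t g"
  by (simp add: multi_def)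

lemma multi_Cons: "multi s t g \<Longrightarrow> multi s t (\<lambda>as. g (a # as))"
  using lmulti_Cons[of s "\<lambda>as. g as _"] by (simp add: multi_def)

lemma multi_append: "multi s t g \<Longrightarrow> multi s t (\<lambda>as. g (as @ bs))"
  using lmulti_append[of s "\<lambda>as. g as _"] by (simp add: multi_def)

lemma multi_split:
  assumes "linform t (g [])" "\<And>as m. linform s (\<lambda>a. g (a # as) m)" "\<And>a. multi s t (\<lambda>as. g (a # as))"
  shows "multi s t g"
proof (rule multiI)
  show "linform t (g as)" for as
    using assms(1) multi_linform[OF assms(3)] by (cases as) auto
  show "lmulti s (\<lambda>as. g as m)" for m
    by (rule lmulti_split[OF assms(2) multi_lmulti[OF assms(3)]])
qed

lemma multi_zero [simp]: "multi s t (\<lambda>_ _. 0)"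
  by (simp add: multi_def lmulti_def)

lemma ev_pow_rel:
  assumes "lmulti s h" "p \<in> pow_rel s r"
  shows "ev p h = 0"
proof (rule ev_span_zero[OF assms(2)[unfolded pow_rel_def]])
  fix q assume "q \<in> \<Union>{slot_relations s (\<lambda>a. as @ a # as') | as as'. Suc (length as + length as') = r}"
  then obtain as as' where "q \<in> slot_relations s (\<lambda>a. as @ a # as')" by blast
  then show "ev q h = 0"
    using lmultiD[OF assms(1), of as as'] unfolding slot_relations_def linform_def by auto
qed

text \<open>The easy half of the duality between relations and forms;
  \<open>mid_rel_separation\<close> is the converse.\<close>

lemma ev_mid_rel:
  assumes "multi s t g" "p \<in> mid_rel s t i j"
  shows "ev p (\<lambda>(as, m, bs). g (as @ bs) m) = 0"
proof (rule ev_span_zero[OF assms(2)[unfolded mid_rel_def]])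
  fix q
  assume "q \<in> \<Union>{slot_relations s (\<lambda>a. (as @ a # as', m, bs)) | as as' m bs.
         Suc (length as + length as') = i \<and> length bs = j} \<union>
     \<Union>{slot_relations t (\<lambda>m. (as, m, bs)) | as bs. length as = i \<and> length bs = j} \<union>
     \<Union>{slot_relations s (\<lambda>b. (as, m, bs @ b # bs')) | as m bs bs'.
         length as = i \<and> Suc (length bs + length bs') = j}"
  then consider (l) as as' m bs where "q \<in> slot_relations s (\<lambda>a. (as @ a # as', m, bs))"
    | (m) as bs where "q \<in> slot_relations t (\<lambda>m. (as, m, bs))"
    | (r) as m bs bs' where "q \<in> slot_relations s (\<lambda>b. (as, m, bs @ b # bs'))"
    by blast
  then show "ev q (\<lambda>(as, m, bs). g (as @ bs) m) = 0"
  proof cases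
    case l
    then show ?thesis using lmultiD[OF multi_lmulti[OF assms(1)], of as "as' @ bs"]
      unfolding slot_relations_def linform_def by auto
  next
    case m
    then show ?thesis using multi_linform[OF assms(1)]
      unfolding slot_relations_def linform_def by auto
  next
    case r
    then show ?thesis using lmultiD[OF multi_lmulti[OF assms(1)], of "as @ bs" bs']
      unfolding slot_relations_def linform_def by auto
  qed
qed

section \<open>Multilinear forms detect the relations\<close>

lemma linform_slot:
  assumes "\<And>q. q \<in> slot_relations s \<sigma> \<Longrightarrow> ev q h = 0"
  shows "linform s (\<lambda>a. h (\<sigma> a))"
  unfolding linform_def
proof (intro conjI allI)
  fix u v
  have "bas (\<sigma> (u + v)) - bas (\<sigma> u) - bas (\<sigma> v) \<in> slot_relations s \<sigma>"
    unfolding slot_relations_def by blast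
  from assms[OF this] show "h (\<sigma> (u + v)) = h (\<sigma> u) + h (\<sigma> v)"
    by (simp add: algebra_simps)
next
  fix c u
  have "bas (\<sigma> (s c u)) - fscale c (bas (\<sigma> u)) \<in> slot_relations s \<sigma>"
    unfolding slot_relations_def by blast
  from assms[OF this] show "h (\<sigma> (s c u)) = c * h (\<sigma> u)"
    by simp
qed

lemma keys_slot_relations:
  assumes "q \<in> slot_relations s \<sigma>" "range \<sigma> \<subseteq> D"
  shows "Poly_Mapping.keys q \<subseteq> D"
proof -
  have \<sigma>: "Poly_Mapping.keys (bas (\<sigma> u)) \<subseteq> D" for u
    using assms(2) by auto
  from assms(1) consider u v where "q = bas (\<sigma> (u + v)) - bas (\<sigma> u) - bas (\<sigma> v)"
    | c u where "q = bas (\<sigma> (s c u)) - fscale c (bas (\<sigma> u))"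
    unfolding slot_relations_def by blast
  then show ?thesis
    by cases (simp_all only: keys_diff_subset \<sigma> order.trans[OF keys_fscale \<sigma>])
qed

text \<open>A separating functional \<open>h\<close> kills the relations, hence is linear in every
  slot, but only on triples with lists of lengths \<open>i\<close> and \<open>j\<close>. Cutting a
  list of length \<open>i + j\<close> after \<open>i\<close> entries, and taking 0 on all other
  lengths, makes it a form on lists of every length.\<close>

lemma mid_rel_separation:
  assumes keys: "Poly_Mapping.keys p \<subseteq> mid_dom i j"
    and ev: "\<And>g. multi s t g \<Longrightarrow> ev p (\<lambda>(as, m, bs). g (as @ bs) m) = 0"
  shows "p \<in> mid_rel s t i j"
proof (rule ccontr)
  assume "p \<notin> mid_rel s t i j"
  then obtain h where h: "\<And>q. q \<in> mid_rel s t i j \<Longrightarrow> ev q h = 0" and ph: "ev p h \<noteq> 0"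
    unfolding mid_rel_def using separating_form by blast
  have left: "linform s (\<lambda>a. h (as @ a # as', m, bs))"
    if "Suc (length as + length as') = i" "length bs = j" for as as' m bs
  proof (rule linform_slot[OF h])
    fix q assume "q \<in> slot_relations s (\<lambda>a. (as @ a # as', m, bs))"
    with that show "q \<in> mid_rel s t i j"
      unfolding mid_rel_def by (intro free.span_base UnI1 UnionI[of "slot_relations s (\<lambda>a. (as @ a # as', m, bs))"]) blast+
  qed
  have mid: "linform t (\<lambda>m. h (as, m, bs))" if "length as = i" "length bs = j" for as bs
  proof (rule linform_slot[OF h])
    fix q assume "q \<in> slot_relations t (\<lambda>m. (as, m, bs))"
    with that show "q \<in> mid_rel s t i j"
      unfolding mid_rel_def by (intro free.span_base UnI1 UnI2[of _ "\<Union>_" "\<Union>_"]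
          UnionI[of "slot_relations t (\<lambda>m. (as, m, bs))"]) blast+
  qed
  have right: "linform s (\<lambda>b. h (as, m, bs @ b # bs'))"
    if "length as = i" "Suc (length bs + length bs') = j" for as m bs bs'
  proof (rule linform_slot[OF h])
    fix q assume "q \<in> slot_relations s (\<lambda>b. (as, m, bs @ b # bs'))"
    with that show "q \<in> mid_rel s t i j"
      unfolding mid_rel_def by (intro free.span_base UnI2 UnionI[of "slot_relations s (\<lambda>b. (as, m, bs @ b # bs'))"]) blast+
  qed
  define g where "g as m = (if length as = i + j then h (take i as, m, drop i as) else 0)" for as m
  have "multi s t g"
    unfolding multi_def lmulti_def
  proof (intro conjI allI)
    show "linform t (g as)" for as
      by (cases "length as = i + j") (auto simp: g_def[abs_def] intro!: mid)
    show "linform s (\<lambda>a. g (as @ a # as') m)" for as as' m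
    proof (cases "Suc (length as + length as') = i + j")
      case len: True
      show ?thesis
      \<comment> \<open>The varying slot lies in the block before or in the block after the module
        factor.\<close>
      proof (cases "length as < i")
        case True
        then have "i - length as = Suc (i - Suc (length as))" by simp
        then have "take (i - length as) (a # as') = a # take (i - Suc (length as)) as'"
          "drop (i - length as) (a # as') = drop (i - Suc (length as)) as'" for a
          by simp_all
        then show ?thesis using True len
          by (auto simp: g_def intro!: left)
      next
        case False
        then show ?thesis using len
          by (auto simp: g_def intro!: right)
      qed
    qed (simp add: g_def)
  qed
  from ev[OF this] have "ev p (\<lambda>(as, m, bs). g (as @ bs) m) = 0" .
  \<comment> \<open>On the support of \<open>p\<close> the lengths are right, so cutting recovers
    \<open>h\<close>.\<close>
  also have "ev p (\<lambda>(as, m, bs). g (as @ bs) m) = ev p h"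
    using keys by (intro ev_cong) (auto simp: g_def mid_dom_def)
  finally show False using ph by simp
qed

text \<open>Every generator is supported on triples of the prescribed lengths; therefore the
  representative chosen by \<open>rep\<close> still consists of such triples.\<close>

lemma keys_mid_rel:
  assumes "p \<in> mid_rel s t i j"
  shows "Poly_Mapping.keys p \<subseteq> mid_dom i j"
proof (rule keys_span[OF assms[unfolded mid_rel_def]])
  fix q
  assume "q \<in> \<Union>{slot_relations s (\<lambda>a. (as @ a # as', m, bs)) | as as' m bs.
         Suc (length as + length as') = i \<and> length bs = j} \<union>
     \<Union>{slot_relations t (\<lambda>m. (as, m, bs)) | as bs. length as = i \<and> length bs = j} \<union>
     \<Union>{slot_relations s (\<lambda>b. (as, m, bs @ b # bs')) | as m bs bs'.
         length as = i \<and> Suc (length bs + length bs') = j}"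
  then consider (l) as as' m bs where "q \<in> slot_relations s (\<lambda>a. (as @ a # as', m, bs))"
        "Suc (length as + length as') = i" "length bs = j"
    | (m) as bs where "q \<in> slot_relations t (\<lambda>m. (as, m, bs))" "length as = i" "length bs = j"
    | (r) as m bs bs' where "q \<in> slot_relations s (\<lambda>b. (as, m, bs @ b # bs'))"
        "length as = i" "Suc (length bs + length bs') = j"
    by blast
  then show "Poly_Mapping.keys q \<subseteq> mid_dom i j"
    by cases (erule keys_slot_relations; auto simp: mid_dom_def)+
qed

lemma keys_pow_rel:
  assumes "p \<in> pow_rel s r"
  shows "Poly_Mapping.keys p \<subseteq> pow_dom r"
proof (rule keys_span[OF assms[unfolded pow_rel_def]])
  fix q assume "q \<in> \<Union>{slot_relations s (\<lambda>a. as @ a # as') | as as'. Suc (length as + length as') = r}"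
  then obtain as as' where "q \<in> slot_relations s (\<lambda>a. as @ a # as')" "Suc (length as + length as') = r"
    by blast
  then show "Poly_Mapping.keys q \<subseteq> pow_dom r"
    by (elim keys_slot_relations) (auto simp: pow_dom_def)
qed


section \<open>Classes of formal sums\<close>

lemma subspace_rel [simp]: "free.subspace (pow_rel s r)" "free.subspace (mid_rel s t i j)"
  by (simp_all add: pow_rel_def mid_rel_def free.subspace_span)

lemma rep_in: "free.subspace R \<Longrightarrow> rep (cls R p) - p \<in> R"
  unfolding rep_def cls_def
  by (rule someI2[where a=p]) (auto simp: free.subspace_0)

lemma cls_eqI: "free.subspace R \<Longrightarrow> p - q \<in> R \<Longrightarrow> cls R p = cls R q"
  unfolding cls_def
  using free.subspace_add[of R "_ - p" "p - q"] free.subspace_diff[of R "_ - q" "p - q"]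
  by (auto simp: algebra_simps)

lemma cls_rep: "free.subspace R \<Longrightarrow> X \<in> qspace R D \<Longrightarrow> cls R (rep X) = X"
  unfolding qspace_def using rep_in by (auto intro!: cls_eqI)

lemma cls_in_qspace: "Poly_Mapping.keys p \<subseteq> D \<Longrightarrow> cls R p \<in> qspace R D"
  by (simp add: qspace_def)

lemma keys_rep:
  assumes "free.subspace R" "\<And>p. p \<in> R \<Longrightarrow> Poly_Mapping.keys p \<subseteq> D" "X \<in> qspace R D"
  shows "Poly_Mapping.keys (rep X) \<subseteq> D"
proof -
  obtain p where p: "X = cls R p" "Poly_Mapping.keys p \<subseteq> D"
    using assms(3) by (auto simp: qspace_def)
  have "rep X - p \<in> R" using rep_in[OF assms(1)] p(1) by simp
  then have "Poly_Mapping.keys ((rep X - p) + p) \<subseteq> D"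
    using assms(2) p(2) by (intro keys_add_subset)
  then show ?thesis by simp
qed

lemma keys_rep_pow:
  "X \<in> qspace (pow_rel s r) (pow_dom r) \<Longrightarrow> Poly_Mapping.keys (rep X) \<subseteq> pow_dom r"
  by (rule keys_rep[OF _ keys_pow_rel]) auto

lemma keys_rep_mid:
  "X \<in> qspace (mid_rel s t i j) (mid_dom i j) \<Longrightarrow> Poly_Mapping.keys (rep X) \<subseteq> mid_dom i j"
  by (rule keys_rep[OF _ keys_mid_rel]) auto

lemma ev_rep_cls_pow: "lmulti s h \<Longrightarrow> ev (rep (cls (pow_rel s r) p)) h = ev p h"
  using ev_pow_rel[OF _ rep_in[OF subspace_rel(1)]] by force

text \<open>A form on lists and module elements is evaluated on \<open>V\<^sup>i \<otimes> W \<otimes> V\<^sup>j\<close> by moving the factor in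
  \<open>W\<close> to the end.\<close>

definition pair :: "('a list \<times> 'm \<times> 'a list \<Rightarrow>\<^sub>0 'k::field) \<Rightarrow> ('a list \<Rightarrow> 'm \<Rightarrow> 'k) \<Rightarrow> 'k"
  where "pair p g = ev p (\<lambda>(as, m, bs). g (as @ bs) m)"

text \<open>The chosen representative differs from \<open>p\<close> by a relation, on which
  multilinear forms vanish.\<close>

lemma pair_rep_cls: "multi s t g \<Longrightarrow> pair (rep (cls (mid_rel s t i j) p)) g = pair p g"
  using ev_mid_rel[OF _ rep_in[OF subspace_rel(2)]] unfolding pair_def by force

lemma pair_eq:
  assumes "cls (mid_rel s t i j) p = cls (mid_rel s t i j) q" "multi s t g"
  shows "pair p g = pair q g"
  using pair_rep_cls[OF assms(2), of i j p] pair_rep_cls[OF assms(2), of i j q] assms(1) by simp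

lemma qspace_eqI:
  assumes X: "X \<in> qspace (mid_rel s t i j) (mid_dom i j)"
    and Y: "Y \<in> qspace (mid_rel s t i j) (mid_dom i j)"
    and eq: "\<And>g. multi s t g \<Longrightarrow> pair (rep X) g = pair (rep Y) g"
  shows "X = Y"
proof -
  have "rep X - rep Y \<in> mid_rel s t i j"
    using keys_diff_subset[OF keys_rep_mid[OF X] keys_rep_mid[OF Y]] eq
    by (intro mid_rel_separation) (auto simp: pair_def)
  then show ?thesis
    using cls_eqI[OF subspace_rel(2)] cls_rep[OF subspace_rel(2) X] cls_rep[OF subspace_rel(2) Y]
    by metis
qed

lemma pair_qadd:
  "multi s t g \<Longrightarrow> pair (rep (qadd (mid_rel s t i j) X Y)) g = pair (rep X) g + pair (rep Y) g"
  unfolding qadd_def by (simp add: pair_rep_cls) (simp add: pair_def)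

lemma pair_qscale:
  "multi s t g \<Longrightarrow> pair (rep (qscale (mid_rel s t i j) c X)) g = c * pair (rep X) g"
  unfolding qscale_def by (simp add: pair_rep_cls) (simp add: pair_def)

lemma pair_qaltsum:
  "multi s t g \<Longrightarrow>
    pair (rep (qaltsum (mid_rel s t i j) r X)) g = (\<Sum>l\<le>r. (- 1) ^ l * pair (rep (X l)) g)"
  unfolding qaltsum_def by (simp add: pair_rep_cls) (simp add: pair_def)

lemma qadd_in_qspace:
  assumes "X \<in> qspace (mid_rel s t i j) (mid_dom i j)" "Y \<in> qspace (mid_rel s t i j) (mid_dom i j)"
  shows "qadd (mid_rel s t i j) X Y \<in> qspace (mid_rel s t i j) (mid_dom i j)"
  unfolding qadd_def by (intro cls_in_qspace keys_add_subset keys_rep_mid[OF assms(1)] keys_rep_mid[OF assms(2)])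

lemma qscale_in_qspace:
  assumes "X \<in> qspace (mid_rel s t i j) (mid_dom i j)"
  shows "qscale (mid_rel s t i j) c X \<in> qspace (mid_rel s t i j) (mid_dom i j)"
  unfolding qscale_def
  by (intro cls_in_qspace order.trans[OF keys_fscale] keys_rep_mid[OF assms])

lemma qaltsum_in_qspace:
  assumes "\<And>l. l \<le> r \<Longrightarrow> X l \<in> qspace (mid_rel s t i j) (mid_dom i j)"
  shows "qaltsum (mid_rel s t i j) r X \<in> qspace (mid_rel s t i j) (mid_dom i j)"
  unfolding qaltsum_def
  by (intro cls_in_qspace keys_sum_subset order.trans[OF keys_fscale] keys_rep_mid[OF assms]) simp

lemma qadd_cls:
  "qadd (mid_rel s t i j) (cls (mid_rel s t i j) p) (cls (mid_rel s t i j) q) = cls (mid_rel s t i j) (p + q)"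
proof -
  let ?R = "mid_rel s t i j"
  have "(rep (cls ?R p) - p) + (rep (cls ?R q) - q) \<in> ?R"
    by (intro free.subspace_add rep_in subspace_rel)
  then show ?thesis
    unfolding qadd_def by (intro cls_eqI) (auto simp: algebra_simps)
qed

lemma qscale_cls:
  "qscale (mid_rel s t i j) c (cls (mid_rel s t i j) p) = cls (mid_rel s t i j) (fscale c p)"
proof -
  let ?R = "mid_rel s t i j"
  have "fscale c (rep (cls ?R p) - p) \<in> ?R"
    by (intro free.subspace_scale rep_in subspace_rel)
  then show ?thesis
    unfolding qscale_def by (intro cls_eqI) (auto simp: free.scale_right_diff_distrib)
qed

section \<open>Forms of small arity, extended by zero to lists of other lengths\<close>

lemma lmulti_case0: "lmulti s (\<lambda>l. case l of [] \<Rightarrow> c | _ \<Rightarrow> 0)"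
  by (rule lmulti_split) (simp_all add: lmulti_def)

lemma lmulti_case1:
  assumes "linform s g"
  shows "lmulti s (\<lambda>l. case l of [x] \<Rightarrow> g x | _ \<Rightarrow> 0)"
proof (rule lmulti_split)
  show "linform s (\<lambda>a. case a # as of [x] \<Rightarrow> g x | _ \<Rightarrow> 0)" for as
    using assms by (cases as) simp_all
qed (use lmulti_case0 in simp)

lemma lmulti_case2:
  assumes "\<And>y. linform s (\<lambda>x. g x y)" "\<And>x. linform s (\<lambda>y. g x y)"
  shows "lmulti s (\<lambda>l. case l of [x, y] \<Rightarrow> g x y | _ \<Rightarrow> 0)"
proof (rule lmulti_split)
  show "linform s (\<lambda>a. case a # as of [x, y] \<Rightarrow> g x y | _ \<Rightarrow> 0)" for as
    using assms(1) by (cases as rule: remdups_adj.cases) simp_all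
qed (use lmulti_case1[OF assms(2)] in simp)

lemma lmulti_case3:
  assumes "\<And>y z. linform s (\<lambda>x. g x y z)" "\<And>x z. linform s (\<lambda>y. g x y z)"
    "\<And>x y. linform s (\<lambda>z. g x y z)"
  shows "lmulti s (\<lambda>l. case l of [x, y, z] \<Rightarrow> g x y z | _ \<Rightarrow> 0)"
proof (rule lmulti_split)
  show "linform s (\<lambda>a. case a # as of [x, y, z] \<Rightarrow> g x y z | _ \<Rightarrow> 0)" for as
  proof (cases as rule: remdups_adj.cases)
    case (3 y z zs)
    then show ?thesis using assms(1) by (cases zs) simp_all
  qed simp_all
qed (use lmulti_case2[OF assms(2,3)] in simp)

lemma multi_case1:
  assumes "\<And>m. linform s (\<lambda>x. g x m)" "\<And>x. linform t (\<lambda>m. g x m)"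
  shows "multi s t (\<lambda>l m. case l of [x] \<Rightarrow> g x m | _ \<Rightarrow> 0)"
proof (rule multiI)
  show "linform t (\<lambda>m. case as of [x] \<Rightarrow> g x m | _ \<Rightarrow> 0)" for as
    using assms(2) by (cases as rule: remdups_adj.cases) simp_all
qed (rule lmulti_case1[OF assms(1)])

lemma multi_case2:
  assumes "\<And>y m. linform s (\<lambda>x. g x y m)" "\<And>x m. linform s (\<lambda>y. g x y m)"
    "\<And>x y. linform t (\<lambda>m. g x y m)"
  shows "multi s t (\<lambda>l m. case l of [x, y] \<Rightarrow> g x y m | _ \<Rightarrow> 0)"
proof (rule multi_split)
  show "linform s (\<lambda>a. case a # as of [x, y] \<Rightarrow> g x y m | _ \<Rightarrow> 0)" for as m
    using assms(1) by (cases as rule: remdups_adj.cases) simp_all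
qed (use multi_case1[OF assms(2,3)] in simp_all)


section \<open>Sweedler sums as functionals\<close>

text \<open>\<open>dlt\<close>, \<open>lam\<close> and \<open>rho\<close> are the Sweedler sums of
  g(a_1, a_2), g(m_(-1), m_(0)) and g(m_0, m_1). Here \<open>g\<close> is any function; linearity is
  required only where a different representative appears.\<close>

definition dlt :: "('k::field, 'a::ring_1) bialg \<Rightarrow> 'a \<Rightarrow> ('a \<Rightarrow> 'a \<Rightarrow> 'k) \<Rightarrow> 'k"
  where "dlt A a g = ev (rep (comult A a)) (\<lambda>w. g (w ! 0) (w ! 1))"

definition lam :: "('k::field, 'a::ring_1, 'm::ab_group_add) hbim \<Rightarrow> 'm \<Rightarrow> ('a \<Rightarrow> 'm \<Rightarrow> 'k) \<Rightarrow> 'k"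
  where "lam M m g = ev (rep (lcoact M m)) (\<lambda>(c, m0, _). g (hd c) m0)"

definition rho :: "('k::field, 'a::ring_1, 'm::ab_group_add) hbim \<Rightarrow> 'm \<Rightarrow> ('m \<Rightarrow> 'a \<Rightarrow> 'k) \<Rightarrow> 'k"
  where "rho M m g = ev (rep (rcoact M m)) (\<lambda>(_, m0, d). g m0 (hd d))"

lemma ev_dlt: "ev p (\<lambda>z. dlt A a (g z)) = dlt A a (\<lambda>x y. ev p (\<lambda>z. g z x y))"
  unfolding dlt_def by (rule ev_swap)

lemma ev_lam: "ev p (\<lambda>z. lam M m (g z)) = lam M m (\<lambda>c m0. ev p (\<lambda>z. g z c m0))"
  unfolding lam_def by (subst ev_swap) (simp add: case_prod_unfold)

lemma ev_rho: "ev p (\<lambda>z. rho M m (g z)) = rho M m (\<lambda>m0 d. ev p (\<lambda>z. g z m0 d))"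
  unfolding rho_def by (subst ev_swap) (simp add: case_prod_unfold)

lemma dlt_swap: "dlt A a (\<lambda>x y. dlt A b (\<lambda>u v. g x y u v)) = dlt A b (\<lambda>u v. dlt A a (\<lambda>x y. g x y u v))"
  unfolding dlt_def by (rule ev_swap)

lemma dlt_lam: "dlt A a (\<lambda>x y. lam M m (g x y)) = lam M m (\<lambda>c m0. dlt A a (\<lambda>x y. g x y c m0))"
  unfolding dlt_def by (rule ev_lam)

lemma dlt_rho: "dlt A a (\<lambda>x y. rho M m (g x y)) = rho M m (\<lambda>m0 d. dlt A a (\<lambda>x y. g x y m0 d))"
  unfolding dlt_def by (rule ev_rho)

lemma dlt_null [simp]: "dlt A a (\<lambda>x y. 0) = 0"
  by (simp add: dlt_def)

lemma lam_null [simp]: "lam M m (\<lambda>x y. 0) = 0"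
  by (simp add: lam_def case_prod_unfold)

lemma rho_null [simp]: "rho M m (\<lambda>x y. 0) = 0"
  by (simp add: rho_def case_prod_unfold)

lemma linform_dlt: "(\<And>x y. linform s (\<lambda>a. G a x y)) \<Longrightarrow> linform s (\<lambda>a. dlt A b (\<lambda>x y. G a x y))"
  unfolding dlt_def by (rule linform_ev)

lemma linform_lam: "(\<And>x y. linform s (\<lambda>a. G a x y)) \<Longrightarrow> linform s (\<lambda>a. lam M m (\<lambda>x y. G a x y))"
  unfolding lam_def case_prod_unfold by (rule linform_ev)

lemma linform_rho: "(\<And>x y. linform s (\<lambda>a. G a x y)) \<Longrightarrow> linform s (\<lambda>a. rho M m (\<lambda>x y. G a x y))"
  unfolding rho_def case_prod_unfold by (rule linform_ev)

lemma linform_comp: "linform t h \<Longrightarrow> Vector_Spaces.linear s t f \<Longrightarrow> linform s (\<lambda>a. h (f a))"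
  by (simp add: linform_def Vector_Spaces.linear_iff)

lemma linform_linext:
  assumes "vector_space s" "linform s h"
  shows "h (linext s p g) = ev p (\<lambda>x. h (g x))"
proof -
  have "h 0 = 0" using assms(2) unfolding linform_def by (metis add_cancel_left_left add.right_neutral)
  then have sum: "h (sum f I) = (\<Sum>i\<in>I. h (f i))" for f :: "'c \<Rightarrow> _" and I
    by (induction I rule: infinite_finite_induct) (use assms(2) in \<open>auto simp: linform_def\<close>)
  show ?thesis using assms(2) unfolding linext_def sum by (auto simp: linform_def)
qed

section \<open>The bialgebra axioms for functionals\<close>

context bialgebra
begin

lemma linform_mult1: "linform (ascale A) h \<Longrightarrow> linform (ascale A) (\<lambda>a. h (a * b))"
  by (rule linform_comp[OF _ mult_linear_left])

lemma linform_mult2: "linform (ascale A) h \<Longrightarrow> linform (ascale A) (\<lambda>a. h (b * a))"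
  by (rule linform_comp[OF _ mult_linear_right])

lemma linform_counit: "linform (ascale A) (counit A)"
  using counit_linear by (simp add: linform_def Vector_Spaces.linear_iff)

lemma keys_comult: "w \<in> Poly_Mapping.keys (rep (comult A a)) \<Longrightarrow> \<exists>x y. w = [x, y]"
  using keys_rep_pow[OF comult_closed]
  by (fastforce simp: pow_dom_def numeral_2_eq_2 length_Suc_conv)

text \<open>The chosen representative of a coproduct is supported on lists of length 2, so
  \<open>g\<close> can be replaced by a form on all lists, to which equalities of classes
  apply.\<close>

lemma dlt_case: "dlt A a g = ev (rep (comult A a)) (\<lambda>l. case l of [x, y] \<Rightarrow> g x y | _ \<Rightarrow> 0)"
  unfolding dlt_def by (intro ev_cong) (auto dest!: keys_comult)

text \<open>The representatives depend on \<open>a\<close> linearly only modulo relations, and a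
  bilinear \<open>g\<close> does not see relations.\<close>

lemma linform_dlt_arg:
  assumes "\<And>y. linform (ascale A) (\<lambda>x. g x y)" "\<And>x. linform (ascale A) (\<lambda>y. g x y)"
  shows "linform (ascale A) (\<lambda>a. dlt A a g)"
  using comult_linear lmulti_case2[OF assms]
  unfolding dlt_case linear_to_quotient_def linform_def qadd_def qscale_def
  by (simp add: ev_rep_cls_pow)

lemma dlt_mult:
  assumes "\<And>y. linform (ascale A) (\<lambda>x. g x y)" "\<And>x. linform (ascale A) (\<lambda>y. g x y)"
  shows "dlt A (a * b) g = dlt A a (\<lambda>x y. dlt A b (\<lambda>u v. g (x * u) (y * v)))"
  using lmulti_case2[OF assms]
  unfolding dlt_case[of "a * b"] comult_mult by (simp add: ev_rep_cls_pow dlt_def)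

lemma dlt_coassoc:
  assumes "\<And>y z. linform (ascale A) (\<lambda>x. g x y z)" "\<And>x z. linform (ascale A) (\<lambda>y. g x y z)"
    "\<And>x y. linform (ascale A) (\<lambda>z. g x y z)"
  shows "dlt A a (\<lambda>x z. dlt A x (\<lambda>u v. g u v z)) = dlt A a (\<lambda>x y. dlt A y (\<lambda>u v. g x u v))"
  using arg_cong[OF coassoc, of "\<lambda>X. ev (rep X) (\<lambda>l. case l of [x, y, z] \<Rightarrow> g x y z | _ \<Rightarrow> 0)" a]
  by (simp add: ev_rep_cls_pow[OF lmulti_case3[OF assms]] dlt_def)

lemma dlt_counit_left:
  assumes "linform (ascale A) h"
  shows "dlt A a (\<lambda>x y. counit A x * h y) = h a"
  using arg_cong[OF counit_left, of h a] assms
  unfolding linform_linext[OF vector_space_axioms assms] dlt_def by (simp add: linform_def)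

lemma dlt_counit_right:
  assumes "linform (ascale A) h"
  shows "dlt A a (\<lambda>x y. counit A y * h x) = h a"
  using arg_cong[OF counit_right, of h a] assms
  unfolding linform_linext[OF vector_space_axioms assms] dlt_def by (simp add: linform_def)

end

section \<open>The Hopf bimodule axioms for functionals\<close>

context hopf_bimodule
begin

lemma linform_lact: "linform (mscale M) h \<Longrightarrow> linform (mscale M) (\<lambda>m. h (lact M a m))"
  by (rule linform_comp[OF _ lact_linear])

lemma linform_lact': "linform (mscale M) h \<Longrightarrow> linform (ascale A) (\<lambda>a. h (lact M a m))"
  by (rule linform_comp[OF _ lact_linear'])

lemma linform_ract: "linform (mscale M) h \<Longrightarrow> linform (mscale M) (\<lambda>m. h (ract M m a))"
  by (rule linform_comp[OF _ ract_linear])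

lemma linform_ract': "linform (mscale M) h \<Longrightarrow> linform (ascale A) (\<lambda>a. h (ract M m a))"
  by (rule linform_comp[OF _ ract_linear'])

lemma keys_lcoact: "z \<in> Poly_Mapping.keys (rep (lcoact M m)) \<Longrightarrow> \<exists>c m0. z = ([c], m0, [])"
  using keys_rep_mid[OF lcoact_closed]
  by (fastforce simp: mid_dom_def length_Suc_conv)

lemma keys_rcoact: "z \<in> Poly_Mapping.keys (rep (rcoact M m)) \<Longrightarrow> \<exists>m0 d. z = ([], m0, [d])"
  using keys_rep_mid[OF rcoact_closed]
  by (fastforce simp: mid_dom_def length_Suc_conv)

lemma lam_case: "lam M m g = pair (rep (lcoact M m)) (\<lambda>l m. case l of [c] \<Rightarrow> g c m | _ \<Rightarrow> 0)"
  unfolding lam_def pair_def by (intro ev_cong) (auto dest!: keys_lcoact)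

lemma rho_case: "rho M m g = pair (rep (rcoact M m)) (\<lambda>l m. case l of [d] \<Rightarrow> g m d | _ \<Rightarrow> 0)"
  unfolding rho_def pair_def by (intro ev_cong) (auto dest!: keys_rcoact)

lemma linform_lam_arg:
  assumes "\<And>m0. linform (ascale A) (\<lambda>c. g c m0)" "\<And>c. linform (mscale M) (\<lambda>m0. g c m0)"
  shows "linform (mscale M) (\<lambda>m. lam M m g)"
  using lcoact_linear multi_case1[OF assms]
  unfolding lam_case linear_to_quotient_def linform_def
  by (simp add: pair_qadd pair_qscale)

lemma linform_rho_arg:
  assumes "\<And>m0. linform (ascale A) (\<lambda>d. g m0 d)" "\<And>d. linform (mscale M) (\<lambda>m0. g m0 d)"
  shows "linform (mscale M) (\<lambda>m. rho M m g)"
  using rcoact_linear multi_case1[of "ascale A" "\<lambda>d m0. g m0 d", OF assms]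
  unfolding rho_case linear_to_quotient_def linform_def
  by (simp add: pair_qadd pair_qscale)

lemma lam_lact:
  assumes "\<And>m0. linform (ascale A) (\<lambda>c. g c m0)" "\<And>c. linform (mscale M) (\<lambda>m0. g c m0)"
  shows "lam M (lact M a m) g = dlt A a (\<lambda>x y. lam M m (\<lambda>c m0. g (x * c) (lact M y m0)))"
  unfolding lam_case[of "lact M a m"] lcoact_lact pair_rep_cls[OF multi_case1[OF assms]]
  by (simp add: pair_def dlt_def lam_def case_prod_unfold)

lemma rho_lact:
  assumes "\<And>m0. linform (ascale A) (\<lambda>d. g m0 d)" "\<And>d. linform (mscale M) (\<lambda>m0. g m0 d)"
  shows "rho M (lact M a m) g = dlt A a (\<lambda>x y. rho M m (\<lambda>m0 d. g (lact M x m0) (y * d)))"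
  unfolding rho_case[of "lact M a m"] rcoact_lact
    pair_rep_cls[OF multi_case1[of "ascale A" "\<lambda>d m0. g m0 d", OF assms]]
  by (simp add: pair_def dlt_def rho_def case_prod_unfold)

lemma rho_ract:
  assumes "\<And>m0. linform (ascale A) (\<lambda>d. g m0 d)" "\<And>d. linform (mscale M) (\<lambda>m0. g m0 d)"
  shows "rho M (ract M m a) g = dlt A a (\<lambda>x y. rho M m (\<lambda>m0 d. g (ract M m0 x) (d * y)))"
  unfolding rho_case[of "ract M m a"] rcoact_ract
    pair_rep_cls[OF multi_case1[of "ascale A" "\<lambda>d m0. g m0 d", OF assms]] dlt_rho
  by (simp add: pair_def dlt_def rho_def case_prod_unfold)

text \<open>The coefficient \<open>d'\<close> of the inner coaction stands before the outer
  \<open>d\<close>: it is m_1, and \<open>d\<close> is m_2.\<close>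

lemma rho_coassoc:
  assumes "\<And>d d'. linform (mscale M) (\<lambda>m0. g m0 d d')" "\<And>m0 d'. linform (ascale A) (\<lambda>d. g m0 d d')"
    "\<And>m0 d. linform (ascale A) (\<lambda>d'. g m0 d d')"
  shows "rho M m (\<lambda>m0 d. rho M m0 (\<lambda>m0' d'. g m0' d' d)) = rho M m (\<lambda>m0 d. dlt A d (\<lambda>x y. g m0 x y))"
proof -
  show ?thesis
    using pair_eq[OF rcoact_coassoc multi_case2[of "ascale A" "\<lambda>d d' m0. g m0 d d'", OF assms(2,3,1)], of m]
    by (simp add: pair_def rho_def case_prod_unfold dlt_case cong: list.case_cong)
qed

lemma lam_rho:
  assumes "\<And>m0 d. linform (ascale A) (\<lambda>c. g c m0 d)" "\<And>c m0. linform (ascale A) (\<lambda>d. g c m0 d)"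
    "\<And>c d. linform (mscale M) (\<lambda>m0. g c m0 d)"
  shows "rho M m (\<lambda>m0 d. lam M m0 (\<lambda>c m0'. g c m0' d)) = lam M m (\<lambda>c m0. rho M m0 (\<lambda>m0' d. g c m0' d))"
proof -
  \<comment> \<open>The axiom lives in A \<otimes> M \<otimes> A, where a form reads the two
    coefficients from one list. This fact and the next bring the nested functionals into that shape,
    using the known lengths in the coactions.\<close>
  have *: "lam M m (\<lambda>c m0. g c m0 (hd d)) =
      ev (rep (lcoact M m)) (\<lambda>z. case fst z @ d of [c, d'] \<Rightarrow> g c (fst (snd z)) d' | _ \<Rightarrow> 0)"
    if "\<exists>d'. d = [d']" for m d
    unfolding lam_def using that by (intro ev_cong) (auto dest!: keys_lcoact)
  have **: "rho M m (\<lambda>m0 d. g (hd c) m0 d) =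
      ev (rep (rcoact M m)) (\<lambda>z. case c @ snd (snd z) of [c, d'] \<Rightarrow> g c (fst (snd z)) d' | _ \<Rightarrow> 0)"
    if "\<exists>c'. c = [c']" for m c
    unfolding rho_def using that by (intro ev_cong) (auto dest!: keys_rcoact)
  have "rho M m (\<lambda>m0 d. lam M m0 (\<lambda>c m0'. g c m0' d)) =
     ev (rep (rcoact M m)) (\<lambda>y. ev (rep (lcoact M (fst (snd y))))
       (\<lambda>z. case fst z @ snd (snd y) of [c, d'] \<Rightarrow> g c (fst (snd z)) d' | _ \<Rightarrow> 0))"
    unfolding rho_def case_prod_unfold by (intro ev_cong *) (auto dest!: keys_rcoact)
  moreover have "lam M m (\<lambda>c m0. rho M m0 (\<lambda>m0' d. g c m0' d)) =
     ev (rep (lcoact M m)) (\<lambda>y. ev (rep (rcoact M (fst (snd y))))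
       (\<lambda>z. case fst y @ snd (snd z) of [c, d'] \<Rightarrow> g c (fst (snd z)) d' | _ \<Rightarrow> 0))"
    unfolding lam_def case_prod_unfold by (intro ev_cong **) (auto dest!: keys_lcoact)
  ultimately show ?thesis
    using pair_eq[OF lcoact_rcoact multi_case2[of "ascale A" "\<lambda>c d m0. g c m0 d", OF assms], of m]
    by (simp add: pair_def case_prod_unfold cong: list.case_cong)
qed

end


section \<open>Operators on forms\<close>

text \<open>Transposes of the operations of the context on \<open>N \<otimes> A\<^sup>p\<close> and \<open>A\<^sup>n \<otimes> M\<close>, written
  in continuation-passing style.  Ending the recursion of \<open>diag\<close> with the counit makes its clauses
  uniform in the length, including length \<open>0\<close>.  \<open>expand i\<close> belongs to \<open>c\<^sub>i\<close> for \<open>i \<le> p\<close> and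
  \<open>merge i\<close> to \<open>b\<^sub>i\<^sub>+\<^sub>1\<close>; the case of one remaining factor in \<open>merge\<close> covers \<open>b\<^sub>n\<^sub>+\<^sub>1\<close>.
  \<open>lco\<close> and \<open>rco\<close> are the codiagonal coactions on \<open>A\<^sup>n \<otimes> M\<close>.\<close>

fun diag :: "('k::field, 'a::ring_1) bialg \<Rightarrow> ('a \<Rightarrow> 'a \<Rightarrow> 'a) \<Rightarrow> 'a \<Rightarrow> 'a list \<Rightarrow> ('a list \<Rightarrow> 'k) \<Rightarrow> 'k" where
  "diag A f b [] h = counit A b * h []"
| "diag A f b (c # cs) h = dlt A b (\<lambda>x y. diag A f y cs (\<lambda>ds. h (f x c # ds)))"

definition diag_act :: "('k::field, 'a::ring_1) bialg \<Rightarrow> ('a \<Rightarrow> 'a \<Rightarrow> 'a) \<Rightarrow> ('a \<Rightarrow> 'n \<Rightarrow> 'n)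
    \<Rightarrow> 'a \<Rightarrow> ('a list \<Rightarrow> 'n \<Rightarrow> 'k) \<Rightarrow> 'a list \<Rightarrow> 'n \<Rightarrow> 'k"
  where "diag_act A f t b g bs x = dlt A b (\<lambda>u v. diag A f v bs (\<lambda>ds. g ds (t u x)))"

fun split_at :: "('k::field, 'a::ring_1) bialg \<Rightarrow> nat \<Rightarrow> 'a list \<Rightarrow> ('a list \<Rightarrow> 'k) \<Rightarrow> 'k" where
  "split_at A i [] h = 0"
| "split_at A 0 (c # cs) h = dlt A c (\<lambda>x y. h (x # y # cs))"
| "split_at A (Suc i) (c # cs) h = split_at A i cs (\<lambda>ds. h (c # ds))"

fun expand :: "('k::field, 'a::ring_1) bialg \<Rightarrow> ('k, 'a, 'n::ab_group_add) hbim \<Rightarrow> nat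
    \<Rightarrow> ('a list \<Rightarrow> 'n \<Rightarrow> 'k) \<Rightarrow> 'a list \<Rightarrow> 'n \<Rightarrow> 'k" where
  "expand A N 0 g bs x = rho N x (\<lambda>x0 d. g (d # bs) x0)"
| "expand A N (Suc i) g bs x = split_at A i bs (\<lambda>ds. g ds x)"

fun merge :: "('k::field, 'a::ring_1, 'm::ab_group_add) hbim \<Rightarrow> nat
    \<Rightarrow> ('a list \<Rightarrow> 'm \<Rightarrow> 'k) \<Rightarrow> 'a list \<Rightarrow> 'm \<Rightarrow> 'k" where
  "merge M i g [] m = 0"
| "merge M 0 g [a] m = g [] (lact M a m)"
| "merge M 0 g (a # b # as) m = g (a * b # as) m"
| "merge M (Suc i) g (a # as) m = merge M i (\<lambda>as. g (a # as)) as m"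

fun lco :: "('k::field, 'a::ring_1) bialg \<Rightarrow> ('k, 'a, 'm::ab_group_add) hbim
    \<Rightarrow> 'a list \<Rightarrow> 'm \<Rightarrow> ('a \<Rightarrow> 'a list \<Rightarrow> 'm \<Rightarrow> 'k) \<Rightarrow> 'k" where
  "lco A M [] m g = lam M m (\<lambda>c m0. g c [] m0)"
| "lco A M (a # as) m g = dlt A a (\<lambda>u v. lco A M as m (\<lambda>c vs m0. g (u * c) (v # vs) m0))"

fun rco :: "('k::field, 'a::ring_1) bialg \<Rightarrow> ('k, 'a, 'm::ab_group_add) hbim
    \<Rightarrow> 'a list \<Rightarrow> 'm \<Rightarrow> ('a list \<Rightarrow> 'm \<Rightarrow> 'a \<Rightarrow> 'k) \<Rightarrow> 'k" where
  "rco A M [] m g = rho M m (\<lambda>m0 d. g [] m0 d)"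
| "rco A M (a # as) m g = dlt A a (\<lambda>u v. rco A M as m (\<lambda>us m0 d. g (u # us) m0 (v * d)))"

text \<open>Each operator is a finite linear combination of values of its continuation, so an
  independent sum can be pulled out without any multilinearity. The versions for \<open>dlt\<close>,
  \<open>rho\<close> and \<open>lam\<close> are instances.\<close>

lemma diag_ev: "diag A f b bs (\<lambda>ds. ev p (\<lambda>z. h z ds)) = ev p (\<lambda>z. diag A f b bs (h z))"
  by (induction bs arbitrary: b h) (simp_all add: ev_times ev_dlt)

lemma split_at_ev: "split_at A i bs (\<lambda>ds. ev p (\<lambda>z. h z ds)) = ev p (\<lambda>z. split_at A i bs (h z))"
  \<comment> \<open>The induction rule has a continuation argument; \<open>h undefined\<close> fills
    that place while \<open>h\<close> itself is generalised.\<close>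
  by (induction A i bs "h undefined" arbitrary: h rule: split_at.induct) (simp_all add: ev_dlt)

lemma merge_ev: "merge M i (\<lambda>as m. ev p (\<lambda>z. h z as m)) as m = ev p (\<lambda>z. merge M i (h z) as m)"
  by (induction M i "h undefined" as m arbitrary: h rule: merge.induct) simp_all

lemma lco_ev: "lco A M as m (\<lambda>c vs m0. ev p (\<lambda>z. h z c vs m0)) = ev p (\<lambda>z. lco A M as m (h z))"
  by (induction as arbitrary: h) (simp_all add: ev_dlt ev_lam)

lemma rco_ev: "rco A M as m (\<lambda>us m0 d. ev p (\<lambda>z. h z us m0 d)) = ev p (\<lambda>z. rco A M as m (h z))"
  by (induction as arbitrary: h) (simp_all add: ev_dlt ev_rho)

lemma diag_dlt: "diag A f b bs (\<lambda>ds. dlt A a (\<lambda>x y. h x y ds)) = dlt A a (\<lambda>x y. diag A f b bs (h x y))"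
  unfolding dlt_def by (rule diag_ev)

lemma diag_rho: "diag A f b bs (\<lambda>ds. rho M m (\<lambda>x y. h x y ds)) = rho M m (\<lambda>x y. diag A f b bs (h x y))"
  unfolding rho_def case_prod_unfold by (rule diag_ev)

lemma diag_lam: "diag A f b bs (\<lambda>ds. lam M m (\<lambda>x y. h x y ds)) = lam M m (\<lambda>x y. diag A f b bs (h x y))"
  unfolding lam_def case_prod_unfold by (rule diag_ev)

lemma split_at_dlt: "split_at A i bs (\<lambda>ds. dlt A a (\<lambda>x y. h x y ds)) = dlt A a (\<lambda>x y. split_at A i bs (h x y))"
  unfolding dlt_def by (rule split_at_ev)

lemma split_at_rho: "split_at A i bs (\<lambda>ds. rho M m (\<lambda>x y. h x y ds)) = rho M m (\<lambda>x y. split_at A i bs (h x y))"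
  unfolding rho_def case_prod_unfold by (rule split_at_ev)

lemma split_at_lam: "split_at A i bs (\<lambda>ds. lam M m (\<lambda>x y. h x y ds)) = lam M m (\<lambda>x y. split_at A i bs (h x y))"
  unfolding lam_def case_prod_unfold by (rule split_at_ev)

lemma merge_dlt: "merge M i (\<lambda>as m. dlt A a (\<lambda>x y. h x y as m)) as m = dlt A a (\<lambda>x y. merge M i (h x y) as m)"
  unfolding dlt_def by (rule merge_ev)

lemma lco_dlt: "lco A M as m (\<lambda>c vs m0. dlt A a (\<lambda>x y. h x y c vs m0)) = dlt A a (\<lambda>x y. lco A M as m (h x y))"
  unfolding dlt_def by (rule lco_ev)

lemma rco_dlt: "rco A M as m (\<lambda>us m0 d. dlt A a (\<lambda>x y. h x y us m0 d)) = dlt A a (\<lambda>x y. rco A M as m (h x y))"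
  unfolding dlt_def by (rule rco_ev)

text \<open>A codiagonal coaction keeps the number of factors, so only lists of that length reach
  the continuation. This carries supports through \<open>rco\<close>.\<close>

lemma rco_cong:
  "(\<And>us. length us = length as \<Longrightarrow> g us = g' us) \<Longrightarrow> rco A M as m g = rco A M as m g'"
proof (induction as arbitrary: g g')
  case (Cons a as)
  have "rco A M as m (\<lambda>us m0 d. g (u # us) m0 (v * d)) = rco A M as m (\<lambda>us m0 d. g' (u # us) m0 (v * d))" for u v
    by (rule Cons.IH) (simp add: Cons.prems)
  then show ?case by simp
qed simp

lemma rco_null [simp]: "rco A M as m (\<lambda>_ _ _. 0) = 0"
  by (induction as) simp_all

lemma lco_cong:
  "(\<And>c vs. length vs = length as \<Longrightarrow> g c vs = g' c vs) \<Longrightarrow> lco A M as m g = lco A M as m g'"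
proof (induction as arbitrary: g g')
  case (Cons a as)
  have "lco A M as m (\<lambda>c vs. g (u * c) (v # vs)) = lco A M as m (\<lambda>c vs. g' (u * c) (v # vs))" for u v
    by (rule Cons.IH) (simp add: Cons.prems)
  then show ?case by simp
qed simp

lemma lco_null [simp]: "lco A M as m (\<lambda>_ _ _. 0) = 0"
  by (induction as) simp_all

lemma merge_support:
  assumes "\<And>as m. length as \<noteq> n \<Longrightarrow> g as m = 0" "length as \<noteq> Suc n"
  shows "merge M i g as m = 0"
  using assms
proof (induction M i g as m arbitrary: n rule: merge.induct)
  case (4 M i g a as m)
  show ?case
  proof (cases n)
    case 0
    then have "g (a # as) m = 0" for as m using 4(2) by simp
    then have "(\<lambda>as. g (a # as)) = (\<lambda>as m. 0)" by auto
    moreover have "merge M i (\<lambda>as m. 0) as m = 0"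
      using merge_ev[of M i 0 "\<lambda>_ _ _. 0" as m] by simp
    ultimately show ?thesis by simp
  next
    case (Suc n')
    have "merge M i (\<lambda>as. g (a # as)) as m = 0"
      by (rule 4(1)[of n']) (use 4(2,3) Suc in auto)
    then show ?thesis by simp
  qed
qed simp_all

lemma split_at_snoc: "i < length bs \<Longrightarrow> split_at A i (bs @ [d]) h = split_at A i bs (\<lambda>ds. h (ds @ [d]))"
  by (induction A i bs h rule: split_at.induct) simp_all

lemma split_at_last: "split_at A (length bs) (bs @ [d]) h = dlt A d (\<lambda>u v. h (bs @ [u, v]))"
  by (induction bs arbitrary: h) simp_all

text \<open>In this range \<open>expand\<close> touches the module factor or a factor of
  \<open>bs\<close>. The next index would split the appended \<open>d\<close>, see
  \<open>split_at_last\<close>.\<close>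

lemma expand_snoc:
  "i \<le> length bs \<Longrightarrow> expand A N i g (bs @ [d]) x = expand A N i (\<lambda>bs. g (bs @ [d])) bs x"
  by (cases i) (simp_all add: split_at_snoc)

section \<open>Linearity and multilinearity of the operators\<close>

lemma linform_diag:
  assumes "\<And>ds. linform s (\<lambda>a. h a ds)"
  shows "linform s (\<lambda>a. diag A f b bs (\<lambda>ds. h a ds))"
  using assms by (induction bs arbitrary: b h) (auto intro!: linform_times linform_dlt)

lemma linform_split_at:
  assumes "\<And>ds. linform s (\<lambda>a. h a ds)"
  shows "linform s (\<lambda>a. split_at A i bs (\<lambda>ds. h a ds))"
  using assms
proof (induction bs arbitrary: i h)
  case (Cons c bs)
  then show ?case by (cases i) (auto intro!: linform_dlt)
qed simp

lemma linform_merge: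
  assumes "\<And>as m. linform s (\<lambda>a. h a as m)"
  shows "linform s (\<lambda>a. merge M i (\<lambda>as m. h a as m) as m)"
  using assms by (induction M i "h undefined" as m arbitrary: h rule: merge.induct) auto

lemma linform_lco:
  assumes "\<And>c vs m0. linform s (\<lambda>a. h a c vs m0)"
  shows "linform s (\<lambda>a. lco A M as m (\<lambda>c vs m0. h a c vs m0))"
  using assms by (induction as arbitrary: h) (auto intro!: linform_dlt linform_lam)

lemma linform_rco:
  assumes "\<And>us m0 d. linform s (\<lambda>a. h a us m0 d)"
  shows "linform s (\<lambda>a. rco A M as m (\<lambda>us m0 d. h a us m0 d))"
  using assms by (induction as arbitrary: h) (auto intro!: linform_dlt linform_rho)

lemma lmulti_dlt: "(\<And>x y. lmulti s (\<lambda>as. G as x y)) \<Longrightarrow> lmulti s (\<lambda>as. dlt A a (\<lambda>x y. G as x y))"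
  by (auto simp: lmulti_def intro: linform_dlt)

lemma lmulti_rho: "(\<And>x y. lmulti s (\<lambda>as. G as x y)) \<Longrightarrow> lmulti s (\<lambda>as. rho M m (\<lambda>x y. G as x y))"
  by (auto simp: lmulti_def intro: linform_rho)

lemma lmulti_lam: "(\<And>x y. lmulti s (\<lambda>as. G as x y)) \<Longrightarrow> lmulti s (\<lambda>as. lam M m (\<lambda>x y. G as x y))"
  by (auto simp: lmulti_def intro: linform_lam)

lemma multi_dlt: "(\<And>x y. multi s t (\<lambda>as m. G as m x y)) \<Longrightarrow> multi s t (\<lambda>as m. dlt A a (\<lambda>x y. G as m x y))"
  by (auto simp: multi_def intro: linform_dlt lmulti_dlt)

lemma multi_head: "multi s t g \<Longrightarrow> linform s (\<lambda>a. g (a # as) m)"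
  by (rule lmulti_head[OF multi_lmulti])

lemma multi_last: "multi s t g \<Longrightarrow> linform s (\<lambda>a. g (as @ [a]) m)"
  by (rule lmulti_last[OF multi_lmulti])

context bialgebra
begin

lemma lmulti_split_at:
  assumes "lmulti (ascale A) h"
  shows "lmulti (ascale A) (\<lambda>bs. split_at A i bs h)"
  using assms
proof (induction i arbitrary: h)
  case 0
  show ?case
    by (rule lmulti_split)
      (auto intro!: linform_dlt_arg lmulti_dlt lmulti_head lmulti_head[OF lmulti_Cons] lmulti_Cons 0)
next
  case (Suc i)
  show ?case
    by (rule lmulti_split) (auto intro!: linform_split_at lmulti_head Suc.IH lmulti_Cons Suc.prems)
qed

text \<open>For \<open>i = j\<close> this is coassociativity, otherwise two different factors are
  split. The index \<open>Suc j\<close> reflects that splitting at \<open>i\<close> shifts the later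
  factors by one.\<close>

lemma split_at_split_at:
  assumes "lmulti (ascale A) h" "i \<le> j"
  shows "split_at A i bs (\<lambda>ds. split_at A (Suc j) ds h) = split_at A j bs (\<lambda>ds. split_at A i ds h)"
  using assms
proof (induction i arbitrary: j bs h)
  case 0
  show ?case
  proof (cases bs)
    case (Cons c cs)
    show ?thesis
    proof (cases j)
      case 0
      have "dlt A c (\<lambda>x z. dlt A x (\<lambda>u v. h (u # v # z # cs))) = dlt A c (\<lambda>x y. dlt A y (\<lambda>u v. h (x # u # v # cs)))"
        using \<open>lmulti (ascale A) h\<close> by (intro dlt_coassoc lmulti_head lmulti_head[OF lmulti_Cons]
          lmulti_head[OF lmulti_Cons[OF lmulti_Cons]])
      then show ?thesis using Cons 0 by simp
    next
      case (Suc j')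
      then show ?thesis using Cons by (simp add: split_at_dlt)
    qed
  qed simp
next
  case (Suc i)
  then obtain j' where "j = Suc j'" by (cases j) auto
  then show ?case using Suc by (cases bs) (auto intro!: lmulti_Cons)
qed

end

text \<open>Both codiagonal actions on \<open>N \<otimes> A\<^sup>p\<close>: \<open>f u c\<close> and \<open>t u x\<close> are \<open>u c\<close> and \<open>u \<cdot> x\<close> for the
  left action, \<open>c u\<close> and \<open>x \<cdot> u\<close> for the right one.\<close>

locale hopf_action = hopf_bimodule A N
  for A :: "('k::field, 'a::ring_1) bialg" and N :: "('k, 'a, 'n::ab_group_add) hbim" +
  fixes f :: "'a \<Rightarrow> 'a \<Rightarrow> 'a" and t :: "'a \<Rightarrow> 'n \<Rightarrow> 'n"
  assumes linform_f1: "linform (ascale A) h \<Longrightarrow> linform (ascale A) (\<lambda>u. h (f u c))"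
    and linform_f2: "linform (ascale A) h \<Longrightarrow> linform (ascale A) (\<lambda>c. h (f u c))"
    and linform_t1: "linform (mscale N) h' \<Longrightarrow> linform (ascale A) (\<lambda>u. h' (t u x))"
    and linform_t2: "linform (mscale N) h' \<Longrightarrow> linform (mscale N) (\<lambda>x. h' (t u x))"
    and dlt_f: "(\<And>y. linform (ascale A) (\<lambda>x. g x y)) \<Longrightarrow> (\<And>x. linform (ascale A) (\<lambda>y. g x y)) \<Longrightarrow>
      dlt A (f u c) g = dlt A u (\<lambda>u1 u2. dlt A c (\<lambda>c1 c2. g (f u1 c1) (f u2 c2)))"
    and rho_t: "(\<And>m0. linform (ascale A) (\<lambda>d. g' m0 d)) \<Longrightarrow> (\<And>d. linform (mscale N) (\<lambda>m0. g' m0 d)) \<Longrightarrow>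
      rho N (t u x) g' = dlt A u (\<lambda>u1 u2. rho N x (\<lambda>x0 d. g' (t u1 x0) (f u2 d)))"
begin

lemma linform_diag_arg:
  assumes "lmulti (ascale A) h"
  shows "linform (ascale A) (\<lambda>b. diag A f b bs h)"
  using assms
proof (induction bs arbitrary: h)
  case Nil
  then show ?case using linform_times[OF linform_counit, of "h []"] by (simp add: mult.commute)
next
  case (Cons c bs)
  then show ?case
    by (auto intro!: linform_dlt_arg linform_diag linform_f1 lmulti_head lmulti_Cons)
qed

lemma lmulti_diag:
  assumes "lmulti (ascale A) h"
  shows "lmulti (ascale A) (\<lambda>bs. diag A f b bs h)"
  unfolding lmulti_def
proof (intro allI)
  fix as as'
  show "linform (ascale A) (\<lambda>a. diag A f b (as @ a # as') h)"
    using assms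
  proof (induction as arbitrary: b h)
    case Nil
    then show ?case by (auto intro!: linform_dlt linform_diag linform_f2 lmulti_head)
  next
    case (Cons c as)
    then show ?case by (auto intro!: linform_dlt Cons.IH lmulti_Cons)
  qed
qed

text \<open>The recursion spends the first leg of \<open>b\<close> on the head; coassociativity lets
  the last leg be spent on the last factor instead. For a single factor both sides are
  \<open>h [f b c]\<close>, by the right and the left counit law.\<close>

lemma diag_snoc:
  assumes "lmulti (ascale A) h"
  shows "diag A f b (bs @ [c]) h = dlt A b (\<lambda>u v. diag A f u bs (\<lambda>ds. h (ds @ [f v c])))"
  using assms
proof (induction bs arbitrary: b h)
  case Nil
  have "linform (ascale A) (\<lambda>x. h [f x c])"
    by (rule linform_f1[OF lmulti_head[OF Nil]])
  then show ?case by (simp add: dlt_counit_left dlt_counit_right)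
next
  case (Cons e bs)
  have "dlt A b (\<lambda>x z. dlt A x (\<lambda>u v. diag A f v bs (\<lambda>ds. h (f u e # ds @ [f z c])))) =
      dlt A b (\<lambda>x y. dlt A y (\<lambda>u v. diag A f u bs (\<lambda>ds. h (f x e # ds @ [f v c]))))"
    using Cons.prems
    by (intro dlt_coassoc[where g="\<lambda>x y z. diag A f y bs (\<lambda>ds. h (f x e # ds @ [f z c]))"]
        linform_diag linform_diag_arg lmulti_append lmulti_Cons linform_f1
        lmulti_head[of _ h] lmulti_last[OF lmulti_Cons])
  then show ?case by (simp add: Cons.IH[OF lmulti_Cons[OF Cons.prems]])
qed

text \<open>Inner faces c_i commute with the codiagonal action: the coproduct of
  \<open>f x c\<close> splits both factors (\<open>dlt_f\<close>), and coassociativity of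
  \<open>b\<close> then redistributes its legs.\<close>

lemma diag_split_at:
  assumes "lmulti (ascale A) h"
  shows "split_at A i bs (\<lambda>ds. diag A f b ds h) = diag A f b bs (\<lambda>ds. split_at A i ds h)"
  using assms
proof (induction i arbitrary: bs b h)
  case 0
  show ?case
  proof (cases bs)
    case (Cons c cs)
    have "diag A f b bs (\<lambda>ds. split_at A 0 ds h) =
        dlt A b (\<lambda>x y. diag A f y cs (\<lambda>ds. dlt A (f x c) (\<lambda>p q. h (p # q # ds))))"
      using Cons by simp
    also have "\<dots> = dlt A b (\<lambda>x z. dlt A x (\<lambda>u v. dlt A c (\<lambda>p q. diag A f z cs (\<lambda>ds. h (f u p # f v q # ds)))))"
      using 0 by (simp add: dlt_f lmulti_head lmulti_head[OF lmulti_Cons] diag_dlt)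
    also have "\<dots> = dlt A b (\<lambda>x y. dlt A y (\<lambda>u v. dlt A c (\<lambda>p q. diag A f v cs (\<lambda>ds. h (f x p # f u q # ds)))))"
      using 0
      by (intro dlt_coassoc[where g="\<lambda>x y z. dlt A c (\<lambda>p q. diag A f z cs (\<lambda>ds. h (f x p # f y q # ds)))"]
        linform_dlt linform_diag linform_diag_arg lmulti_Cons linform_f1
        lmulti_head[of _ h] lmulti_head[OF lmulti_Cons])
    also have "\<dots> = dlt A c (\<lambda>p q. dlt A b (\<lambda>x y. dlt A y (\<lambda>u v. diag A f v cs (\<lambda>ds. h (f x p # f u q # ds)))))"
      by (subst dlt_swap) (rule dlt_swap)
    finally show ?thesis using Cons by simp
  qed simp
next
  case (Suc i)
  show ?case
  proof (cases bs)
    case (Cons c cs)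
    then show ?thesis by (simp add: split_at_dlt Suc.IH lmulti_Cons[OF Suc.prems])
  qed simp
qed

lemma multi_diag_act:
  assumes "multi (ascale A) (mscale N) g"
  shows "multi (ascale A) (mscale N) (diag_act A f t b g)"
  unfolding diag_act_def[abs_def]
  by (intro multi_dlt multiI linform_diag linform_t2 multi_linform[OF assms] lmulti_diag multi_lmulti[OF assms])

lemma linform_diag_act_arg:
  assumes "multi (ascale A) (mscale N) g"
  shows "linform (ascale A) (\<lambda>b. diag_act A f t b g bs x)"
  unfolding diag_act_def
  by (intro linform_dlt_arg linform_diag linform_t1 multi_linform[OF assms] linform_diag_arg multi_lmulti[OF assms])

text \<open>For \<open>i = 0\<close> the compatibility \<open>rho_t\<close> of action and right
  coaction produces an extra leg of \<open>b\<close> for the new factor, and coassociativity puts it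
  in place; for the other indices see \<open>diag_split_at\<close>.\<close>

lemma expand_diag_act:
  assumes g: "multi (ascale A) (mscale N) g"
  shows "expand A N i (diag_act A f t b g) bs x = diag_act A f t b (expand A N i g) bs x"
proof (cases i)
  case 0
  have "diag_act A f t b (expand A N 0 g) bs x =
      dlt A b (\<lambda>u v. dlt A u (\<lambda>p q. rho N x (\<lambda>x0 d. diag A f v bs (\<lambda>ds. g (f q d # ds) (t p x0)))))"
    using g by (simp add: diag_act_def rho_t multi_head multi_linform diag_dlt diag_rho)
  also have "\<dots> = dlt A b (\<lambda>u v. dlt A v (\<lambda>p q. rho N x (\<lambda>x0 d. diag A f q bs (\<lambda>ds. g (f p d # ds) (t u x0)))))"
    by (intro dlt_coassoc[where g="\<lambda>p q v. rho N x (\<lambda>x0 d. diag A f v bs (\<lambda>ds. g (f q d # ds) (t p x0)))"]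
      linform_rho linform_diag linform_diag_arg linform_t1 multi_linform[OF g]
      lmulti_Cons[OF multi_lmulti[OF g]] linform_f1 multi_head[OF g])
  also have "\<dots> = expand A N 0 (diag_act A f t b g) bs x"
    by (simp add: diag_act_def dlt_rho)
  finally show ?thesis using 0 by simp
next
  case (Suc i')
  then show ?thesis
    by (simp add: diag_act_def split_at_dlt diag_split_at[OF multi_lmulti[OF g]])
qed

text \<open>Isolates the action on the last factor, which is the one appended by c_(p+1).\<close>

lemma diag_act_snoc:
  assumes g: "multi (ascale A) (mscale N) g"
  shows "diag_act A f t b g (bs @ [d]) x =
    dlt A b (\<lambda>u v. diag_act A f t u (\<lambda>ds. g (ds @ [f v d])) bs x)"
proof -
  have "dlt A b (\<lambda>u v. dlt A u (\<lambda>p q. diag A f q bs (\<lambda>ds. g (ds @ [f v d]) (t p x)))) =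
    dlt A b (\<lambda>u v. dlt A v (\<lambda>p q. diag A f p bs (\<lambda>ds. g (ds @ [f q d]) (t u x))))"
    by (intro dlt_coassoc[where g="\<lambda>p q v. diag A f q bs (\<lambda>ds. g (ds @ [f v d]) (t p x))"]
      linform_diag linform_diag_arg linform_t1 multi_linform[OF g]
      lmulti_append[OF multi_lmulti[OF g]] linform_f1 multi_last[OF g])
  then show ?thesis by (simp add: diag_act_def diag_snoc[OF multi_lmulti[OF g]])
qed

text \<open>\<open>comult_iter A p b\<close> has exactly one leg per factor, whereas
  \<open>diag\<close> splits once more and applies the counit to the rest; the counit law removes
  that leg.\<close>

lemma ev_comult_iter_diag:
  assumes "lmulti (ascale A) h" "length bs = Suc p"
  shows "ev (comult_iter A p b) (\<lambda>w. h (map2 f w bs)) = diag A f b bs h"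
  using assms
proof (induction p arbitrary: b bs h)
  case 0
  then obtain c where "bs = [c]" by (auto simp: length_Suc_conv)
  then show ?case using dlt_counit_right[OF linform_f1[OF lmulti_head[OF 0(1)]]] by simp
next
  case (Suc p)
  then obtain c cs where "bs = c # cs" "length cs = Suc p" by (auto simp: length_Suc_conv)
  then show ?case using Suc.IH[OF lmulti_Cons[OF Suc.prems(1)]] by (simp add: dlt_def)
qed

lemma ev_comult_iter_diag_act:
  assumes "multi (ascale A) (mscale N) g"
  shows "ev (comult_iter A (length bs) b) (\<lambda>w. g (map2 f (tl w) bs) (t (hd w) x)) = diag_act A f t b g bs x"
proof (cases bs)
  case Nil
  then show ?thesis
    using dlt_counit_right[OF linform_t1[OF multi_linform[OF assms]]] by (simp add: diag_act_def)
next
  case (Cons c cs)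
  then show ?thesis
    using ev_comult_iter_diag[OF multi_lmulti[OF assms], of bs "length cs"]
    by (simp add: diag_act_def dlt_def)
qed

end

section \<open>The left and right codiagonal actions\<close>

context hopf_bimodule
begin

sublocale left: hopf_action A M "(*)" "lact M"
  by unfold_locales
    (auto intro: linform_mult1 linform_mult2 linform_lact linform_lact' dlt_mult rho_lact)

sublocale right: hopf_action A M "\<lambda>u c. c * u" "\<lambda>u m. ract M m u"
proof (unfold_locales, goal_cases)
  \<comment> \<open>For the right action the product is \<open>c * u\<close>, so multiplicativity of
    the coproduct puts the sum over \<open>c\<close> outside; the two sums are exchanged.\<close>
  case (5 g u c)
  then show ?case using dlt_mult[of g c u] by (subst dlt_swap) auto
qed (auto intro: linform_mult1 linform_mult2 linform_ract linform_ract' rho_ract)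

lemma diag_mult:
  assumes "lmulti (ascale A) h"
  shows "diag A (*) (a * b) bs h = diag A (*) b bs (\<lambda>ds. diag A (*) a ds h)"
  using assms
proof (induction bs arbitrary: a b h)
  case (Cons c bs)
  have "diag A (*) (a * b) (c # bs) h =
      dlt A a (\<lambda>x y. dlt A b (\<lambda>u v. diag A (*) (y * v) bs (\<lambda>ds. h (x * u * c # ds))))"
    unfolding diag.simps
    by (intro dlt_mult linform_diag left.linform_diag_arg linform_mult1 lmulti_head[OF Cons.prems]
        lmulti_Cons[OF Cons.prems])
  also have "\<dots> = dlt A b (\<lambda>u v. dlt A a (\<lambda>x y. diag A (*) (y * v) bs (\<lambda>ds. h (x * u * c # ds))))"
    by (rule dlt_swap)
  finally show ?case
    by (simp add: Cons.IH[OF lmulti_Cons[OF Cons.prems]] diag_dlt mult.assoc)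
qed (simp add: counit_mult)

lemma diag_commute:
  "diag A (*) a bs (\<lambda>ds. diag A (\<lambda>u c. c * u) b ds h) = diag A (\<lambda>u c. c * u) b bs (\<lambda>ds. diag A (*) a ds h)"
proof (induction bs arbitrary: a b h)
  case (Cons c bs)
  then show ?case by (simp add: diag_dlt mult.assoc) (rule dlt_swap)
qed simp

definition left_act where "left_act = diag_act A (*) (lact M)"

definition right_act where "right_act = diag_act A (\<lambda>u c. c * u) (\<lambda>u m. ract M m u)"

text \<open>Transposing reverses the order: g(a.(b.y)) is the form \<open>left_act a g\<close>
  evaluated at b.y.\<close>

lemma left_act_mult:
  assumes g: "multi (ascale A) (mscale M) g"
  shows "left_act (a * b) g bs x = left_act b (left_act a g) bs x"
proof -
  have "left_act (a * b) g bs x =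
     dlt A a (\<lambda>p q. dlt A b (\<lambda>u v. diag A (*) (q * v) bs (\<lambda>ds. g ds (lact M (p * u) x))))"
    unfolding left_act_def diag_act_def
    by (intro dlt_mult linform_diag left.linform_diag_arg left.linform_t1 multi_linform[OF g] multi_lmulti[OF g])
  also have "\<dots> = dlt A b (\<lambda>u v. dlt A a (\<lambda>p q. diag A (*) (q * v) bs (\<lambda>ds. g ds (lact M (p * u) x))))"
    by (rule dlt_swap)
  finally show ?thesis
    by (simp add: left_act_def diag_act_def diag_mult[OF multi_lmulti[OF g]] lact_mult diag_dlt)
qed

lemma left_act_right_act: "left_act a (right_act b g) bs x = right_act b (left_act a g) bs x"
  unfolding left_act_def right_act_def diag_act_def
  by (simp add: diag_dlt diag_commute lact_ract) (rule dlt_swap)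

lemma multi_expand:
  assumes g: "multi (ascale A) (mscale M) g"
  shows "multi (ascale A) (mscale M) (expand A M i g)"
proof (cases i)
  case 0
  show ?thesis unfolding 0 expand.simps[abs_def]
    by (intro multiI linform_rho_arg lmulti_rho multi_head[OF g] multi_linform[OF g] lmulti_Cons multi_lmulti[OF g])
next
  case (Suc i')
  show ?thesis unfolding Suc expand.simps[abs_def]
    by (intro multiI linform_split_at lmulti_split_at multi_linform[OF g] multi_lmulti[OF g])
qed

text \<open>Coassociativity of the right coaction if \<open>i = j = 0\<close>, of A if
  \<open>i = j > 0\<close>; otherwise different factors are concerned.\<close>

lemma expand_expand:
  assumes g: "multi (ascale A) (mscale M) g" and "i \<le> j"
  shows "expand A M i (expand A M (Suc j) g) bs x = expand A M j (expand A M i g) bs x"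
proof (cases i)
  case i: 0
  show ?thesis
  proof (cases j)
    case 0
    have "rho M x (\<lambda>m0 d. rho M m0 (\<lambda>m0' d'. g (d' # d # bs) m0')) = rho M x (\<lambda>m0 d. dlt A d (\<lambda>x y. g (x # y # bs) m0))"
      by (rule rho_coassoc[where g="\<lambda>m0 x y. g (x # y # bs) m0"])
        (intro multi_linform[OF g] multi_head[OF g] multi_head[OF multi_Cons[OF g]])+
    then show ?thesis using i 0 by simp
  next
    case (Suc j')
    then show ?thesis using i by (simp add: split_at_rho)
  qed
next
  case (Suc i')
  then obtain j' where "j = Suc j'" "i' \<le> j'" using assms(2) by (cases j) auto
  then show ?thesis using Suc split_at_split_at[OF multi_lmulti[OF g]] by simp
qed

text \<open>Only c_0 meets the module factor, and there the claim is the bicomodule axiom.\<close>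

lemma expand_lam:
  assumes "\<And>c. multi (ascale A) (mscale M) (g c)" "\<And>bs x. linform (ascale A) (\<lambda>c. g c bs x)"
  shows "expand A M i (\<lambda>bs x. lam M x (\<lambda>c x0. g c bs x0)) bs x = lam M x (\<lambda>c x0. expand A M i (g c) bs x0)"
proof (cases i)
  case 0
  have "rho M x (\<lambda>m0 d. lam M m0 (\<lambda>c m0'. g c (d # bs) m0')) = lam M x (\<lambda>c m0. rho M m0 (\<lambda>m0' d. g c (d # bs) m0'))"
    by (rule lam_rho[where g="\<lambda>c m0 d. g c (d # bs) m0"])
      (intro assms multi_linform[OF assms(1)] multi_head[OF assms(1)])+
  then show ?thesis using 0 by simp
qed (simp add: split_at_lam)

lemma multi_lam:
  assumes "\<And>c. multi (ascale A) (mscale M) (g c)" "\<And>bs x. linform (ascale A) (\<lambda>c. g c bs x)"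
  shows "multi (ascale A) (mscale M) (\<lambda>bs x. lam M x (\<lambda>c x0. g c bs x0))"
  by (intro multiI linform_lam_arg lmulti_lam assms multi_linform[OF assms(1)] multi_lmulti[OF assms(1)])

text \<open>The Hopf compatibility of left action and left coaction, extended from the module to its
  tensor product with A^p: the left coaction involves only the module factor, so
  \<open>lam_lact\<close> and a regrouping of the legs of \<open>a\<close> suffice.\<close>

lemma left_act_lam:
  assumes "\<And>c. multi (ascale A) (mscale M) (g c)" "\<And>bs x. linform (ascale A) (\<lambda>c. g c bs x)"
  shows "left_act a (\<lambda>bs x. lam M x (\<lambda>c x0. g c bs x0)) bs x =
    dlt A a (\<lambda>u v. lam M x (\<lambda>c x0. left_act v (g (u * c)) bs x0))"
proof -
  have "left_act a (\<lambda>bs x. lam M x (\<lambda>c x0. g c bs x0)) bs x =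
      dlt A a (\<lambda>u v. dlt A u (\<lambda>p q. lam M x (\<lambda>c x0. diag A (*) v bs (\<lambda>ds. g (p * c) ds (lact M q x0)))))"
    unfolding left_act_def diag_act_def
    by (simp add: lam_lact assms multi_linform[OF assms(1)] diag_dlt diag_lam)
  also have "\<dots> = dlt A a (\<lambda>u v. dlt A v (\<lambda>p q. lam M x (\<lambda>c x0. diag A (*) q bs (\<lambda>ds. g (u * c) ds (lact M p x0)))))"
    by (intro dlt_coassoc[where g="\<lambda>p q v. lam M x (\<lambda>c x0. diag A (*) v bs (\<lambda>ds. g (p * c) ds (lact M q x0)))"]
      linform_lam linform_diag left.linform_diag_arg linform_mult1 assms multi_lmulti[OF assms(1)]
      left.linform_t1 multi_linform[OF assms(1)])
  finally show ?thesis
    unfolding left_act_def diag_act_def by (simp add: dlt_lam)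
qed

section \<open>Merging neighbouring factors of A^n \<otimes> M\<close>

lemma multi_merge:
  assumes "multi (ascale A) (mscale M) g"
  shows "multi (ascale A) (mscale M) (merge M i g)"
  using assms
proof (induction i arbitrary: g)
  case 0
  have lin: "linform (ascale A) (\<lambda>a. merge M 0 g (a # as) m)" for as m
    by (cases as) (simp_all add: linform_lact'[OF multi_linform[OF 0]] linform_mult1[OF multi_head[OF 0]])
  have tail: "multi (ascale A) (mscale M) (\<lambda>as. merge M 0 g (a # as))" for a
  proof (rule multi_split)
    show "linform (mscale M) (merge M 0 g [a])"
      unfolding merge.simps[abs_def] by (rule linform_lact[OF multi_linform[OF 0]])
    show "linform (ascale A) (\<lambda>b. merge M 0 g (a # b # as) m)" for as m
      using 0 by (auto intro!: linform_mult2 multi_head)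
    show "multi (ascale A) (mscale M) (\<lambda>as. merge M 0 g (a # b # as))" for b
      unfolding merge.simps[abs_def] by (rule multi_Cons[OF 0])
  qed
  show ?case
    by (rule multi_split[OF _ lin tail]) (simp add: merge.simps[abs_def])
next
  case (Suc i)
  show ?case
  proof (rule multi_split)
    show "linform (mscale M) (merge M (Suc i) g [])" by (simp add: merge.simps[abs_def])
    show "linform (ascale A) (\<lambda>a. merge M (Suc i) g (a # as) m)" for as m
      using Suc.prems by (auto intro!: linform_merge multi_head)
    show "multi (ascale A) (mscale M) (\<lambda>as. merge M (Suc i) g (a # as))" for a
      unfolding merge.simps[abs_def] by (rule Suc.IH[OF multi_Cons[OF Suc.prems]])
  qed
qed

text \<open>If \<open>i = j\<close>, this is associativity in A, or the module law when the last two
  factors of A act on the module element; otherwise the merges do not interfere.\<close>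

lemma merge_merge:
  "i \<le> j \<Longrightarrow> merge M (Suc j) (merge M i g) as m = merge M i (merge M j g) as m"
proof (induction i arbitrary: j as m g)
  case 0
  show ?case
  proof (cases as rule: remdups_adj.cases)
    case (3 a b cs)
    then show ?thesis by (cases j; cases cs) (simp_all add: merge.simps(3)[abs_def] lact_mult mult.assoc)
  qed simp_all
next
  case (Suc i)
  then obtain j' where "j = Suc j'" by (cases j) auto
  then show ?case using Suc by (cases as) (simp_all add: merge.simps(4)[abs_def])
qed

lemma merge_ract:
  "merge M i g as (ract M m b) = merge M i (\<lambda>as m. g as (ract M m b)) as m"
proof (induction i arbitrary: g as)
  case 0
  show ?case by (cases as rule: remdups_adj.cases) (simp_all add: lact_ract)
next
  case (Suc i)
  then show ?case by (cases as) simp_all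
qed

text \<open>Merging is colinear: for two factors of A because the coproduct is multiplicative, for
  the last factor and the module element by \<open>lam_lact\<close>. \<open>merge_rco\<close> is the
  same argument with \<open>rho_lact\<close>.\<close>

lemma merge_lco:
  assumes "\<And>c. multi (ascale A) (mscale M) (g c)" "\<And>vs m. linform (ascale A) (\<lambda>c. g c vs m)"
  shows "merge M i (\<lambda>as m. lco A M as m g) as m = lco A M as m (\<lambda>c. merge M i (g c))"
  using assms
proof (induction i arbitrary: g as)
  case (0 g)
  show ?case
  proof (cases as rule: remdups_adj.cases)
    case (2 a)
    then show ?thesis by (simp add: lam_lact 0 multi_linform[OF 0(1)] merge.simps(2)[abs_def])
  next
    case (3 a b cs)
    have "dlt A (a * b) (\<lambda>u v. lco A M cs m (\<lambda>c vs m0. g (u * c) (v # vs) m0)) =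
      dlt A a (\<lambda>x y. dlt A b (\<lambda>u v. lco A M cs m (\<lambda>c vs m0. g (x * u * c) (y * v # vs) m0)))"
      by (rule dlt_mult) (intro linform_lco linform_mult1 0 multi_head[OF 0(1)])+
    then show ?thesis using 3 by (simp add: merge.simps(3)[abs_def] mult.assoc)
  qed (simp add: merge.simps(1)[abs_def])
next
  case (Suc i)
  show ?case
  proof (cases as)
    case (Cons a cs)
    have "merge M i (\<lambda>as m. lco A M as m (\<lambda>c vs m0. g (u * c) (v # vs) m0)) cs m =
        lco A M cs m (\<lambda>c. merge M i (\<lambda>vs m0. g (u * c) (v # vs) m0))" for u v
      by (rule Suc.IH) (intro multi_Cons Suc.prems linform_mult2)+
    then show ?thesis using Cons by (simp add: merge_dlt merge.simps(4)[abs_def])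
  qed (simp add: merge.simps(1)[abs_def])
qed

lemma merge_rco:
  assumes "\<And>d. multi (ascale A) (mscale M) (\<lambda>us m. g us m d)" "\<And>us m. linform (ascale A) (g us m)"
  shows "merge M i (\<lambda>as m. rco A M as m g) as m = rco A M as m (\<lambda>us m0 d. merge M i (\<lambda>us m0. g us m0 d) us m0)"
  using assms
proof (induction i arbitrary: g as)
  case (0 g)
  show ?case
  proof (cases as rule: remdups_adj.cases)
    case (2 a)
    then show ?thesis by (simp add: rho_lact 0 multi_linform[OF 0(1)])
  next
    case (3 a b cs)
    have "dlt A (a * b) (\<lambda>u v. rco A M cs m (\<lambda>us m0 d. g (u # us) m0 (v * d))) =
      dlt A a (\<lambda>x y. dlt A b (\<lambda>u v. rco A M cs m (\<lambda>us m0 d. g (x * u # us) m0 (y * v * d))))"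
      by (rule dlt_mult) (intro linform_rco linform_mult1 0 multi_head[OF 0(1)])+
    then show ?thesis using 3 by (simp add: mult.assoc)
  qed simp
next
  case (Suc i)
  show ?case
  proof (cases as)
    case (Cons a cs)
    have "merge M i (\<lambda>as m. rco A M as m (\<lambda>us m0 d. g (u # us) m0 (v * d))) cs m =
        rco A M cs m (\<lambda>us m0 d. merge M i (\<lambda>us m0. g (u # us) m0 (v * d)) us m0)" for u v
      by (rule Suc.IH) (intro multi_Cons[of _ _ "\<lambda>us m. g us m _"] Suc.prems linform_mult2)+
    then show ?thesis using Cons by (simp add: merge_dlt)
  qed simp
qed

section \<open>The codiagonal coactions on A^n \<otimes> M\<close>

lemma multi_lco:
  assumes "\<And>c. multi (ascale A) (mscale M) (g c)" "\<And>vs m. linform (ascale A) (\<lambda>c. g c vs m)"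
  shows "multi (ascale A) (mscale M) (\<lambda>as m. lco A M as m g)"
  unfolding multi_def lmulti_def
proof (intro conjI allI)
  show "linform (mscale M) (\<lambda>m. lco A M as m g)" for as
    using assms
  proof (induction as arbitrary: g)
    case Nil
    then show ?case by (simp add: linform_lam_arg multi_linform[OF Nil(1)])
  next
    case (Cons a as)
    then show ?case by (auto intro!: linform_dlt Cons.IH multi_Cons linform_mult2)
  qed
  show "linform (ascale A) (\<lambda>a. lco A M (as @ a # as') m g)" for as as' m
    using assms
  proof (induction as arbitrary: g)
    case Nil
    then show ?case by (auto intro!: linform_dlt_arg linform_lco linform_mult1 multi_head)
  next
    case (Cons a as)
    then show ?case by (auto intro!: linform_dlt Cons.IH multi_Cons linform_mult2)
  qed
qed

lemma multi_rco:
  assumes "\<And>d. multi (ascale A) (mscale M) (\<lambda>us m. g us m d)" "\<And>us m. linform (ascale A) (g us m)"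
  shows "multi (ascale A) (mscale M) (\<lambda>as m. rco A M as m g)"
  unfolding multi_def lmulti_def
proof (intro conjI allI)
  show "linform (mscale M) (\<lambda>m. rco A M as m g)" for as
    using assms
  proof (induction as arbitrary: g)
    case Nil
    then show ?case by (auto intro!: linform_rho_arg multi_linform[of _ _ "\<lambda>us m. g us m _"])
  next
    case (Cons a as)
    then show ?case
      by (auto intro!: linform_dlt Cons.IH multi_Cons[of _ _ "\<lambda>us m. g us m _"] linform_mult2)
  qed
  show "linform (ascale A) (\<lambda>a. rco A M (as @ a # as') m g)" for as as' m
    using assms
  proof (induction as arbitrary: g)
    case Nil
    then show ?case
      by (auto intro!: linform_dlt_arg linform_rco linform_mult1 multi_head[of _ _ "\<lambda>us m. g us m _"])
  next
    case (Cons a as)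
    then show ?case
      by (auto intro!: linform_dlt Cons.IH multi_Cons[of _ _ "\<lambda>us m. g us m _"] linform_mult2)
  qed
qed

lemma rco_ract:
  assumes "\<And>d. multi (ascale A) (mscale M) (\<lambda>us m. g us m d)" "\<And>us m. linform (ascale A) (g us m)"
  shows "rco A M as (ract M m b) g = rco A M as m (\<lambda>us m0 d. dlt A b (\<lambda>p q. g us (ract M m0 p) (d * q)))"
  using assms
proof (induction as arbitrary: g)
  case Nil
  then show ?case by (simp add: rho_ract[where g="g []", OF Nil(2) multi_linform[OF Nil(1)]] dlt_rho)
next
  case (Cons a as)
  have "rco A M as (ract M m b) (\<lambda>us m0 d. g (u # us) m0 (v * d)) =
      rco A M as m (\<lambda>us m0 d. dlt A b (\<lambda>p q. g (u # us) (ract M m0 p) (v * (d * q))))" for u v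
    by (rule Cons.IH) (intro multi_Cons[of _ _ "\<lambda>us m. g us m _"] Cons.prems linform_mult2)+
  then show ?case by (simp add: mult.assoc)
qed

text \<open>Each further factor contributes its own coassociativity; the product
  \<open>v * d\<close> of coefficients is then split by multiplicativity of the coproduct.\<close>

lemma rco_coassoc:
  assumes "\<And>d e. multi (ascale A) (mscale M) (\<lambda>us m. g us m d e)"
    "\<And>us m e. linform (ascale A) (\<lambda>d. g us m d e)" "\<And>us m d. linform (ascale A) (\<lambda>e. g us m d e)"
  shows "rco A M as m (\<lambda>us m0 d. rco A M us m0 (\<lambda>us' m0' d'. g us' m0' d' d)) =
    rco A M as m (\<lambda>us m0 d. dlt A d (\<lambda>p q. g us m0 p q))"
  using assms
proof (induction as arbitrary: g)
  case Nil
  then show ?case by (simp add: rho_coassoc[where g="g []", OF multi_linform[OF Nil(1)] Nil(2,3)])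
next
  case (Cons a as)
  have IH: "rco A M as m (\<lambda>us m0 d. rco A M us m0 (\<lambda>us' m0' d'. g (p # us') m0' (q * d') (v * d))) =
      rco A M as m (\<lambda>us m0 d. dlt A d (\<lambda>d1 d2. g (p # us) m0 (q * d1) (v * d2)))" for p q v
    by (rule Cons.IH[of "\<lambda>us m0 d1 d2. g (p # us) m0 (q * d1) (v * d2)"])
      (intro multi_Cons[of _ _ "\<lambda>us m. g us m _ _"] Cons.prems linform_mult2)+
  have "rco A M (a # as) m (\<lambda>us m0 d. rco A M us m0 (\<lambda>us' m0' d'. g us' m0' d' d)) =
      dlt A a (\<lambda>u v. dlt A u (\<lambda>p q. rco A M as m (\<lambda>us m0 d. dlt A d (\<lambda>d1 d2. g (p # us) m0 (q * d1) (v * d2)))))"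
    by (simp add: rco_dlt IH)
  also have "\<dots> = dlt A a (\<lambda>u v. dlt A v (\<lambda>p q. rco A M as m (\<lambda>us m0 d. dlt A d (\<lambda>d1 d2. g (u # us) m0 (p * d1) (q * d2)))))"
    by (intro dlt_coassoc[where g="\<lambda>p q v. rco A M as m (\<lambda>us m0 d. dlt A d (\<lambda>d1 d2. g (p # us) m0 (q * d1) (v * d2)))"]
      linform_rco linform_dlt linform_mult1 Cons.prems multi_head[OF Cons.prems(1)])
  also have "\<dots> = dlt A a (\<lambda>u v. rco A M as m (\<lambda>us m0 d. dlt A (v * d) (\<lambda>p q. g (u # us) m0 p q)))"
    by (simp add: dlt_mult Cons.prems rco_dlt)
  finally show ?case by simp
qed

text \<open>A^n \<otimes> M is again a bicomodule: the module supplies the base case, and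
  coassociativity of A handles each further factor.\<close>

lemma lco_rco:
  assumes "\<And>c d. multi (ascale A) (mscale M) (\<lambda>us m. g c us m d)"
    "\<And>us m d. linform (ascale A) (\<lambda>c. g c us m d)" "\<And>c us m. linform (ascale A) (\<lambda>d. g c us m d)"
  shows "lco A M as m (\<lambda>c vs m0. rco A M vs m0 (\<lambda>us m0' d. g c us m0' d)) =
    rco A M as m (\<lambda>us m0 d. lco A M us m0 (\<lambda>c vs m0'. g c vs m0' d))"
  using assms
proof (induction as arbitrary: g)
  case Nil
  then show ?case by (simp add: lam_rho[where g="\<lambda>c. g c []", OF Nil(2,3) multi_linform[OF Nil(1)]])
next
  case (Cons a as)
  have IH: "lco A M as m (\<lambda>c vs m0. rco A M vs m0 (\<lambda>us m0' d. g (u * c) (p # us) m0' (q * d))) =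
      rco A M as m (\<lambda>us m0 d. lco A M us m0 (\<lambda>c vs m0'. g (u * c) (p # vs) m0' (q * d)))" for u p q
    by (rule Cons.IH[of "\<lambda>c us m0' d. g (u * c) (p # us) m0' (q * d)"])
      (intro multi_Cons[of _ _ "\<lambda>us m. g _ us m _"] Cons.prems linform_mult2 linform_mult1)+
  have "lco A M (a # as) m (\<lambda>c vs m0. rco A M vs m0 (\<lambda>us m0' d. g c us m0' d)) =
      dlt A a (\<lambda>u v. dlt A v (\<lambda>p q. rco A M as m (\<lambda>us m0 d. lco A M us m0 (\<lambda>c vs m0'. g (u * c) (p # vs) m0' (q * d)))))"
    by (simp add: lco_dlt IH)
  also have "\<dots> = dlt A a (\<lambda>u v. dlt A u (\<lambda>p q. rco A M as m (\<lambda>us m0 d. lco A M us m0 (\<lambda>c vs m0'. g (p * c) (q # vs) m0' (v * d)))))"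
    by (intro dlt_coassoc[where g="\<lambda>u p q. rco A M as m (\<lambda>us m0 d. lco A M us m0 (\<lambda>c vs m0'. g (u * c) (p # vs) m0' (q * d)))", symmetric]
      linform_rco linform_lco linform_mult1 Cons.prems multi_head[OF Cons.prems(1)])
  finally show ?case by (simp add: rco_dlt)
qed

end


section \<open>Alternating sums\<close>

text \<open>The signs are stored as a formal sum over indices, so that \<open>ev_swap\<close> and
  the lemmas pulling \<open>ev\<close> out of operators apply to differentials as they do to
  Sweedler sums.\<close>

definition altsum :: "nat \<Rightarrow> (nat \<Rightarrow>\<^sub>0 'k::field)"
  where "altsum r = (\<Sum>i\<le>r. fscale ((- 1) ^ i) (bas i))"

lemma ev_altsum: "ev (altsum r) h = (\<Sum>i\<le>r. (- 1) ^ i * h i)"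
  by (simp add: altsum_def)

lemma keys_altsum: "i \<in> Poly_Mapping.keys (altsum r :: nat \<Rightarrow>\<^sub>0 'k::field) \<Longrightarrow> i \<le> r"
proof -
  have "Poly_Mapping.keys (altsum r :: nat \<Rightarrow>\<^sub>0 'k) \<subseteq> {..r}"
    unfolding altsum_def by (intro keys_sum_subset order.trans[OF keys_fscale]) simp
  then show "i \<in> Poly_Mapping.keys (altsum r :: nat \<Rightarrow>\<^sub>0 'k) \<Longrightarrow> i \<le> r" by auto
qed

text \<open>Index pairs (outer, inner) split into those with inner below outer and the rest. The map
  (i, j) to (j+1, i) is a bijection from the rest onto the former; it preserves \<open>D\<close> and
  changes the sign.\<close>

lemma altsum_cosimplicial:
  fixes D :: "nat \<Rightarrow> nat \<Rightarrow> 'k::field"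
  assumes "\<And>i j. i \<le> j \<Longrightarrow> j \<le> r \<Longrightarrow> D (Suc j) i = D i j"
  shows "ev (altsum (Suc r)) (\<lambda>j. ev (altsum r) (D j)) = 0"
proof -
  define h where "h = (\<lambda>(j, i). (- 1) ^ j * ((- 1) ^ i * D j i))"
  let ?L = "{(j, i). j \<le> Suc r \<and> i < j}" and ?U = "{(i, j). i \<le> j \<and> j \<le> r}"
  have fin: "finite ?L" "finite ?U"
    by (rule finite_subset[of _ "{..Suc r} \<times> {..Suc r}"]; auto)+
  have "ev (altsum (Suc r)) (\<lambda>j. ev (altsum r) (D j)) = (\<Sum>x\<in>{..Suc r} \<times> {..r}. h x)"
    by (simp only: ev_altsum sum_distrib_left sum.cartesian_product h_def)
  also have "{..Suc r} \<times> {..r} = ?L \<union> ?U" by auto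
  also have "sum h (?L \<union> ?U) = sum h ?L + sum h ?U"
    by (intro sum.union_disjoint fin) auto
  also have "?L = (\<lambda>(i, j). (Suc j, i)) ` ?U"
  proof (intro subset_antisym subsetI)
    fix x assume "x \<in> ?L"
    then obtain j i where "x = (Suc j, i)" "i \<le> j" "j \<le> r"
      by (cases "fst x") auto
    then show "x \<in> (\<lambda>(i, j). (Suc j, i)) ` ?U" by auto
  qed auto
  also have "sum h \<dots> = (\<Sum>(i, j)\<in>?U. h (Suc j, i))"
    by (subst sum.reindex) (auto simp: inj_on_def case_prod_unfold)
  also have "\<dots> = (\<Sum>x\<in>?U. - h x)"
    using assms by (intro sum.cong) (auto simp: h_def algebra_simps)
  finally show ?thesis by (simp add: sum_negf)
qed


section \<open>Faces on the level of forms\<close>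

text \<open>\<open>bface i\<close> and \<open>cface p i\<close> are the transposes of \<open>b\<^sub>i\<close> and \<open>c\<^sub>i\<close>.\<close>

locale hopf_pair = HM: hopf_bimodule A M + HN: hopf_bimodule A N
  for A :: "('k::field, 'a::ring_1) bialg"
    and M :: "('k, 'a, 'm::ab_group_add) hbim" and N :: "('k, 'a, 'n::ab_group_add) hbim"
begin

abbreviation "multiM \<equiv> multi (ascale A) (mscale M)"
abbreviation "multiN \<equiv> multi (ascale A) (mscale N)"

fun bface :: "nat \<Rightarrow> (('a list \<Rightarrow> 'n \<Rightarrow> 'k) \<Rightarrow> 'a list \<Rightarrow> 'm \<Rightarrow> 'k)
    \<Rightarrow> ('a list \<Rightarrow> 'n \<Rightarrow> 'k) \<Rightarrow> 'a list \<Rightarrow> 'm \<Rightarrow> 'k" where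
  "bface 0 F g [] m = 0"
| "bface 0 F g (a # as) m = F (HN.left_act a g) as m"
| "bface (Suc i) F g as m = merge M i (F g) as m"

lemma bface_fun:
  "bface 0 F g [] = (\<lambda>m. 0)"
  "bface 0 F g (a # as) = F (HN.left_act a g) as"
  "bface (Suc i) F g = merge M i (F g)"
  by (intro ext; simp)+

definition cface :: "nat \<Rightarrow> nat \<Rightarrow> (('a list \<Rightarrow> 'n \<Rightarrow> 'k) \<Rightarrow> 'a list \<Rightarrow> 'm \<Rightarrow> 'k)
    \<Rightarrow> ('a list \<Rightarrow> 'n \<Rightarrow> 'k) \<Rightarrow> 'a list \<Rightarrow> 'm \<Rightarrow> 'k"
  where "cface p i F g as m =
    (if i \<le> p then F (expand A N i g) as m
     else rco A M as m (\<lambda>us m0 d. F (\<lambda>bs. g (bs @ [d])) us m0))"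

definition right_lin :: "(('a list \<Rightarrow> 'n \<Rightarrow> 'k) \<Rightarrow> 'a list \<Rightarrow> 'm \<Rightarrow> 'k) \<Rightarrow> bool"
  where "right_lin F \<longleftrightarrow> (\<forall>g as m b. multiN g \<longrightarrow> F (HN.right_act b g) as m = F g as (ract M m b))"

text \<open>A family \<open>g c\<close> linear in \<open>c\<close> is a form on A \<otimes> N
  \<otimes> A^p; the equation compares coacting before and after the cochain.\<close>

definition left_colin :: "(('a list \<Rightarrow> 'n \<Rightarrow> 'k) \<Rightarrow> 'a list \<Rightarrow> 'm \<Rightarrow> 'k) \<Rightarrow> bool"
  where "left_colin F \<longleftrightarrow> (\<forall>g. (\<forall>c. multiN (g c)) \<longrightarrow> (\<forall>bs x. linform (ascale A) (\<lambda>c. g c bs x)) \<longrightarrow>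
    (\<forall>as m. lco A M as m (\<lambda>c. F (g c)) = F (\<lambda>bs x. lam N x (\<lambda>c x0. g c bs x0)) as m))"

lemma bface_ev:
  "bface i (\<lambda>g as m. ev q (\<lambda>z. H z g as m)) g as m = ev q (\<lambda>z. bface i (H z) g as m)"
  by (cases i; cases as) (simp_all add: merge_ev[of M _ q "\<lambda>z. H z _"])

lemma cface_ev:
  "cface p i (\<lambda>g as m. ev q (\<lambda>z. H z g as m)) g as m = ev q (\<lambda>z. cface p i (H z) g as m)"
  by (simp add: cface_def rco_ev)

lemma multi_left_act: "multiN g \<Longrightarrow> multiN (HN.left_act a g)"
  unfolding HN.left_act_def by (rule HN.left.multi_diag_act)

lemma multi_right_act: "multiN g \<Longrightarrow> multiN (HN.right_act a g)"
  unfolding HN.right_act_def by (rule HN.right.multi_diag_act)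

text \<open>Transposes of differentials are known only on multilinear forms
  (\<open>dual_d_m\<close>, \<open>dual_d_c\<close>); replacing \<open>F\<close> is still legitimate
  since a face passes only such forms to it.\<close>

lemma bface_cong:
  assumes "\<And>g. multiN g \<Longrightarrow> F g = F' g" "multiN g"
  shows "bface i F g = bface i F' g"
proof (intro ext)
  show "bface i F g as m = bface i F' g as m" for as m
    using assms by (cases i; cases as) (simp_all add: multi_left_act)
qed

lemma cface_cong:
  assumes "\<And>g. multiN g \<Longrightarrow> F g = F' g" "multiN g"
  shows "cface p i F g = cface p i F' g"
  using assms by (intro ext) (simp add: cface_def HN.multi_expand multi_append)

end

text \<open>\<open>W as m\<close> represents the value of a cochain at \<open>as \<otimes> m\<close>, and \<open>F\<close> is the transposed map on
  forms.\<close>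

locale cochain = hopf_pair A M N
  for A :: "('k::field, 'a::ring_1) bialg"
    and M :: "('k, 'a, 'm::ab_group_add) hbim" and N :: "('k, 'a, 'n::ab_group_add) hbim" +
  fixes W :: "'a list \<Rightarrow> 'm \<Rightarrow> ('a list \<times> 'n \<times> 'a list \<Rightarrow>\<^sub>0 'k)"
    and F :: "('a list \<Rightarrow> 'n \<Rightarrow> 'k) \<Rightarrow> 'a list \<Rightarrow> 'm \<Rightarrow> 'k"
    and n p :: nat
  assumes F_ev: "F g as m = ev (W as m) (\<lambda>(_, x, bs). g bs x)"
    and keys_W: "(cs, x, bs) \<in> Poly_Mapping.keys (W as m) \<Longrightarrow> length bs = p"
    and support_W: "length as \<noteq> n \<Longrightarrow> W as m = 0"
    and multi_F: "multiN g \<Longrightarrow> multiM (F g)"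
begin

text \<open>Forms matter to \<open>F\<close> only on lists of length \<open>p\<close>. This supplies
  the lengths that \<open>expand_snoc\<close> and \<open>split_at_last\<close> need.\<close>

lemma F_cong:
  assumes "\<And>bs x. length bs = p \<Longrightarrow> g bs x = g' bs x"
  shows "F g as m = F g' as m"
  unfolding F_ev by (intro ev_cong) (auto dest!: keys_W intro: assms)

lemma F_support: "length as \<noteq> n \<Longrightarrow> F g as m = 0"
  by (simp add: F_ev support_W)

lemma F_dlt: "F (\<lambda>bs x. dlt A a (\<lambda>u v. h u v bs x)) as m = dlt A a (\<lambda>u v. F (h u v) as m)"
  unfolding F_ev case_prod_unfold by (rule ev_dlt)

lemma linform_F:
  "(\<And>bs x. linform s (\<lambda>a. h a bs x)) \<Longrightarrow> linform s (\<lambda>a. F (h a) as m)"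
  unfolding F_ev case_prod_unfold by (rule linform_ev)

lemma bface_support: "length as \<noteq> Suc n \<Longrightarrow> bface i F g as m = 0"
  by (cases i; cases as) (simp_all add: F_support merge_support[of n])

lemma cface_support: "length as \<noteq> n \<Longrightarrow> cface p i F g as m = 0"
proof -
  assume "length as \<noteq> n"
  moreover from this have "rco A M as m (\<lambda>us m0 d. F (\<lambda>bs. g (bs @ [d])) us m0) = rco A M as m (\<lambda>_ _ _. 0)"
    by (intro rco_cong) (simp add: F_support)
  ultimately show ?thesis by (simp add: cface_def F_support)
qed

lemma multi_bface:
  assumes "multiN g"
  shows "multiM (bface i F g)"
proof (cases i)
  case 0
  have "linform (ascale A) (\<lambda>a. F (HN.left_act a g) as m)" for as m
    unfolding HN.left_act_def by (intro linform_F HN.left.linform_diag_act_arg assms)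
  moreover have "multiM (\<lambda>as. bface 0 F g (a # as))" for a
    unfolding bface_fun by (rule multi_F[OF multi_left_act[OF assms]])
  ultimately show ?thesis
    unfolding 0 by - (rule multi_split, simp_all add: bface_fun(1))
next
  case (Suc i')
  show ?thesis unfolding Suc bface_fun by (rule HM.multi_merge[OF multi_F[OF assms]])
qed

lemma multi_snoc_F: "multiN g \<Longrightarrow> multiM (\<lambda>us m0. F (\<lambda>bs. g (bs @ [d])) us m0)"
  by (intro multi_F multi_append)

lemma linform_snoc_F: "multiN g \<Longrightarrow> linform (ascale A) (\<lambda>d. F (\<lambda>bs. g (bs @ [d])) us m0)"
  by (intro linform_F multi_last)

lemma multi_cface:
  assumes "multiN g"
  shows "multiM (cface p i F g)"
proof (cases "i \<le> p")
  case True
  then have "cface p i F g = F (expand A N i g)" by (simp add: cface_def[abs_def])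
  then show ?thesis by (simp add: multi_F HN.multi_expand assms)
next
  case False
  then have "cface p i F g = (\<lambda>as m. rco A M as m (\<lambda>us m0 d. F (\<lambda>bs. g (bs @ [d])) us m0))"
    by (simp add: cface_def[abs_def])
  then show ?thesis
    by (simp add: HM.multi_rco multi_snoc_F linform_snoc_F assms)
qed

section \<open>Cosimplicial identities and commutation of the faces\<close>

lemma bface_bface:
  assumes "multiN g" "i \<le> j"
  shows "bface (Suc j) (bface i F) g as m = bface i (bface j F) g as m"
proof (cases i)
  case i: 0
  show ?thesis
  proof (cases j)
    case 0
    then show ?thesis
    proof (cases as rule: remdups_adj.cases)
      case (3 a b cs)
      have "HN.left_act (a * b) g = HN.left_act b (HN.left_act a g)"
        by (intro ext HN.left_act_mult assms(1))
      then show ?thesis using 3 i 0 by simp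
    qed (simp_all add: i 0)
  next
    case (Suc j')
    then show ?thesis using i by (cases as) (simp_all add: bface_fun)
  qed
next
  case (Suc i')
  then obtain j' where "j = Suc j'" "i' \<le> j'" using assms(2) by (cases j) auto
  then show ?thesis using Suc by (simp add: bface_fun HM.merge_merge)
qed

text \<open>Three regimes: both indices at most \<open>p\<close> is \<open>expand_expand\<close>;
  for \<open>j = Suc p\<close> and smaller \<open>i\<close>, the appended factor is left alone by
  \<open>expand\<close>; for \<open>i = j = Suc p\<close> it is coassociativity of the codiagonal
  coaction on A^n \<otimes> M.\<close>

lemma cface_cface:
  assumes g: "multiN g" and "i \<le> j" "j \<le> Suc p"
  shows "cface (Suc p) (Suc j) (cface p i F) g as m = cface (Suc p) i (cface p j F) g as m"
proof (cases "j \<le> p")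
  case True
  then have "expand A N i (expand A N (Suc j) g) = expand A N j (expand A N i g)"
    using assms by (intro ext HN.expand_expand)
  then show ?thesis using assms(2) True by (simp add: cface_def)
next
  case False
  then have j: "j = Suc p" using assms(3) by simp
  show ?thesis
  proof (cases "i \<le> p")
    case True
    have "F (expand A N i (\<lambda>bs. g (bs @ [d]))) us m0 = F (\<lambda>bs. expand A N i g (bs @ [d])) us m0" for d us m0
      using True by (intro F_cong) (simp add: expand_snoc)
    then show ?thesis using True j by (simp add: cface_def)
  next
    case False
    then have i: "i = Suc p" using assms j by simp
    have "rco A M as m (\<lambda>us m0 d. rco A M us m0 (\<lambda>us' m0' d'. F (\<lambda>bs. g (bs @ [d', d])) us' m0')) =
        rco A M as m (\<lambda>us m0 d. dlt A d (\<lambda>p q. F (\<lambda>bs. g (bs @ [p, q])) us m0))"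
    proof (rule HM.rco_coassoc[where g="\<lambda>us m d e. F (\<lambda>bs. g (bs @ [d, e])) us m"])
      show "multiM (\<lambda>us m. F (\<lambda>bs. g (bs @ [d, e])) us m)" for d e
        by (intro multi_F multi_append g)
      show "linform (ascale A) (\<lambda>d. F (\<lambda>bs. g (bs @ [d, e])) us m)" for us m e
        by (intro linform_F lmultiD[of _ "\<lambda>as. g as _"] multi_lmulti[OF g])
      show "linform (ascale A) (\<lambda>e. F (\<lambda>bs. g (bs @ [d, e])) us m)" for us m d
        using multi_last[OF g, of "_ @ [d]"] by (intro linform_F) simp
    qed
    also have "\<dots> = rco A M as m (\<lambda>us m0 d. F (\<lambda>bs. expand A N (Suc p) g (bs @ [d])) us m0)"
    proof -
      \<comment> \<open>On lists of length \<open>p\<close> the index \<open>Suc p\<close> splits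
        exactly the appended \<open>d\<close>.\<close>
      have "F (\<lambda>bs. expand A N (Suc p) g (bs @ [d])) us m0 = F (\<lambda>bs x. dlt A d (\<lambda>u v. g (bs @ [u, v]) x)) us m0" for us m0 d
        by (rule F_cong) (auto simp: split_at_last)
      then show ?thesis by (simp add: F_dlt)
    qed
    finally show ?thesis using i j by (simp add: cface_def)
  qed
qed

text \<open>For b_0 the last leg of \<open>a\<close> multiplies the appended coefficient, as
  \<open>diag_act_snoc\<close> shows; the other b_i are colinear by
  \<open>merge_rco\<close>.\<close>

lemma rco_bface:
  assumes g: "multiN g"
  shows "rco A M as m (\<lambda>us m0 d. bface i F (\<lambda>bs. g (bs @ [d])) us m0) = bface i (cface p (Suc p) F) g as m"
proof (cases i)
  case 0
  show ?thesis
  proof (cases as)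
    case (Cons a cs)
    have "(\<lambda>bs. HN.left_act a g (bs @ [d])) =
        (\<lambda>bs x. dlt A a (\<lambda>u v. HN.left_act u (\<lambda>ds. g (ds @ [v * d])) bs x))" for d
      unfolding HN.left_act_def by (intro ext HN.left.diag_act_snoc[OF g])
    then show ?thesis using Cons 0 by (simp add: cface_def F_dlt rco_dlt)
  qed (simp add: 0)
next
  case (Suc i')
  have "merge M i' (\<lambda>as m. rco A M as m (\<lambda>us m0 d. F (\<lambda>bs. g (bs @ [d])) us m0)) as m =
    rco A M as m (\<lambda>us m0 d. merge M i' (\<lambda>us m0. F (\<lambda>bs. g (bs @ [d])) us m0) us m0)"
    by (intro HM.merge_rco multi_snoc_F linform_snoc_F g)
  then show ?thesis using Suc by (simp add: cface_def[abs_def])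
qed

lemma cface_bface:
  assumes g: "multiN g" and "j \<le> Suc p"
  shows "cface p j (bface i F) g as m = bface i (cface p j F) g as m"
proof (cases "j \<le> p")
  case True
  have "HN.left_act a (expand A N j g) = expand A N j (HN.left_act a g)" for a
    unfolding HN.left_act_def by (intro ext HN.left.expand_diag_act[symmetric] g)
  then show ?thesis using True by (cases i; cases as) (simp_all add: cface_def[abs_def])
next
  case False
  then have "j = Suc p" using assms by simp
  then show ?thesis using rco_bface[OF g] by (simp add: cface_def)
qed

section \<open>Faces preserve right linearity and left colinearity\<close>

lemma right_lin_bface:
  assumes "right_lin F"
  shows "right_lin (bface i F)"
  unfolding right_lin_def
proof (intro allI impI)
  fix g as m b assume g: "multiN g"
  have F: "F (HN.right_act b g) = (\<lambda>as m. F g as (ract M m b))" if "multiN g" for g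
    using assms that by (simp add: right_lin_def fun_eq_iff)
  have comm: "HN.left_act a (HN.right_act b g) = HN.right_act b (HN.left_act a g)" for a
    by (intro ext HN.left_act_right_act)
  show "bface i (F) (HN.right_act b g) as m = bface i F g as (ract M m b)"
    by (cases i; cases as) (simp_all add: F[OF g] F[OF multi_left_act[OF g]] comm HM.merge_ract)
qed

lemma right_lin_cface:
  assumes "right_lin F"
  shows "right_lin (cface p i F)"
  unfolding right_lin_def
proof (intro allI impI)
  fix g as m b assume g: "multiN g"
  have F: "F (HN.right_act b g) = (\<lambda>as m. F g as (ract M m b))" if "multiN g" for g b
    using assms that by (simp add: right_lin_def fun_eq_iff)
  show "cface p i F (HN.right_act b g) as m = cface p i F g as (ract M m b)"
  proof (cases "i \<le> p")
    case True
    have "expand A N i (HN.right_act b g) = HN.right_act b (expand A N i g)"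
      unfolding HN.right_act_def by (intro ext HN.right.expand_diag_act g)
    then show ?thesis using True F[OF HN.multi_expand[OF g]] by (simp add: cface_def)
  next
    case False
    \<comment> \<open>The last leg of \<open>b\<close> multiplies the appended factor; the remaining
      legs act on N \<otimes> A^p and pass to M by right linearity of \<open>F\<close>.
      \<open>rco_ract\<close> reassembles them.\<close>
    have "(\<lambda>bs. HN.right_act b g (bs @ [d])) =
        (\<lambda>bs x. dlt A b (\<lambda>u v. HN.right_act u (\<lambda>ds. g (ds @ [d * v])) bs x))" for d
      unfolding HN.right_act_def by (intro ext HN.right.diag_act_snoc[OF g])
    then have "rco A M as m (\<lambda>us m0 d. F (\<lambda>bs. HN.right_act b g (bs @ [d])) us m0) =
        rco A M as m (\<lambda>us m0 d. dlt A b (\<lambda>u v. F (\<lambda>ds. g (ds @ [d * v])) us (ract M m0 u)))"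
      by (simp add: F_dlt F multi_append[OF g])
    also have "\<dots> = rco A M as (ract M m b) (\<lambda>us m0 d. F (\<lambda>bs. g (bs @ [d])) us m0)"
      by (intro HM.rco_ract[symmetric] multi_snoc_F linform_snoc_F g)
    finally show ?thesis using False by (simp add: cface_def)
  qed
qed

text \<open>For b_0, colinearity of \<open>F\<close> is applied to the family
  \<open>left_act v (g (u * c))\<close>: the leg \<open>u\<close> multiplies the coaction
  coefficient, which keeps the family linear in \<open>c\<close>.\<close>

lemma left_colin_bface:
  assumes "left_colin F"
  shows "left_colin (bface i F)"
  unfolding left_colin_def
proof (intro allI impI)
  fix g as m
  assume "\<forall>c. multiN (g c)" and "\<forall>bs x. linform (ascale A) (\<lambda>c. g c bs x)"
  then have g1: "\<And>c. multiN (g c)" and g2: "\<And>bs x. linform (ascale A) (\<lambda>c. g c bs x)" by auto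
  have F: "lco A M as m (\<lambda>c. F (g c)) = F (\<lambda>bs x. lam N x (\<lambda>c x0. g c bs x0)) as m"
    if "\<And>c. multiN (g c)" "\<And>bs x. linform (ascale A) (\<lambda>c. g c bs x)" for g as m
    using assms that by (simp add: left_colin_def)
  show "lco A M as m (\<lambda>c. bface i F (g c)) = bface i F (\<lambda>bs x. lam N x (\<lambda>c x0. g c bs x0)) as m"
  proof (cases i)
    case i: 0
    show ?thesis
    proof (cases as)
      case Nil
      then show ?thesis using i by (simp add: bface_fun)
    next
      case (Cons a cs)
      have "lco A M as m (\<lambda>c. bface i F (g c)) =
          dlt A a (\<lambda>u v. lco A M cs m (\<lambda>c. F (HN.left_act v (g (u * c)))))"
        using i Cons by (simp add: bface_fun)
      also have "\<dots> = dlt A a (\<lambda>u v. F (\<lambda>bs x. lam N x (\<lambda>c x0. HN.left_act v (g (u * c)) bs x0)) cs m)"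
      proof -
        have "linform (ascale A) (\<lambda>c. HN.left_act v (g (u * c)) bs x)" for u v bs x
          unfolding HN.left_act_def diag_act_def
          by (intro linform_dlt linform_diag HM.linform_mult2 g2)
        then show ?thesis
          by (simp add: F[of "\<lambda>c. HN.left_act _ (g (_ * c))"] multi_left_act g1)
      qed
      also have "\<dots> = F (HN.left_act a (\<lambda>bs x. lam N x (\<lambda>c x0. g c bs x0))) cs m"
      proof -
        have "HN.left_act a (\<lambda>bs x. lam N x (\<lambda>c x0. g c bs x0)) =
            (\<lambda>bs x. dlt A a (\<lambda>u v. lam N x (\<lambda>c x0. HN.left_act v (g (u * c)) bs x0)))"
          by (intro ext HN.left_act_lam g1 g2)
        then show ?thesis by (simp add: F_dlt)
      qed
      finally show ?thesis using i Cons by simp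
    qed
  next
    case (Suc i')
    have "merge M i' (\<lambda>as m. lco A M as m (\<lambda>c. F (g c))) as m = lco A M as m (\<lambda>c. merge M i' (F (g c)))"
      by (intro HM.merge_lco multi_F g1 linform_F g2)
    then show ?thesis using Suc F[OF g1 g2] by (simp add: bface_fun)
  qed
qed

text \<open>The last face coacts on A^n \<otimes> M from the right, so the two codiagonal coactions
  must be interchanged (\<open>lco_rco\<close>) before colinearity of \<open>F\<close> applies, with
  the appended factor fixed.\<close>

lemma left_colin_cface:
  assumes "left_colin F"
  shows "left_colin (cface p i F)"
  unfolding left_colin_def
proof (intro allI impI)
  fix g as m
  assume "\<forall>c. multiN (g c)" and "\<forall>bs x. linform (ascale A) (\<lambda>c. g c bs x)"
  then have g1: "\<And>c. multiN (g c)" and g2: "\<And>bs x. linform (ascale A) (\<lambda>c. g c bs x)" by auto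
  have F: "lco A M as m (\<lambda>c. F (g c)) = F (\<lambda>bs x. lam N x (\<lambda>c x0. g c bs x0)) as m"
    if "\<And>c. multiN (g c)" "\<And>bs x. linform (ascale A) (\<lambda>c. g c bs x)" for g as m
    using assms that by (simp add: left_colin_def)
  show "lco A M as m (\<lambda>c. cface p i F (g c)) = cface p i F (\<lambda>bs x. lam N x (\<lambda>c x0. g c bs x0)) as m"
  proof (cases "i \<le> p")
    case True
    have "linform (ascale A) (\<lambda>c. expand A N i (g c) bs x)" for bs x
      by (cases i) (auto intro!: linform_rho linform_split_at g2)
    then have "lco A M as m (\<lambda>c. F (expand A N i (g c))) = F (\<lambda>bs x. lam N x (\<lambda>c x0. expand A N i (g c) bs x0)) as m"
      by (intro F HN.multi_expand g1)
    moreover have "(\<lambda>bs x. lam N x (\<lambda>c x0. expand A N i (g c) bs x0)) = expand A N i (\<lambda>bs x. lam N x (\<lambda>c x0. g c bs x0))"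
      by (intro ext HN.expand_lam[symmetric] g1 g2)
    ultimately show ?thesis using True by (simp add: cface_def[abs_def])
  next
    case False
    have "lco A M as m (\<lambda>c vs m0. rco A M vs m0 (\<lambda>us m0' d. F (\<lambda>bs. g c (bs @ [d])) us m0')) =
        rco A M as m (\<lambda>us m0 d. lco A M us m0 (\<lambda>c vs m0'. F (\<lambda>bs. g c (bs @ [d])) vs m0'))"
      by (intro HM.lco_rco[where g="\<lambda>c us m0 d. F (\<lambda>bs. g c (bs @ [d])) us m0"]
          multi_snoc_F linform_snoc_F g1 linform_F g2)
    also have "\<dots> = rco A M as m (\<lambda>us m0 d. F (\<lambda>bs x. lam N x (\<lambda>c x0. g c (bs @ [d]) x0)) us m0)"
      using F[of "\<lambda>c bs. g c (bs @ [_])"] by (simp add: multi_append g1 g2)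
    finally show ?thesis using False by (simp add: cface_def[abs_def])
  qed
qed

end


section \<open>Cochains as maps on forms\<close>

lemma keys_bindE:
  assumes "y \<in> Poly_Mapping.keys (bind p h)"
  obtains x where "x \<in> Poly_Mapping.keys p" "y \<in> Poly_Mapping.keys (h x)"
  using assms keys_bind[of p h "\<Union>x\<in>Poly_Mapping.keys p. Poly_Mapping.keys (h x)"] by blast

lemma (in bialgebra) keys_comult_iter: "w \<in> Poly_Mapping.keys (comult_iter A r a) \<Longrightarrow> length w = Suc r"
  by (induction r arbitrary: a w) (auto elim!: keys_bindE)

lemma merge_take:
  "Suc i < length as \<Longrightarrow>
    merge M i g as m = g (take i as @ (as ! i * as ! Suc i) # drop (Suc (Suc i)) as) m"
proof (induction i arbitrary: as g)
  case 0
  then show ?case by (cases as rule: remdups_adj.cases) simp_all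
next
  case (Suc i)
  then show ?case by (cases as) simp_all
qed

lemma merge_last: "length as = Suc i \<Longrightarrow> merge M i g as m = g (butlast as) (lact M (last as) m)"
proof (induction i arbitrary: as g)
  case 0
  then show ?case by (cases as rule: remdups_adj.cases) simp_all
next
  case (Suc i)
  then obtain a bs where "as = a # bs" "length bs = Suc i" by (cases as) auto
  then show ?case using Suc.IH by auto
qed

lemma split_at_take:
  "i < length bs \<Longrightarrow> split_at A i bs h = dlt A (bs ! i) (\<lambda>x y. h (take i bs @ x # y # drop (Suc i) bs))"
proof (induction i arbitrary: bs h)
  case 0
  then show ?case by (cases bs) simp_all
next
  case (Suc i)
  then show ?case by (cases bs) simp_all
qed

lemma lco_comult_each:
  "lco A M as m g = ev (comult_each A as) (\<lambda>(us, vs). lam M m (\<lambda>c m0. g (prod_list us * c) vs m0))"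
  by (induction as arbitrary: g) (simp_all add: dlt_def case_prod_unfold mult.assoc)

lemma rco_comult_each:
  "rco A M as m g = ev (comult_each A as) (\<lambda>(us, vs). rho M m (\<lambda>m0 d. g us m0 (prod_list vs * d)))"
  by (induction as arbitrary: g) (simp_all add: dlt_def case_prod_unfold mult.assoc)

lemma keys_comult_each:
  "(us, vs) \<in> Poly_Mapping.keys (comult_each A as) \<Longrightarrow> length us = length as \<and> length vs = length as"
proof (induction as arbitrary: us vs)
  case (Cons a as)
  then show ?case by (fastforce elim!: keys_bindE)
qed simp

section \<open>The transpose of a cochain\<close>

context hopf_pair
begin

text \<open>Lists of length other than \<open>n\<close> do not denote elements of A^n \<otimes> M;
  the value 0 there lets \<open>dual\<close> be multilinear on lists of every length.\<close>

definition val :: "nat \<Rightarrow> ('k, 'a, 'm, 'n) cochain \<Rightarrow> 'a list \<Rightarrow> 'm \<Rightarrow> ('a list \<times> 'n \<times> 'a list \<Rightarrow>\<^sub>0 'k)"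
  where "val n f as m = (if length as = n then rep (f (cls (mrel A M n 0) (bas (as, m, [])))) else 0)"

definition dual :: "nat \<Rightarrow> ('k, 'a, 'm, 'n) cochain \<Rightarrow> ('a list \<Rightarrow> 'n \<Rightarrow> 'k) \<Rightarrow> 'a list \<Rightarrow> 'm \<Rightarrow> 'k"
  where "dual n f g as m = ev (val n f as m) (\<lambda>(_, x, bs). g bs x)"

lemma keys_NAp: "Y \<in> NAp A N p \<Longrightarrow> (cs, x, bs) \<in> Poly_Mapping.keys (rep Y) \<Longrightarrow> cs = [] \<and> length bs = p"
  by (drule keys_rep_mid) (auto simp: mid_dom_def)

lemma keys_AnM: "X \<in> AnM A M n \<Longrightarrow> (as, m, bs) \<in> Poly_Mapping.keys (rep X) \<Longrightarrow> length as = n \<and> bs = []"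
  by (drule keys_rep_mid) (auto simp: mid_dom_def)

lemma pair_NAp: "Y \<in> NAp A N p \<Longrightarrow> pair (rep Y) g = ev (rep Y) (\<lambda>(_, x, bs). g bs x)"
  unfolding pair_def by (intro ev_cong) (auto dest: keys_NAp)

lemma pair_AnM: "X \<in> AnM A M n \<Longrightarrow> pair (rep X) g = ev (rep X) (\<lambda>(as, m, _). g as m)"
  unfolding pair_def by (intro ev_cong) (auto dest: keys_AnM)

lemma simple_AnM: "length as = n \<Longrightarrow> cls (mrel A M n 0) (bas (as, m, [])) \<in> AnM A M n"
  by (intro cls_in_qspace) (simp add: mid_dom_def)

lemma Csp_NAp: "f \<in> Csp A M N n p \<Longrightarrow> X \<in> AnM A M n \<Longrightarrow> f X \<in> NAp A N p"
  by (auto simp: Csp_def qhom_def)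

lemma Csp_simple: "f \<in> Csp A M N n p \<Longrightarrow> length as = n \<Longrightarrow> f (cls (mrel A M n 0) (bas (as, m, []))) \<in> NAp A N p"
  by (rule Csp_NAp[OF _ simple_AnM])

lemma dual_simple:
  "f \<in> Csp A M N n p \<Longrightarrow> length as = n \<Longrightarrow>
    dual n f g as m = pair (rep (f (cls (mrel A M n 0) (bas (as, m, []))))) g"
  by (simp add: dual_def val_def pair_NAp[OF Csp_simple])

lemma pair_Csp_add:
  assumes "f \<in> Csp A M N n p" "multiN g"
    "Poly_Mapping.keys q \<subseteq> mid_dom n 0" "Poly_Mapping.keys r \<subseteq> mid_dom n 0"
  shows "pair (rep (f (cls (mrel A M n 0) (q + r)))) g =
    pair (rep (f (cls (mrel A M n 0) q))) g + pair (rep (f (cls (mrel A M n 0) r))) g"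
  using assms(1) cls_in_qspace[OF assms(3), of "mrel A M n 0"] cls_in_qspace[OF assms(4), of "mrel A M n 0"]
    pair_qadd[OF assms(2)]
  by (simp add: Csp_def qhom_def qadd_cls[symmetric])

lemma pair_Csp_fscale:
  assumes "f \<in> Csp A M N n p" "multiN g" "Poly_Mapping.keys q \<subseteq> mid_dom n 0"
  shows "pair (rep (f (cls (mrel A M n 0) (fscale c q)))) g = c * pair (rep (f (cls (mrel A M n 0) q))) g"
  using assms(1) cls_in_qspace[OF assms(3), of "mrel A M n 0"] pair_qscale[OF assms(2)]
  by (simp add: Csp_def qhom_def qscale_cls[symmetric])

text \<open>Linearity of \<open>f\<close> is available only on classes supported in
  \<open>mid_dom n 0\<close>, so \<open>rep X\<close> is built up one basis vector at a time inside
  that support.\<close>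

lemma pair_Csp:
  assumes f: "f \<in> Csp A M N n p" and g: "multiN g" and X: "X \<in> AnM A M n"
  shows "pair (rep (f X)) g = ev (rep X) (\<lambda>(as, m, _). dual n f g as m)"
proof -
  let ?\<phi> = "\<lambda>q. pair (rep (f (cls (mrel A M n 0) q))) g"
  let ?q = "\<lambda>S. \<Sum>x\<in>S. fscale (Poly_Mapping.lookup (rep X) x) (bas x)"
  have "?\<phi> (?q S) = (\<Sum>x\<in>S. Poly_Mapping.lookup (rep X) x * ?\<phi> (bas x))"
    if "finite S" "S \<subseteq> mid_dom n 0" for S
    using that
  proof (induction S)
    case empty
    then show ?case using pair_Csp_fscale[OF f g, of 0 0] by simp
  next
    case (insert x S)
    have "?\<phi> (?q (insert x S)) = ?\<phi> (fscale (Poly_Mapping.lookup (rep X) x) (bas x) + ?q S)"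
      using insert by simp
    also have "\<dots> = ?\<phi> (fscale (Poly_Mapping.lookup (rep X) x) (bas x)) + ?\<phi> (?q S)"
      using insert.prems
      by (intro pair_Csp_add[OF f g] keys_sum_subset order.trans[OF keys_fscale]) auto
    also have "?\<phi> (fscale (Poly_Mapping.lookup (rep X) x) (bas x)) = Poly_Mapping.lookup (rep X) x * ?\<phi> (bas x)"
      using insert.prems by (intro pair_Csp_fscale[OF f g]) auto
    finally show ?case using insert by simp
  qed
  from this[OF finite_keys keys_rep_mid[OF X]]
  have "?\<phi> (rep X) = ev (rep X) (\<lambda>x. ?\<phi> (bas x))"
    unfolding expand_bas[symmetric] by (simp only: linext_def)
  also have "\<dots> = ev (rep X) (\<lambda>(as, m, _). dual n f g as m)"
  proof (intro ev_cong)
    fix x assume "x \<in> Poly_Mapping.keys (rep X)"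
    then obtain as m where "x = (as, m, [])" "length as = n"
      using keys_AnM[OF X] by (metis prod_cases3)
    then show "?\<phi> (bas x) = (case x of (as, m, _) \<Rightarrow> dual n f g as m)"
      by (simp add: dual_simple[OF f])
  qed
  finally show ?thesis by (simp add: cls_rep[OF subspace_rel(2) X])
qed

text \<open>If all forms are linear in the slot, then the basis vectors are linear in it modulo
  relations, by \<open>mid_rel_separation\<close>; \<open>f\<close> is linear on classes.\<close>

lemma linform_Csp_slot:
  assumes f: "f \<in> Csp A M N n p" and g: "multiN g" and \<sigma>: "\<And>a. \<sigma> a \<in> mid_dom n 0"
    and lin: "\<And>G. multiM G \<Longrightarrow> linform s (\<lambda>a. pair (bas (\<sigma> a)) G)"
  shows "linform s (\<lambda>a. pair (rep (f (cls (mrel A M n 0) (bas (\<sigma> a))))) g)"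
  unfolding linform_def
proof (intro conjI allI)
  let ?R = "mrel A M n 0"
  have keys: "Poly_Mapping.keys (bas (\<sigma> a) :: _ \<Rightarrow>\<^sub>0 'k) \<subseteq> mid_dom n 0" for a
    using \<sigma> by simp
  fix u v
  have "bas (\<sigma> (u + v)) - (bas (\<sigma> u) + bas (\<sigma> v)) \<in> ?R"
    using lin unfolding linform_def pair_def
    by (intro mid_rel_separation keys_diff_subset keys_add_subset keys) simp
  then have "cls ?R (bas (\<sigma> (u + v))) = cls ?R (bas (\<sigma> u) + bas (\<sigma> v))"
    by (rule cls_eqI[OF subspace_rel(2)])
  then show "pair (rep (f (cls ?R (bas (\<sigma> (u + v)))))) g =
      pair (rep (f (cls ?R (bas (\<sigma> u))))) g + pair (rep (f (cls ?R (bas (\<sigma> v))))) g"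
    by (simp only: pair_Csp_add[OF f g keys keys])
next
  let ?R = "mrel A M n 0"
  have keys: "Poly_Mapping.keys (bas (\<sigma> a) :: _ \<Rightarrow>\<^sub>0 'k) \<subseteq> mid_dom n 0" for a
    using \<sigma> by simp
  fix c u
  have "bas (\<sigma> (s c u)) - fscale c (bas (\<sigma> u)) \<in> ?R"
    using lin unfolding linform_def pair_def
    by (intro mid_rel_separation keys_diff_subset order.trans[OF keys_fscale] keys) simp
  then have "cls ?R (bas (\<sigma> (s c u))) = cls ?R (fscale c (bas (\<sigma> u)))"
    by (rule cls_eqI[OF subspace_rel(2)])
  then show "pair (rep (f (cls ?R (bas (\<sigma> (s c u)))))) g = c * pair (rep (f (cls ?R (bas (\<sigma> u))))) g"
    by (simp only: pair_Csp_fscale[OF f g keys])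
qed

lemma dual_support: "length as \<noteq> n \<Longrightarrow> dual n f g as = (\<lambda>m. 0)"
  by (intro ext) (simp add: dual_def val_def)

lemma multi_dual:
  assumes f: "f \<in> Csp A M N n p" and g: "multiN g"
  shows "multiM (dual n f g)"
  unfolding multi_def lmulti_def
proof (intro conjI allI)
  show "linform (mscale M) (dual n f g as)" for as
  proof (cases "length as = n")
    case True
    have "linform (mscale M) (\<lambda>m. pair (rep (f (cls (mrel A M n 0) (bas (as, m, []))))) g)"
      by (rule linform_Csp_slot[OF f g]) (auto simp: True mid_dom_def pair_def multi_linform)
    moreover have "dual n f g as = (\<lambda>m. pair (rep (f (cls (mrel A M n 0) (bas (as, m, []))))) g)"
      by (intro ext dual_simple[OF f True])
    ultimately show ?thesis by simp
  qed (simp add: dual_support)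
  show "linform (ascale A) (\<lambda>a. dual n f g (as @ a # as') m)" for as as' m
  proof (cases "Suc (length as + length as') = n")
    case True
    have "linform (ascale A) (\<lambda>a. pair (rep (f (cls (mrel A M n 0) (bas (as @ a # as', m, []))))) g)"
      by (rule linform_Csp_slot[OF f g])
        (auto simp: True mid_dom_def pair_def intro: lmultiD[OF multi_lmulti])
    then show ?thesis using True by (simp add: dual_simple[OF f])
  qed (simp add: dual_support)
qed

lemma cochain_Csp:
  assumes f: "f \<in> Csp A M N n p"
  shows "cochain A M N (val n f) (dual n f) n p"
proof (unfold_locales)
  show "length bs = p" if "(cs, x, bs) \<in> Poly_Mapping.keys (val n f as m)" for cs x bs as m
    using that keys_NAp[OF Csp_simple[OF f]] by (auto simp: val_def split: if_splits)
qed (auto simp: dual_def val_def multi_dual[OF f])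

lemma Csp_eqI:
  assumes "f \<in> AnM A M n \<rightarrow>\<^sub>E NAp A N p" "f' \<in> AnM A M n \<rightarrow>\<^sub>E NAp A N p"
    "\<And>X g. X \<in> AnM A M n \<Longrightarrow> multiN g \<Longrightarrow> pair (rep (f X)) g = pair (rep (f' X)) g"
  shows "f = f'"
  by (rule PiE_ext[OF assms(1,2)], rule qspace_eqI) (use assms in auto)

lemma Csp_PiE: "f \<in> Csp A M N n p \<Longrightarrow> f \<in> AnM A M n \<rightarrow>\<^sub>E NAp A N p"
  by (simp add: Csp_def qhom_def)

text \<open>Values in N \<otimes> A^p are separated by forms, so a map having a transpose that
  yields multilinear forms is linear.\<close>

lemma Csp_intro:
  assumes f: "f \<in> AnM A M n \<rightarrow>\<^sub>E NAp A N p"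
    and G: "\<And>g. multiN g \<Longrightarrow> multiM (G g)"
    and pair: "\<And>X g. X \<in> AnM A M n \<Longrightarrow> multiN g \<Longrightarrow> pair (rep (f X)) g = ev (rep X) (\<lambda>(as, m, _). G g as m)"
  shows "f \<in> Csp A M N n p"
proof -
  have fX: "f X \<in> NAp A N p" if "X \<in> AnM A M n" for X using f that by auto
  have pair': "pair (rep (f X)) g = pair (rep X) (G g)" if "X \<in> AnM A M n" "multiN g" for X g
    using pair that by (simp add: pair_AnM)
  have "f (qadd (mrel A M n 0) X Y) = qadd (mrel A N 0 p) (f X) (f Y)"
    if X: "X \<in> AnM A M n" and Y: "Y \<in> AnM A M n" for X Y
    using X Y by (intro qspace_eqI[OF fX[OF qadd_in_qspace] qadd_in_qspace])
      (simp_all add: fX pair_qadd pair' qadd_in_qspace G)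
  moreover have "f (qscale (mrel A M n 0) c X) = qscale (mrel A N 0 p) c (f X)"
    if X: "X \<in> AnM A M n" for c X
    using X by (intro qspace_eqI[OF fX[OF qscale_in_qspace] qscale_in_qspace])
      (simp_all add: fX pair_qscale pair' qscale_in_qspace G)
  ultimately show ?thesis using f by (simp add: Csp_def qhom_def)
qed

lemma ev_rep_simple:
  assumes "multiM G" "length as = n"
  shows "ev (rep (cls (mrel A M n 0) (bas (as, m, [])))) (\<lambda>(as, m, _). G as m) = G as m"
  using pair_rep_cls[OF assms(1), of n 0 "bas (as, m, [])"] pair_AnM[OF simple_AnM[OF assms(2)], of m G]
  by (simp add: pair_def)

lemma dual_eqI:
  assumes f: "f \<in> Csp A M N n p" and g: "multiN g" and G: "multiM G"
    and supp: "\<And>as m. length as \<noteq> n \<Longrightarrow> G as m = 0"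
    and pair: "\<And>X. X \<in> AnM A M n \<Longrightarrow> pair (rep (f X)) g = ev (rep X) (\<lambda>(as, m, _). G as m)"
  shows "dual n f g = G"
proof (intro ext)
  show "dual n f g as m = G as m" for as m
  proof (cases "length as = n")
    case True
    then show ?thesis
      using pair[OF simple_AnM[OF True]] by (simp add: dual_simple[OF f] ev_rep_simple G)
  qed (simp add: dual_support supp)
qed

end


section \<open>The double complex\<close>

context hopf_pair
begin

section \<open>Faces of cochains compared with faces on forms\<close>

lemma face_b_NAp:
  assumes f: "f \<in> Csp A M N n p" and X: "X \<in> AnM A M (Suc n)" and i: "i \<le> Suc n"
  shows "face_b A M N n p i f X \<in> NAp A N p"
  unfolding face_b_def
proof (intro cls_in_qspace keys_bind)
  fix z assume "z \<in> Poly_Mapping.keys (rep X)"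
  then obtain as m where z: "z = (as, m, [])" "length as = Suc n"
    using keys_AnM[OF X] by (metis prod_cases3)
  show "Poly_Mapping.keys (case z of (as, m, _) \<Rightarrow>
      if i = 0 then
        bind (comult_iter A p (hd as)) (\<lambda>w.
          bind (rep (f (cls (mrel A M n 0) (bas (tl as, m, []))))) (\<lambda>(_, x, bs).
            bas ([], lact N (hd w) x, map2 (*) (tl w) bs)))
      else if i \<le> n then
        rep (f (cls (mrel A M n 0)
          (bas (take (i - 1) as @ (as ! (i - 1) * as ! i) # drop (i + 1) as, m, []))))
      else
        rep (f (cls (mrel A M n 0) (bas (butlast as, lact M (last as) m, []))))) \<subseteq> mid_dom 0 p"
  proof (cases "i = 0")
    case True
    have "length (map2 (*) (tl w) bs) = p"
      if "w \<in> Poly_Mapping.keys (comult_iter A p a)"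
        "(cs, x, bs) \<in> Poly_Mapping.keys (rep (f (cls (mrel A M n 0) (bas (tl as, m, [])))))" for w a cs x bs
      using HM.keys_comult_iter[OF that(1)] keys_NAp[OF Csp_simple[OF f] that(2)] z by simp
    then show ?thesis
      using True z by (auto intro!: keys_bind simp: mid_dom_def)
  next
    case False
    then show ?thesis
      using z i by (auto intro!: keys_rep_mid Csp_simple[OF f])
  qed
qed

lemma pair_face_b:
  assumes f: "f \<in> Csp A M N n p" and X: "X \<in> AnM A M (Suc n)" and i: "i \<le> Suc n" and g: "multiN g"
  shows "pair (rep (face_b A M N n p i f X)) g = ev (rep X) (\<lambda>(as, m, _). bface i (dual n f) g as m)"
  unfolding face_b_def pair_rep_cls[OF g] unfolding pair_def ev_bind
proof (intro ev_cong)
  let ?g = "\<lambda>(as, x, bs). g (as @ bs) x"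
  fix z assume "z \<in> Poly_Mapping.keys (rep X)"
  then obtain as m where z: "z = (as, m, [])" "length as = Suc n"
    using keys_AnM[OF X] by (metis prod_cases3)
  then obtain a cs where as: "as = a # cs" "length cs = n" by (cases as) auto
  have dual: "ev (rep (f (cls (mrel A M n 0) (bas (bs, m, []))))) ?g = dual n f g bs m"
    if "length bs = n" for bs m
    by (simp add: dual_simple[OF f that] pair_def)
  consider "i = 0" | i' where "i = Suc i'" "i' < n" | "i = Suc n" using i by (cases i) force+
  then show "ev (case z of (as, m, _) \<Rightarrow>
      if i = 0 then
        bind (comult_iter A p (hd as)) (\<lambda>w.
          bind (rep (f (cls (mrel A M n 0) (bas (tl as, m, []))))) (\<lambda>(_, x, bs).
            bas ([], lact N (hd w) x, map2 (*) (tl w) bs)))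
      else if i \<le> n then
        rep (f (cls (mrel A M n 0)
          (bas (take (i - 1) as @ (as ! (i - 1) * as ! i) # drop (i + 1) as, m, []))))
      else
        rep (f (cls (mrel A M n 0) (bas (butlast as, lact M (last as) m, []))))) ?g =
    (case z of (as, m, _) \<Rightarrow> bface i (dual n f) g as m)"
  proof cases
    case 1
    let ?W = "rep (f (cls (mrel A M n 0) (bas (cs, m, []))))"
    \<comment> \<open>Exchanging the sums fixes an entry of the value of \<open>f\<close> first; its
      list has length \<open>p\<close>, matching the legs of
      \<open>comult_iter A p a\<close>.\<close>
    have "ev (comult_iter A p a) (\<lambda>w. ev ?W (\<lambda>(_, x, bs). g (map2 (*) (tl w) bs) (lact N (hd w) x))) =
        ev ?W (\<lambda>y. ev (comult_iter A p a) (\<lambda>w. g (map2 (*) (tl w) (snd (snd y))) (lact N (hd w) (fst (snd y)))))"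
      unfolding case_prod_unfold by (rule ev_swap)
    also have "\<dots> = ev ?W (\<lambda>(_, x, bs). HN.left_act a g bs x)"
    proof (intro ev_cong)
      fix y assume "y \<in> Poly_Mapping.keys ?W"
      then obtain x bs where "y = ([], x, bs)" "length bs = p"
        using keys_NAp[OF Csp_simple[OF f as(2)]] by (metis prod_cases3)
      then show "ev (comult_iter A p a) (\<lambda>w. g (map2 (*) (tl w) (snd (snd y))) (lact N (hd w) (fst (snd y)))) =
          (case y of (_, x, bs) \<Rightarrow> HN.left_act a g bs x)"
        using HN.left.ev_comult_iter_diag_act[OF g] by (auto simp: HN.left_act_def)
    qed
    also have "\<dots> = dual n f (HN.left_act a g) cs m"
      by (simp add: dual_def val_def as)
    finally show ?thesis
      using 1 z as by (simp add: case_prod_unfold)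
  next
    case 2
    then show ?thesis
      using z by (simp add: merge_take dual)
  next
    case 3
    then show ?thesis
      using z by (simp add: merge_last dual)
  qed
qed

lemma face_c_NAp:
  assumes f: "f \<in> Csp A M N n p" and X: "X \<in> AnM A M n"
  shows "face_c A M N n p i f X \<in> NAp A N (Suc p)"
proof -
  note keys_f = keys_NAp[OF Csp_NAp[OF f X]]
  show ?thesis
  proof (cases "i \<le> p")
    case True
    then show ?thesis
      unfolding face_c_def
      by (intro cls_in_qspace) (auto intro!: keys_bind dest!: keys_f simp: mid_dom_def)
  next
    case False
    have "length bs = p"
      if "(as, m, cs) \<in> Poly_Mapping.keys (rep X)" "(us, vs) \<in> Poly_Mapping.keys (comult_each A as)"
        "(ds, x, bs) \<in> Poly_Mapping.keys (rep (f (cls (mrel A M n 0) (bas (us, m0, [])))))"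
      for as m cs us vs ds x bs m0
      using keys_NAp[OF Csp_simple[OF f] that(3)] keys_comult_each[OF that(2)] keys_AnM[OF X that(1)] by simp
    then have "Poly_Mapping.keys (bind (rep X) (\<lambda>(as, m, _). bind (comult_each A as) (\<lambda>(us, vs).
          bind (rep (rcoact M m)) (\<lambda>(_, m0, d).
            bind (rep (f (cls (mrel A M n 0) (bas (us, m0, []))))) (\<lambda>(_, x, bs).
              bas ([], x, bs @ [prod_list vs * hd d])))))) \<subseteq> mid_dom 0 (Suc p)"
      by (intro keys_bind) (auto elim!: keys_bindE simp: mid_dom_def)
    then show ?thesis
      using False unfolding face_c_def by (intro cls_in_qspace) simp
  qed
qed

text \<open>For \<open>i \<le> p\<close> the face acts on \<open>f X\<close> as a whole, and
  \<open>pair_Csp\<close> moves the expanded form to \<open>X\<close>; only the last face decomposes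
  \<open>X\<close> itself.\<close>

lemma pair_face_c:
  assumes f: "f \<in> Csp A M N n p" and X: "X \<in> AnM A M n" and g: "multiN g"
  shows "pair (rep (face_c A M N n p i f X)) g = ev (rep X) (\<lambda>(as, m, _). cface p i (dual n f) g as m)"
proof (cases "i \<le> p")
  case True
  note keys_f = keys_NAp[OF Csp_NAp[OF f X]]
  have "pair (rep (face_c A M N n p i f X)) g = ev (rep (f X)) (\<lambda>(_, x, bs). expand A N i g bs x)"
  proof (cases i)
    case 0
    then show ?thesis
      unfolding face_c_def pair_rep_cls[OF g] by (simp add: pair_def rho_def case_prod_unfold)
  next
    case (Suc i')
    have "ev (rep (f X)) (\<lambda>y. dlt A (snd (snd y) ! i') (\<lambda>u v.
        g (take i' (snd (snd y)) @ u # v # drop (Suc i') (snd (snd y))) (fst (snd y)))) =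
      ev (rep (f X)) (\<lambda>(_, x, bs). split_at A i' bs (\<lambda>ds. g ds x))"
      using True Suc by (intro ev_cong) (auto dest!: keys_f simp: split_at_take)
    then show ?thesis
      using True Suc unfolding face_c_def pair_rep_cls[OF g]
      by (simp add: pair_def dlt_def case_prod_unfold)
  qed
  also have "\<dots> = pair (rep (f X)) (expand A N i g)"
    by (rule pair_NAp[OF Csp_NAp[OF f X], symmetric])
  also have "\<dots> = ev (rep X) (\<lambda>(as, m, _). cface p i (dual n f) g as m)"
    using True by (simp add: pair_Csp[OF f HN.multi_expand[OF g] X] cface_def)
  finally show ?thesis .
next
  case False
  have "pair (rep (face_c A M N n p i f X)) g = ev (rep X) (\<lambda>(as, m, _). ev (comult_each A as) (\<lambda>(us, vs).
      rho M m (\<lambda>m0 d. ev (rep (f (cls (mrel A M n 0) (bas (us, m0, [])))))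
        (\<lambda>(_, x, bs). g (bs @ [prod_list vs * d]) x))))"
    using False unfolding face_c_def pair_rep_cls[OF g]
    by (simp add: pair_def rho_def case_prod_unfold)
  also have "\<dots> = ev (rep X) (\<lambda>(as, m, _). ev (comult_each A as) (\<lambda>(us, vs).
      rho M m (\<lambda>m0 d. dual n f (\<lambda>bs. g (bs @ [prod_list vs * d])) us m0)))"
    unfolding case_prod_unfold
    by (intro ev_cong) (auto dest!: keys_AnM[OF X] keys_comult_each simp: dual_def val_def case_prod_unfold)
  also have "\<dots> = ev (rep X) (\<lambda>(as, m, _). cface p i (dual n f) g as m)"
    using False by (simp add: cface_def rco_comult_each)
  finally show ?thesis .
qed

section \<open>The differentials on forms\<close>

definition dm_form where "dm_form n F g as m = ev (altsum (Suc n)) (\<lambda>i. bface i F g as m)"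

definition dc_form where "dc_form p F g as m = ev (altsum (Suc p)) (\<lambda>i. cface p i F g as m)"

lemma multi_ev: "(\<And>z. multi s t (\<lambda>as m. G z as m)) \<Longrightarrow> multi s t (\<lambda>as m. ev q (\<lambda>z. G z as m))"
  unfolding multi_def lmulti_def by (auto intro: linform_ev)

lemma d_m_NAp:
  assumes f: "f \<in> Csp A M N n p"
  shows "d_m A M N n p f \<in> AnM A M (Suc n) \<rightarrow>\<^sub>E NAp A N p"
proof
  fix X assume X: "X \<in> AnM A M (Suc n)"
  show "d_m A M N n p f X \<in> NAp A N p"
    using X face_b_NAp[OF f X] by (simp add: d_m_def qaltsum_in_qspace)
qed (simp add: d_m_def)

lemma d_c_NAp:
  assumes f: "f \<in> Csp A M N n p"
  shows "d_c A M N n p f \<in> AnM A M n \<rightarrow>\<^sub>E NAp A N (Suc p)"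
proof
  fix X assume X: "X \<in> AnM A M n"
  show "d_c A M N n p f X \<in> NAp A N (Suc p)"
    using X face_c_NAp[OF f X] by (simp add: d_c_def qaltsum_in_qspace)
qed (simp add: d_c_def)

lemma pair_d_m:
  assumes f: "f \<in> Csp A M N n p" and X: "X \<in> AnM A M (Suc n)" and g: "multiN g"
  shows "pair (rep (d_m A M N n p f X)) g = ev (rep X) (\<lambda>(as, m, _). dm_form n (dual n f) g as m)"
proof -
  have "pair (rep (d_m A M N n p f X)) g =
      (\<Sum>i\<le>Suc n. (- 1) ^ i * ev (rep X) (\<lambda>(as, m, _). bface i (dual n f) g as m))"
    using X unfolding d_m_def by (simp add: pair_qaltsum[OF g] pair_face_b[OF f X _ g])
  also have "\<dots> = ev (rep X) (\<lambda>(as, m, _). dm_form n (dual n f) g as m)"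
    unfolding dm_form_def ev_altsum[symmetric] case_prod_unfold by (rule ev_swap)
  finally show ?thesis .
qed

lemma pair_d_c:
  assumes f: "f \<in> Csp A M N n p" and X: "X \<in> AnM A M n" and g: "multiN g"
  shows "pair (rep (d_c A M N n p f X)) g = ev (rep X) (\<lambda>(as, m, _). dc_form p (dual n f) g as m)"
proof -
  have "pair (rep (d_c A M N n p f X)) g =
      (\<Sum>i\<le>Suc p. (- 1) ^ i * ev (rep X) (\<lambda>(as, m, _). cface p i (dual n f) g as m))"
    using X unfolding d_c_def by (simp add: pair_qaltsum[OF g] pair_face_c[OF f X g])
  also have "\<dots> = ev (rep X) (\<lambda>(as, m, _). dc_form p (dual n f) g as m)"
    unfolding dc_form_def ev_altsum[symmetric] case_prod_unfold by (rule ev_swap)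
  finally show ?thesis .
qed

lemma multi_dm_form: "f \<in> Csp A M N n p \<Longrightarrow> multiN g \<Longrightarrow> multiM (dm_form n (dual n f) g)"
  unfolding dm_form_def[abs_def] by (intro multi_ev cochain.multi_bface[OF cochain_Csp])

lemma multi_dc_form: "f \<in> Csp A M N n p \<Longrightarrow> multiN g \<Longrightarrow> multiM (dc_form p (dual n f) g)"
  unfolding dc_form_def[abs_def] by (intro multi_ev cochain.multi_cface[OF cochain_Csp])

lemma d_m_Csp: "f \<in> Csp A M N n p \<Longrightarrow> d_m A M N n p f \<in> Csp A M N (Suc n) p"
  by (rule Csp_intro[OF d_m_NAp multi_dm_form pair_d_m])

lemma d_c_Csp: "f \<in> Csp A M N n p \<Longrightarrow> d_c A M N n p f \<in> Csp A M N n (Suc p)"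
  by (rule Csp_intro[OF d_c_NAp multi_dc_form pair_d_c])

lemma dual_d_m:
  assumes f: "f \<in> Csp A M N n p" and g: "multiN g"
  shows "dual (Suc n) (d_m A M N n p f) g = dm_form n (dual n f) g"
  by (rule dual_eqI[OF d_m_Csp[OF f] g multi_dm_form[OF f g] _ pair_d_m[OF f _ g]])
    (simp add: dm_form_def cochain.bface_support[OF cochain_Csp[OF f]])

lemma dual_d_c:
  assumes f: "f \<in> Csp A M N n p" and g: "multiN g"
  shows "dual n (d_c A M N n p f) g = dc_form p (dual n f) g"
  by (rule dual_eqI[OF d_c_Csp[OF f] g multi_dc_form[OF f g] _ pair_d_c[OF f _ g]])
    (simp add: dc_form_def cochain.cface_support[OF cochain_Csp[OF f]])

lemma Csp_dual_eqI:
  assumes f: "f \<in> Csp A M N n p" and f': "f' \<in> Csp A M N n p"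
    and eq: "\<And>g. multiN g \<Longrightarrow> dual n f g = dual n f' g"
  shows "f = f'"
  by (rule Csp_eqI[OF Csp_PiE[OF f] Csp_PiE[OF f']]) (simp add: pair_Csp[OF f] pair_Csp[OF f'] eq)

lemma zero_NAp: "cls (mrel A N 0 p) 0 \<in> NAp A N p"
  by (intro cls_in_qspace) simp

lemma eq_zero_cochain:
  assumes f: "f \<in> Csp A M N n p" and eq: "\<And>g as m. multiN g \<Longrightarrow> dual n f g as m = 0"
  shows "f = zero_cochain A M N n p"
proof (rule Csp_eqI[OF Csp_PiE[OF f]])
  show "zero_cochain A M N n p \<in> AnM A M n \<rightarrow>\<^sub>E NAp A N p"
    using zero_NAp by (simp add: zero_cochain_def)
  show "pair (rep (f X)) g = pair (rep (zero_cochain A M N n p X)) g"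
    if "X \<in> AnM A M n" "multiN g" for X g
    using that by (simp add: pair_Csp[OF f] eq zero_cochain_def pair_rep_cls case_prod_unfold)
      (simp add: pair_def)
qed

lemma d_m_d_m:
  assumes f: "f \<in> Csp A M N n p"
  shows "d_m A M N (Suc n) p (d_m A M N n p f) = zero_cochain A M N (Suc (Suc n)) p"
proof (rule eq_zero_cochain[OF d_m_Csp[OF d_m_Csp[OF f]]])
  fix g as m assume g: "multiN g"
  have "dual (Suc (Suc n)) (d_m A M N (Suc n) p (d_m A M N n p f)) g as m =
      ev (altsum (Suc (Suc n))) (\<lambda>j. bface j (dm_form n (dual n f)) g as m)"
    by (simp add: dual_d_m[OF d_m_Csp[OF f] g] dm_form_def[of "Suc n"] bface_cong[OF dual_d_m[OF f] g])
  also have "\<dots> = ev (altsum (Suc (Suc n))) (\<lambda>j. ev (altsum (Suc n)) (\<lambda>i. bface j (bface i (dual n f)) g as m))"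
    unfolding dm_form_def[abs_def] bface_ev ..
  also have "\<dots> = 0"
    by (rule altsum_cosimplicial) (rule cochain.bface_bface[OF cochain_Csp[OF f] g])
  finally show "dual (Suc (Suc n)) (d_m A M N (Suc n) p (d_m A M N n p f)) g as m = 0" .
qed

lemma d_c_d_c:
  assumes f: "f \<in> Csp A M N n p"
  shows "d_c A M N n (Suc p) (d_c A M N n p f) = zero_cochain A M N n (Suc (Suc p))"
proof (rule eq_zero_cochain[OF d_c_Csp[OF d_c_Csp[OF f]]])
  fix g as m assume g: "multiN g"
  have "dual n (d_c A M N n (Suc p) (d_c A M N n p f)) g as m =
      ev (altsum (Suc (Suc p))) (\<lambda>j. cface (Suc p) j (dc_form p (dual n f)) g as m)"
    by (simp add: dual_d_c[OF d_c_Csp[OF f] g] dc_form_def[of "Suc p"] cface_cong[OF dual_d_c[OF f] g])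
  also have "\<dots> = ev (altsum (Suc (Suc p))) (\<lambda>j. ev (altsum (Suc p)) (\<lambda>i. cface (Suc p) j (cface p i (dual n f)) g as m))"
    unfolding dc_form_def[abs_def] cface_ev ..
  also have "\<dots> = 0"
    by (rule altsum_cosimplicial) (rule cochain.cface_cface[OF cochain_Csp[OF f] g])
  finally show "dual n (d_c A M N n (Suc p) (d_c A M N n p f)) g as m = 0" .
qed

lemma d_c_d_m:
  assumes f: "f \<in> Csp A M N n p"
  shows "d_c A M N (Suc n) p (d_m A M N n p f) = d_m A M N n (Suc p) (d_c A M N n p f)"
proof (rule Csp_dual_eqI[OF d_c_Csp[OF d_m_Csp[OF f]] d_m_Csp[OF d_c_Csp[OF f]]], intro ext)
  fix g as m assume g: "multiN g"
  have "dual (Suc n) (d_c A M N (Suc n) p (d_m A M N n p f)) g as m =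
      ev (altsum (Suc p)) (\<lambda>j. cface p j (dm_form n (dual n f)) g as m)"
    by (simp add: dual_d_c[OF d_m_Csp[OF f] g] dc_form_def cface_cong[OF dual_d_m[OF f] g])
  also have "\<dots> = ev (altsum (Suc p)) (\<lambda>j. ev (altsum (Suc n)) (\<lambda>i. cface p j (bface i (dual n f)) g as m))"
    unfolding dm_form_def[abs_def] cface_ev ..
  \<comment> \<open>Faces commute pairwise; \<open>keys_altsum\<close> provides the bound on
    \<open>j\<close> required by \<open>cface_bface\<close>.\<close>
  also have "\<dots> = ev (altsum (Suc p)) (\<lambda>j. ev (altsum (Suc n)) (\<lambda>i. bface i (cface p j (dual n f)) g as m))"
    by (intro ev_cong cochain.cface_bface[OF cochain_Csp[OF f] g] keys_altsum)
  also have "\<dots> = ev (altsum (Suc n)) (\<lambda>i. bface i (dc_form p (dual n f)) g as m)"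
    unfolding dc_form_def[abs_def] bface_ev by (rule ev_swap)
  also have "\<dots> = dual (Suc n) (d_m A M N n (Suc p) (d_c A M N n p f)) g as m"
    by (simp add: dual_d_m[OF d_c_Csp[OF f] g] dm_form_def bface_cong[OF dual_d_c[OF f] g])
  finally show "dual (Suc n) (d_c A M N (Suc n) p (d_m A M N n p f)) g as m =
      dual (Suc n) (d_m A M N n (Suc p) (d_c A M N n p f)) g as m" .
qed

section \<open>Membership in T as a condition on the transpose\<close>

lemma right_lin_ev: "(\<And>z. right_lin (H z)) \<Longrightarrow> right_lin (\<lambda>g as m. ev q (\<lambda>z. H z g as m))"
  by (simp add: right_lin_def)

lemma left_colin_ev: "(\<And>z. left_colin (H z)) \<Longrightarrow> left_colin (\<lambda>g as m. ev q (\<lambda>z. H z g as m))"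
  by (simp add: left_colin_def lco_ev)

lemma right_lin_cong:
  assumes "\<And>g. multiN g \<Longrightarrow> F g = F' g" "right_lin F'"
  shows "right_lin F"
  using assms by (simp add: right_lin_def multi_right_act)

lemma left_colin_cong:
  assumes "\<And>g. multiN g \<Longrightarrow> F g = F' g" "left_colin F'"
  shows "left_colin F"
  using assms by (simp add: left_colin_def HN.multi_lam)

text \<open>A condition on all tensors is tested on classes of single triples, where
  \<open>ev_rep_simple\<close> recovers the form itself; conversely the sums agree termwise.\<close>

lemma all_AnM_iff:
  assumes "\<And>g. P g \<Longrightarrow> multiM (G g)" "\<And>g. P g \<Longrightarrow> multiM (G' g)"
    "\<And>g as m. P g \<Longrightarrow> length as \<noteq> n \<Longrightarrow> G g as m = G' g as m"
  shows "(\<forall>X\<in>AnM A M n. \<forall>g. P g \<longrightarrow>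
      ev (rep X) (\<lambda>(as, m, _). G g as m) = ev (rep X) (\<lambda>(as, m, _). G' g as m)) \<longleftrightarrow>
    (\<forall>g as m. P g \<longrightarrow> G g as m = G' g as m)"
    (is "?L \<longleftrightarrow> ?R")
proof
  assume L: ?L
  show ?R
  proof (intro allI impI)
    fix g as m assume g: "P g"
    show "G g as m = G' g as m"
    proof (cases "length as = n")
      case True
      then show ?thesis
        using L simple_AnM[OF True, of m] g by (force simp: ev_rep_simple assms(1,2))
    qed (simp add: assms(3) g)
  qed
qed simp

lemma qspace_eq_iff:
  assumes "X \<in> qspace (mid_rel s t i j) (mid_dom i j)" "Y \<in> qspace (mid_rel s t i j) (mid_dom i j)"
  shows "X = Y \<longleftrightarrow> (\<forall>g. multi s t g \<longrightarrow> pair (rep X) g = pair (rep Y) g)"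
  using qspace_eqI[OF assms] by blast

lemma ract_AnM_in:
  assumes X: "X \<in> AnM A M n"
  shows "ract_AnM A M n X b \<in> AnM A M n"
  unfolding ract_AnM_def
  by (intro cls_in_qspace keys_bind) (auto dest!: keys_AnM[OF X] simp: mid_dom_def)

lemma multi_ract:
  assumes "multiM G"
  shows "multiM (\<lambda>as m. G as (ract M m b))"
  by (intro multiI HM.linform_ract multi_linform[OF assms] multi_lmulti[OF assms])

lemma pair_ract_AnM:
  assumes f: "f \<in> Csp A M N n p" and X: "X \<in> AnM A M n" and g: "multiN g"
  shows "pair (rep (f (ract_AnM A M n X b))) g = ev (rep X) (\<lambda>(as, m, _). dual n f g as (ract M m b))"
proof -
  have "pair (rep (f (ract_AnM A M n X b))) g = pair (rep (ract_AnM A M n X b)) (dual n f g)"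
    unfolding pair_Csp[OF f g ract_AnM_in[OF X]] pair_AnM[OF ract_AnM_in[OF X]] ..
  also have "\<dots> = ev (rep X) (\<lambda>(as, m, _). dual n f g as (ract M m b))"
    unfolding ract_AnM_def pair_rep_cls[OF multi_dual[OF f g]]
    by (simp add: pair_def case_prod_unfold)
  finally show ?thesis .
qed

lemma ract_NAp_in:
  assumes Y: "Y \<in> NAp A N p"
  shows "ract_NAp A N p Y b \<in> NAp A N p"
  unfolding ract_NAp_def
  by (intro cls_in_qspace)
    (auto elim!: keys_bindE dest!: keys_NAp[OF Y] HM.keys_comult_iter simp: mid_dom_def)

lemma map2_flip: "map2 (\<lambda>u c. f c u) xs ys = map2 f ys xs"
  by (induction xs ys rule: list_induct2') simp_all

lemma pair_ract_NAp:
  assumes Y: "Y \<in> NAp A N p" and g: "multiN g"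
  shows "pair (rep (ract_NAp A N p Y b)) g = pair (rep Y) (HN.right_act b g)"
proof -
  have "pair (rep (ract_NAp A N p Y b)) g =
      ev (rep Y) (\<lambda>(_, x, bs). ev (comult_iter A p b) (\<lambda>w. g (map2 (*) bs (tl w)) (ract N x (hd w))))"
    unfolding ract_NAp_def pair_rep_cls[OF g] by (simp add: pair_def case_prod_unfold)
  also have "\<dots> = ev (rep Y) (\<lambda>(_, x, bs). HN.right_act b g bs x)"
  proof (intro ev_cong)
    fix y assume "y \<in> Poly_Mapping.keys (rep Y)"
    then obtain x bs where "y = ([], x, bs)" "length bs = p"
      using keys_NAp[OF Y] by (metis prod_cases3)
    then show "(case y of (_, x, bs) \<Rightarrow> ev (comult_iter A p b) (\<lambda>w. g (map2 (*) bs (tl w)) (ract N x (hd w)))) =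
        (case y of (_, x, bs) \<Rightarrow> HN.right_act b g bs x)"
      using HN.right.ev_comult_iter_diag_act[OF g, of bs b x] map2_flip[of "(*)" _ bs]
      by (simp add: HN.right_act_def)
  qed
  finally show ?thesis by (simp add: pair_NAp[OF Y])
qed

lemma right_lin_iff:
  assumes f: "f \<in> Csp A M N n p"
  shows "(\<forall>X\<in>AnM A M n. \<forall>b. f (ract_AnM A M n X b) = ract_NAp A N p (f X) b) \<longleftrightarrow> right_lin (dual n f)"
proof -
  have "f (ract_AnM A M n X b) = ract_NAp A N p (f X) b \<longleftrightarrow> (\<forall>g. multiN g \<longrightarrow>
      ev (rep X) (\<lambda>(as, m, _). dual n f g as (ract M m b)) =
      ev (rep X) (\<lambda>(as, m, _). dual n f (HN.right_act b g) as m))"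
    if X: "X \<in> AnM A M n" for X b
    by (simp add: qspace_eq_iff[OF Csp_NAp[OF f ract_AnM_in[OF X]] ract_NAp_in[OF Csp_NAp[OF f X]]]
      pair_ract_AnM[OF f X] pair_ract_NAp[OF Csp_NAp[OF f X]] pair_Csp[OF f multi_right_act X])
  then have "(\<forall>X\<in>AnM A M n. \<forall>b. f (ract_AnM A M n X b) = ract_NAp A N p (f X) b) \<longleftrightarrow>
      (\<forall>b. \<forall>X\<in>AnM A M n. \<forall>g. multiN g \<longrightarrow>
      ev (rep X) (\<lambda>(as, m, _). dual n f g as (ract M m b)) =
      ev (rep X) (\<lambda>(as, m, _). dual n f (HN.right_act b g) as m))"
    by blast
  also have "\<dots> \<longleftrightarrow> (\<forall>b g as m. multiN g \<longrightarrow> dual n f g as (ract M m b) = dual n f (HN.right_act b g) as m)"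
    by (intro iff_allI all_AnM_iff multi_ract multi_dual[OF f] multi_right_act) (auto simp: dual_support)
  finally show ?thesis by (auto simp: right_lin_def)
qed

text \<open>This form is \<open>g\<close> transposed along id \<otimes> \<open>f\<close>, with the
  head as the additional factor of A; 0 is a filler for the empty list.\<close>

lemma multi_tail_dual:
  assumes f: "f \<in> Csp A M N n p" and g: "multiN g"
  shows "multiM (\<lambda>as m. case as of [] \<Rightarrow> 0 | c # vs \<Rightarrow> dual n f (\<lambda>bs. g (c # bs)) vs m)"
proof -
  interpret F: cochain A M N "val n f" "dual n f" n p by (rule cochain_Csp[OF f])
  show ?thesis
    by (rule multi_split) (simp_all add: F.linform_F multi_head[OF g] F.multi_F multi_Cons[OF g])
qed

lemma lcoact_AnM_in:
  assumes X: "X \<in> AnM A M n"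
  shows "lcoact_AnM A M n X \<in> AnM A M (Suc n)"
  unfolding lcoact_AnM_def
  by (intro cls_in_qspace)
    (auto elim!: keys_bindE dest!: keys_AnM[OF X] keys_comult_each simp: mid_dom_def)

lemma pair_lcoact_AnM:
  assumes G: "multiM G"
  shows "pair (rep (lcoact_AnM A M n X)) G = ev (rep X) (\<lambda>(as, m, _). lco A M as m (\<lambda>c vs. G (c # vs)))"
  unfolding lcoact_AnM_def pair_rep_cls[OF G]
  by (simp add: pair_def lco_comult_each lam_def case_prod_unfold)

lemma id_tensor_in:
  assumes f: "f \<in> Csp A M N n p" and Z: "Z \<in> AnM A M (Suc n)"
  shows "id_tensor A M N n p f Z \<in> qspace (mrel A N 1 p) (mid_dom 1 p)"
  unfolding id_tensor_def
proof (intro cls_in_qspace keys_bind)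
  fix z assume "z \<in> Poly_Mapping.keys (rep Z)"
  then obtain as m where z: "z = (as, m, [])" "length as = Suc n"
    using keys_AnM[OF Z] by (metis prod_cases3)
  then have "length (tl as) = n" by simp
  from keys_NAp[OF Csp_simple[OF f this]]
  show "Poly_Mapping.keys (case z of (as, m, _) \<Rightarrow>
      bind (rep (f (cls (mrel A M n 0) (bas (tl as, m, []))))) (\<lambda>(_, x, bs). bas ([hd as], x, bs)))
      \<subseteq> mid_dom 1 p"
    unfolding z(1) prod.case by (intro keys_bind) (auto simp: mid_dom_def)
qed

lemma pair_id_tensor:
  assumes f: "f \<in> Csp A M N n p" and Z: "Z \<in> AnM A M (Suc n)" and g: "multiN g"
  shows "pair (rep (id_tensor A M N n p f Z)) g =
    pair (rep Z) (\<lambda>as m. case as of [] \<Rightarrow> 0 | c # vs \<Rightarrow> dual n f (\<lambda>bs. g (c # bs)) vs m)"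
  unfolding id_tensor_def pair_rep_cls[OF g] pair_AnM[OF Z] unfolding pair_def ev_bind
proof (intro ev_cong)
  fix z assume "z \<in> Poly_Mapping.keys (rep Z)"
  then obtain as m where z: "z = (as, m, [])" "length as = Suc n"
    using keys_AnM[OF Z] by (metis prod_cases3)
  then obtain c vs where "as = c # vs" "length vs = n" by (cases as) auto
  then show "ev (case z of (as, m, _) \<Rightarrow>
      bind (rep (f (cls (mrel A M n 0) (bas (tl as, m, []))))) (\<lambda>(_, x, bs). bas ([hd as], x, bs)))
      (\<lambda>(as, m, bs). g (as @ bs) m) =
    (case z of (as, m, _) \<Rightarrow> case as of [] \<Rightarrow> 0 | c # vs \<Rightarrow> dual n f (\<lambda>bs. g (c # bs)) vs m)"
    using z by (simp add: dual_def val_def case_prod_unfold)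
qed

lemma lcoact_NAp_in:
  assumes Y: "Y \<in> NAp A N p"
  shows "lcoact_NAp A N p Y \<in> qspace (mrel A N 1 p) (mid_dom 1 p)"
  unfolding lcoact_NAp_def
  by (intro cls_in_qspace)
    (auto elim!: keys_bindE dest!: keys_NAp[OF Y] HN.keys_lcoact simp: mid_dom_def)

lemma pair_lcoact_NAp:
  assumes Y: "Y \<in> NAp A N p" and g: "multiN g"
  shows "pair (rep (lcoact_NAp A N p Y)) g = pair (rep Y) (\<lambda>bs x. lam N x (\<lambda>c x0. g (c # bs) x0))"
proof -
  have "lam N x (\<lambda>c x0. g (c # bs) x0) = ev (rep (lcoact N x)) (\<lambda>z. g (fst z @ bs) (fst (snd z)))" for x bs
    unfolding lam_def by (intro ev_cong) (auto dest!: HN.keys_lcoact)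
  then show ?thesis
    unfolding lcoact_NAp_def pair_rep_cls[OF g] pair_NAp[OF Y] by (simp add: pair_def case_prod_unfold)
qed

text \<open>Inverse to fixing the head: a linear family of forms becomes one form on A \<otimes> N
  \<otimes> A^p.\<close>

lemma multi_cases_head:
  assumes "\<And>c. multiN (g c)" "\<And>bs x. linform (ascale A) (\<lambda>c. g c bs x)"
  shows "multiN (\<lambda>l x. case l of [] \<Rightarrow> 0 | c # bs \<Rightarrow> g c bs x)"
  by (rule multi_split) (simp_all add: assms)

lemma left_colin_iff:
  assumes f: "f \<in> Csp A M N n p"
  shows "(\<forall>X\<in>AnM A M n. id_tensor A M N n p f (lcoact_AnM A M n X) = lcoact_NAp A N p (f X)) \<longleftrightarrow>
    left_colin (dual n f)"
proof -
  interpret F: cochain A M N "val n f" "dual n f" n p by (rule cochain_Csp[OF f])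
  have multi_lam_Cons: "multiN (\<lambda>bs x. lam N x (\<lambda>c x0. g (c # bs) x0))" if "multiN g" for g
    using that by (intro HN.multi_lam multi_Cons multi_head)
  have "id_tensor A M N n p f (lcoact_AnM A M n X) = lcoact_NAp A N p (f X) \<longleftrightarrow> (\<forall>g. multiN g \<longrightarrow>
      ev (rep X) (\<lambda>(as, m, _). lco A M as m (\<lambda>c. dual n f (\<lambda>bs. g (c # bs)))) =
      ev (rep X) (\<lambda>(as, m, _). dual n f (\<lambda>bs x. lam N x (\<lambda>c x0. g (c # bs) x0)) as m))"
    if X: "X \<in> AnM A M n" for X
    by (simp add: qspace_eq_iff[OF id_tensor_in[OF f lcoact_AnM_in[OF X]] lcoact_NAp_in[OF Csp_NAp[OF f X]]]
      pair_id_tensor[OF f lcoact_AnM_in[OF X]] pair_lcoact_AnM[OF multi_tail_dual[OF f]]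
      pair_lcoact_NAp[OF Csp_NAp[OF f X]] pair_Csp[OF f multi_lam_Cons X])
  then have "(\<forall>X\<in>AnM A M n. id_tensor A M N n p f (lcoact_AnM A M n X) = lcoact_NAp A N p (f X)) \<longleftrightarrow>
      (\<forall>X\<in>AnM A M n. \<forall>g. multiN g \<longrightarrow>
      ev (rep X) (\<lambda>(as, m, _). lco A M as m (\<lambda>c. dual n f (\<lambda>bs. g (c # bs)))) =
      ev (rep X) (\<lambda>(as, m, _). dual n f (\<lambda>bs x. lam N x (\<lambda>c x0. g (c # bs) x0)) as m))"
    by blast
  also have "\<dots> \<longleftrightarrow> (\<forall>g as m. multiN g \<longrightarrow> lco A M as m (\<lambda>c. dual n f (\<lambda>bs. g (c # bs))) =
      dual n f (\<lambda>bs x. lam N x (\<lambda>c x0. g (c # bs) x0)) as m)"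
  proof (rule all_AnM_iff)
    show "multiM (\<lambda>as m. lco A M as m (\<lambda>c. dual n f (\<lambda>bs. g (c # bs))))" if "multiN g" for g
      using that by (intro HM.multi_lco F.multi_F multi_Cons F.linform_F multi_head)
    show "multiM (dual n f (\<lambda>bs x. lam N x (\<lambda>c x0. g (c # bs) x0)))" if "multiN g" for g
      using that by (intro F.multi_F multi_lam_Cons)
    show "lco A M as m (\<lambda>c. dual n f (\<lambda>bs. g (c # bs))) = dual n f (\<lambda>bs x. lam N x (\<lambda>c x0. g (c # bs) x0)) as m"
      if "length as \<noteq> n" for g as m
    proof -
      have "lco A M as m (\<lambda>c. dual n f (\<lambda>bs. g (c # bs))) = lco A M as m (\<lambda>_ _ _. 0)"
        using that by (intro lco_cong) (simp add: dual_support)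
      then show ?thesis using that by (simp add: dual_support)
    qed
  qed
  \<comment> \<open>Single forms on longer lists and linear families of forms are interchangeable:
    \<open>g (c # bs)\<close> in one direction, \<open>multi_cases_head\<close> in the
    other.\<close>
  also have "\<dots> \<longleftrightarrow> left_colin (dual n f)"
  proof
    assume L: "\<forall>g as m. multiN g \<longrightarrow> lco A M as m (\<lambda>c. dual n f (\<lambda>bs. g (c # bs))) =
      dual n f (\<lambda>bs x. lam N x (\<lambda>c x0. g (c # bs) x0)) as m"
    show "left_colin (dual n f)"
      unfolding left_colin_def
    proof (intro allI impI)
      fix g as m
      assume "\<forall>c. multiN (g c)" "\<forall>bs x. linform (ascale A) (\<lambda>c. g c bs x)"
      then have "multiN (\<lambda>l x. case l of [] \<Rightarrow> 0 | c # bs \<Rightarrow> g c bs x)"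
        by (intro multi_cases_head) auto
      from L[rule_format, OF this, of as m]
      show "lco A M as m (\<lambda>c. dual n f (g c)) = dual n f (\<lambda>bs x. lam N x (\<lambda>c x0. g c bs x0)) as m"
        by simp
    qed
  qed (simp add: left_colin_def multi_Cons multi_head)
  finally show ?thesis .
qed

section \<open>Stability of T under both differentials\<close>

lemma Tsp_iff: "f \<in> Tsp A M N n p \<longleftrightarrow> f \<in> Csp A M N n p \<and> right_lin (dual n f) \<and> left_colin (dual n f)"
  using right_lin_iff left_colin_iff unfolding Tsp_def by blast

lemma d_m_Tsp:
  assumes "f \<in> Tsp A M N n p"
  shows "d_m A M N n p f \<in> Tsp A M N (Suc n) p"
proof -
  have f: "f \<in> Csp A M N n p" "right_lin (dual n f)" "left_colin (dual n f)"
    using assms by (auto simp: Tsp_iff)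
  note F = cochain_Csp[OF f(1)]
  have "right_lin (dm_form n (dual n f))" "left_colin (dm_form n (dual n f))"
    unfolding dm_form_def[abs_def]
    by (intro right_lin_ev left_colin_ev cochain.right_lin_bface[OF F] cochain.left_colin_bface[OF F] f)+
  then show ?thesis
    using right_lin_cong[OF dual_d_m[OF f(1)]] left_colin_cong[OF dual_d_m[OF f(1)]]
    by (simp add: Tsp_iff d_m_Csp[OF f(1)])
qed

lemma d_c_Tsp:
  assumes "f \<in> Tsp A M N n p"
  shows "d_c A M N n p f \<in> Tsp A M N n (Suc p)"
proof -
  have f: "f \<in> Csp A M N n p" "right_lin (dual n f)" "left_colin (dual n f)"
    using assms by (auto simp: Tsp_iff)
  note F = cochain_Csp[OF f(1)]
  have "right_lin (dc_form p (dual n f))" "left_colin (dc_form p (dual n f))"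
    unfolding dc_form_def[abs_def]
    by (intro right_lin_ev left_colin_ev cochain.right_lin_cface[OF F] cochain.left_colin_cface[OF F] f)+
  then show ?thesis
    using right_lin_cong[OF dual_d_c[OF f(1)]] left_colin_cong[OF dual_d_c[OF f(1)]]
    by (simp add: Tsp_iff d_c_Csp[OF f(1)])
qed

end

theorem mainTheorem8:
  fixes A :: "('k::field, 'a::ring_1) bialg"
    and M :: "('k, 'a, 'm::ab_group_add) hbim"
    and N :: "('k, 'a, 'n::ab_group_add) hbim"
  assumes "bialgebra A"
    and "hopf_bimodule A M"
    and "hopf_bimodule A N"
  shows "(\<forall>n p. d_m A M N n p ` Tsp A M N n p \<subseteq> Tsp A M N (Suc n) p \<and>
                d_c A M N n p ` Tsp A M N n p \<subseteq> Tsp A M N n (Suc p)) \<and>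
         double_complex (Tsp A M N) (d_m A M N) (d_c A M N) (zero_cochain A M N)"
proof -
  interpret hopf_pair A M N
    by (intro hopf_pair.intro assms)
  have "f \<in> Csp A M N n p" if "f \<in> Tsp A M N n p" for f n p
    using that by (simp add: Tsp_iff)
  then show ?thesis
    unfolding double_complex_def using d_m_Tsp d_c_Tsp d_m_d_m d_c_d_c d_c_d_m by blast
qed

end
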